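(* Let $1< p < \infty$, $m \in \mathbb{N}$, $0 \le \ell < d$, and $a \in \mathbb{R}$. Then there exists a constant $c$ such that $$\|u\cdot v|\mathcal{K}^{m}_{a,p} (\mathbb{R}^d,\mathbb{R}^\ell_* )\| \le c \, \big(\|u|\mathcal{K}^{m}_{a,p} (\mathbb{R}^d,\mathbb{R}^\ell_* )\| \, \|v|L_\infty (\mathbb{R}^d)\| + \|v|\mathcal{K}^{m}_{a,p} (\mathbb{R}^d,\mathbb{R}^\ell_* )\|\, \|u|L_\infty (\mathbb{R}^d)\|\big)$$ holds for all $u, v \in \mathcal{K}^{m}_{a,p} (\mathbb{R}^d,\mathbb{R}^\ell_* )\cap L_\infty (\mathbb{R}^d)$.
   Context: $\mathbb{N}=\{1,2,\dots\}$, $\mathbb{N}_0=\mathbb{N}\cup\{0\}$. For an integer $0\le\ell<d$ put $\mathbb{R}^\ell_*=\{x\in\mathbb{R}^d: x_1=\dots=x_{d-\ell}=0\}$ (so $\mathbb{R}^0_*=\{0\}$) and $\rho(x)=\min\big(1,(\sum_{i=1}^{d-\ell}|x_i|^2)^{1/2}\big)$. For $m\in\mathbb{N}_0$, $a\in\mathbb{R}$, $1\le p<\infty$, the Kondratiev space $\mathcal{K}^m_{a,p}(\mathbb{R}^d,\mathbb{R}^\ell_* )$ consists of all measurable functions $u$ on $\mathbb{R}^d\setminus\mathbb{R}^\ell_*$ having weak derivatives $\partial^\alpha u$, $|\alpha|\le m$, in $\mathbb{R}^d\setminus\mathbb{R}^\ell_*$ with $\|u|\mathcal{K}^m_{a,p}(\mathbb{R}^d,\mathbb{R}^\ell_*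 )\|=\big(\sum_{|\alpha|\le m}\int_{\mathbb{R}^d\setminus\mathbb{R}^\ell_*}|\rho(x)^{|\alpha|-a}\partial^\alpha u(x)|^p\,dx\big)^{1/p}<\infty$. *)

theory Defs
  imports "HOL-Analysis.Analysis" "HOL-Probability.Essential_Supremum"
begin

text \<open>
  The space \<open>\<real>\<^sup>d\<close> is \<open>real ^ 'n\<close> with \<open>d = CARD('n)\<close>. The linear order on the index type fixes
  the numbering of the coordinates: the index \<open>i\<close> is number \<open>card {..<i} + 1\<close>.
  Functions take values in \<open>'b :: {real_normed_field, euclidean_space}\<close>; both \<open>real\<close> and
  \<open>complex\<close> are instances.
\<close>

definition leading_coords :: "nat \<Rightarrow> 'n::{finite,linorder} set" where
  "leading_coords l = {i. card {..<i} + 1 \<le> CARD('n) - l}"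

definition Rstar :: "nat \<Rightarrow> (real ^ 'n::{finite,linorder}) set" where
  "Rstar l = {x. \<forall>i\<in>leading_coords l. x $ i = 0}"

definition rho :: "nat \<Rightarrow> real ^ 'n::{finite,linorder} \<Rightarrow> real" where
  "rho l x = min 1 (sqrt (\<Sum>i\<in>leading_coords l. \<bar>x $ i\<bar>\<^sup>2))"

definition mi_order :: "('n::finite \<Rightarrow> nat) \<Rightarrow> nat" where
  "mi_order \<alpha> = (\<Sum>i\<in>UNIV. \<alpha> i)"

definition partial :: "'n \<Rightarrow> (real ^ 'n::finite \<Rightarrow> real) \<Rightarrow> real ^ 'n \<Rightarrow> real" where
  "partial i f x = frechet_derivative f (at x) (axis i 1)"

definition mpartial ::
    "('n \<Rightarrow> nat) \<Rightarrow> (real ^ 'n::{finite,linorder} \<Rightarrow> real) \<Rightarrow> real ^ 'n::{finite,linorder} \<Rightarrow> real" where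
  "mpartial \<alpha> f = foldr (\<lambda>i. partial i ^^ \<alpha> i) (sorted_list_of_set UNIV) f"

text \<open>
  If all iterated partial derivatives, in any order, are (totally) differentiable, then they are
  all continuous; hence this is \<open>C\<^sup>\<infinity>\<close>.
\<close>

definition smooth :: "(real ^ 'n::finite \<Rightarrow> real) \<Rightarrow> bool" where
  "smooth f \<longleftrightarrow> (\<forall>is x. foldr partial is f differentiable (at x))"

definition test_functions :: "(real ^ 'n::finite) set \<Rightarrow> (real ^ 'n \<Rightarrow> real) set" where
  "test_functions \<Omega> =
     {\<phi>. smooth \<phi> \<and> compact (closure {x. \<phi> x \<noteq> 0}) \<and> closure {x. \<phi> x \<noteq> 0} \<subseteq> \<Omega>}"

definition locally_integrable ::
    "(real ^ 'n::finite) set \<Rightarrow> (real ^ 'n \<Rightarrow> 'b::euclidean_space) \<Rightarrow> bool" where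
  "locally_integrable \<Omega> f \<longleftrightarrow> (\<forall>K. compact K \<and> K \<subseteq> \<Omega> \<longrightarrow> f absolutely_integrable_on K)"

definition has_weak_derivative ::
    "(real ^ 'n::{finite,linorder}) set \<Rightarrow> ('n \<Rightarrow> nat) \<Rightarrow>
     (real ^ 'n::{finite,linorder} \<Rightarrow> 'b::euclidean_space) \<Rightarrow> (real ^ 'n::{finite,linorder} \<Rightarrow> 'b) \<Rightarrow> bool" where
  "has_weak_derivative \<Omega> \<alpha> u w \<longleftrightarrow>
     locally_integrable \<Omega> u \<and> locally_integrable \<Omega> w \<and>
     (\<forall>\<phi>\<in>test_functions \<Omega>.
        (LINT x:\<Omega>|lebesgue. mpartial \<alpha> \<phi> x *\<^sub>R u x) =
        (-1) ^ mi_order \<alpha> *\<^sub>R (LINT x:\<Omega>|lebesgue. \<phi> x *\<^sub>R w x))"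

text \<open>
  Weak derivatives are unique only up to null sets; a representative is chosen, on which the
  integrals below do not depend.
\<close>

definition weak_derivative ::
    "(real ^ 'n::{finite,linorder}) set \<Rightarrow> ('n \<Rightarrow> nat) \<Rightarrow>
     (real ^ 'n::{finite,linorder} \<Rightarrow> 'b::euclidean_space) \<Rightarrow> real ^ 'n::{finite,linorder} \<Rightarrow> 'b" where
  "weak_derivative \<Omega> \<alpha> u = (SOME w. has_weak_derivative \<Omega> \<alpha> u w)"

definition kondratiev_integrand ::
    "real \<Rightarrow> real \<Rightarrow> nat \<Rightarrow> ('n \<Rightarrow> nat) \<Rightarrow>
     (real ^ 'n::{finite,linorder} \<Rightarrow> 'b::euclidean_space) \<Rightarrow> real ^ 'n::{finite,linorder} \<Rightarrow> real" where
  "kondratiev_integrand a p l \<alpha> u x =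
     norm (rho l x powr (real (mi_order \<alpha>) - a) *\<^sub>R weak_derivative (- Rstar l) \<alpha> u x) powr p"

definition kondratiev_space ::
    "nat \<Rightarrow> real \<Rightarrow> real \<Rightarrow> nat \<Rightarrow> (real ^ 'n::{finite,linorder} \<Rightarrow> 'b::euclidean_space) set" where
  "kondratiev_space m a p l =
     {u. u \<in> borel_measurable (lebesgue_on (- Rstar l)) \<and>
         (\<forall>\<alpha>. mi_order \<alpha> \<le> m \<longrightarrow>
            (\<exists>w. has_weak_derivative (- Rstar l) \<alpha> u w) \<and>
            set_integrable lebesgue (- Rstar l) (kondratiev_integrand a p l \<alpha> u))}"

text \<open>Meaningful only on \<open>kondratiev_space m a p l\<close>: divergent integrals have the value \<open>0\<close>.\<close>

definition kondratiev_norm ::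
    "nat \<Rightarrow> real \<Rightarrow> real \<Rightarrow> nat \<Rightarrow> (real ^ 'n::{finite,linorder} \<Rightarrow> 'b::euclidean_space) \<Rightarrow> real" where
  "kondratiev_norm m a p l u =
     (\<Sum>\<alpha> | mi_order \<alpha> \<le> m.
        LINT x:(- Rstar l)|lebesgue. kondratiev_integrand a p l \<alpha> u x) powr (1 / p)"

definition Linf_esssup :: "(real ^ 'n::finite \<Rightarrow> 'b::euclidean_space) \<Rightarrow> ereal" where
  "Linf_esssup u = esssup lebesgue (\<lambda>x. ereal (norm (u x)))"

definition Linf_space :: "(real ^ 'n::finite \<Rightarrow> 'b::euclidean_space) set" where
  "Linf_space = {u. u \<in> borel_measurable lebesgue \<and> Linf_esssup u < \<infinity>}"

definition Linf_norm :: "(real ^ 'n::finite \<Rightarrow> 'b::euclidean_space) \<Rightarrow> real" where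
  "Linf_norm u = real_of_ereal (Linf_esssup u)"

end

theory Submission
  imports Defs "HOL-Computational_Algebra.Polynomial"
begin

text \<open>
  By the Leibniz rule the estimate is about products \<open>\<partial>\<^sup>\<gamma> u \<partial>\<^sup>\<epsilon> v\<close> with \<open>\<bar>\<gamma>\<bar> + \<bar>\<epsilon>\<bar> = n \<le> m\<close>. They are bounded
  pointwise, without Gagliardo-Nirenberg inequalities for norms. For a mollifier \<open>\<phi>\<close> whose scale
  derivative \<open>t \<partial>\<^sub>t \<phi>\<^sub>t\<close> is a sum of derivatives of order above \<open>m\<close> one has, for \<open>0 < s \<le> t \<le> \<rho>(x) / 2\<close>
  and \<open>\<bar>\<gamma>\<bar> = j\<close>,
  \<open>\<bar>(\<partial>\<^sup>\<gamma> u * \<phi>\<^sub>s)(x)\<bar> \<le> C (t^(-j) M u (x) + t^(n - j) M (\<partial>\<^sup>n u) (x))\<close>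
  with a local maximal function \<open>M\<close>: the difference between the scales \<open>s\<close> and \<open>t\<close> is controlled by the
  derivatives of order \<open>n\<close>, and at scale \<open>t\<close> all derivatives are moved to the kernel. Since
  \<open>M u \<le> C \<parallel>u\<parallel>\<close> with the supremum norm, the best choice of \<open>t\<close> gives
  \<open>\<rho>^j \<bar>\<partial>\<^sup>\<gamma> u * \<phi>\<^sub>s\<bar> \<le> C \<parallel>u\<parallel> \<kappa>^j\<close> with \<open>\<parallel>u\<parallel> \<kappa>^n = M u + \<rho>^n M (\<partial>\<^sup>n u)\<close>. Multiplying the bounds for \<open>u\<close>
  and \<open>v\<close> and using \<open>\<kappa>^j \<lambda>^k \<le> \<kappa>^n + \<lambda>^n\<close> for \<open>j + k = n\<close>, the product is at most
  \<open>C (\<parallel>v\<parallel> (M u + \<rho>^n M (\<partial>\<^sup>n u)) + \<parallel>u\<parallel> (M v + \<rho>^n M (\<partial>\<^sup>n v)))\<close>. On balls of radius \<open>\<rho>(x) / 2\<close> the weight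
  is comparable to \<open>\<rho>(x)\<close>, so the Hardy-Littlewood theorem, where \<open>p > 1\<close> enters, bounds this in the
  weighted \<open>L\<^sup>p\<close> norm. The same bound is uniform in \<open>s\<close> and dominates the passage \<open>s \<rightarrow> 0\<close> in the Leibniz
  rule for the mollified functions.
\<close>

subsection \<open>Calculus of smooth functions\<close>

text \<open>Derivatives of \<open>u\<close> and \<open>v\<close> of intermediate order are in
  general unbounded, and nothing known beforehand makes their products locally integrable. So
  membership of the product in the space is itself part of what has to be proved, and the chosen
  representative behind \<open>weak_derivative\<close> can be reached only through uniqueness of
  weak derivatives. The kernel comes from a correction process: adding a suitable multiple of
  \<open>euler \<phi>\<close> to \<open>\<phi>\<close> makes the scale derivative a sum of
  derivatives of one order more and leaves the integral unchanged. Scales stop at half the weight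
  for three reasons: the balls stay off \<open>Rstar l\<close>, the weight changes on them by a
  factor of at most two, and the radii remain below 1. For each factor a single envelope, the sum of
  the maximal functions of all weighted derivatives up to order \<open>m\<close>, stands for both
  \<open>M u\<close> and the weighted \<open>M (\<partial>\<^sup>n u)\<close>, so that it serves
  every order at once. The sup bounds are kept strictly positive, because the balancing parameter is
  a root of a quotient by them; the norms are reached only in a final limit.\<close>

lemma partial_eq: "(f has_derivative f') (at x) \<Longrightarrow> partial i f x = f' (axis i 1)"
  unfolding partial_def using frechet_derivative_at by metis

lemma partial_has_vector_derivative:
  assumes "f differentiable (at x)"
  shows "((\<lambda>t. f (x + t *\<^sub>R axis i 1)) has_real_derivative partial i f x) (at 0)"
proof -
  have f: "(f has_derivative frechet_derivative f (at x)) (at (x + 0 *\<^sub>R axis i 1))"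
    using assms by (simp add: frechet_derivative_works)
  have "((\<lambda>t. x + t *\<^sub>R axis i 1) has_derivative (\<lambda>t. t *\<^sub>R axis i 1)) (at 0)"
    by (auto intro!: derivative_eq_intros)
  from diff_chain_at[OF this f]
  have "((\<lambda>t. f (x + t *\<^sub>R axis i 1)) has_derivative
      (\<lambda>t. frechet_derivative f (at x) (t *\<^sub>R axis i 1))) (at 0)"
    by (simp add: o_def)
  then show ?thesis
    using linear_cmul[OF linear_frechet_derivative[OF assms]]
    by (simp add: has_field_derivative_def partial_def mult_commute_abs)
qed

lemma partial_along_line:
  assumes "\<And>x. f differentiable (at x)"
  shows "((\<lambda>t. f (x + t *\<^sub>R axis i 1)) has_real_derivative partial i f (x + s *\<^sub>R axis i 1)) (at s)"
proof -
  have "((\<lambda>t. f ((x + s *\<^sub>R axis i 1) + t *\<^sub>R axis i 1)) has_real_derivative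
      partial i f (x + s *\<^sub>R axis i 1)) (at (0::real))"
    by (rule partial_has_vector_derivative[OF assms])
  then have "((\<lambda>t. f (x + (s + t) *\<^sub>R axis i 1)) has_real_derivative
      partial i f (x + s *\<^sub>R axis i 1)) (at (0::real))"
    by (simp add: algebra_simps)
  with DERIV_shift[of "\<lambda>t. f (x + t *\<^sub>R axis i 1)" _ 0 s] show ?thesis
    by (simp add: add.commute)
qed

lemma partial_add:
  "f differentiable (at x) \<Longrightarrow> g differentiable (at x) \<Longrightarrow>
    partial i (\<lambda>x. f x + g x) x = partial i f x + partial i g x"
  by (simp add: frechet_derivative_works partial_eq[OF has_derivative_add] partial_def[of _ f] partial_def[of _ g])

lemma partial_mult:
  "f differentiable (at x) \<Longrightarrow> g differentiable (at x) \<Longrightarrow>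
    partial i (\<lambda>x. f x * g x) x = f x * partial i g x + partial i f x * g x"
  by (simp add: frechet_derivative_works partial_eq[OF has_derivative_mult] partial_def[of _ f] partial_def[of _ g])

lemma partial_const: "partial i (\<lambda>x. c) = (\<lambda>x. 0)"
  by (simp add: fun_eq_iff partial_def)

lemma partial_coord: "partial i (\<lambda>x. x $ j) = (\<lambda>x. if i = j then 1 else 0)"
proof
  fix x :: "real^'a"
  have "((\<lambda>x. x $ j) has_derivative (\<lambda>x. x $ j)) (at x)"
    by (rule bounded_linear_imp_has_derivative[OF bounded_linear_vec_nth])
  from partial_eq[OF this] show "partial i (\<lambda>x. x $ j) x = (if i = j then 1 else 0)"
    by (simp add: axis_def eq_commute)
qed

lemma partial_cong_open:
  assumes "open S" "x \<in> S" "\<And>y. y \<in> S \<Longrightarrow> f y = g y"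
  shows "partial i f x = partial i g x"
proof (cases "f differentiable (at x)")
  case True
  then have "(f has_derivative frechet_derivative f (at x)) (at x)"
    by (simp add: frechet_derivative_works)
  then have "(g has_derivative frechet_derivative f (at x)) (at x)"
    by (rule has_derivative_transform_within_open[OF _ assms])
  then show ?thesis by (simp add: partial_def frechet_derivative_at[symmetric])
next
  case False
  \<comment> \<open>Where no derivative exists, \<open>frechet_derivative\<close> is a choice from
    the empty predicate, and this is the same choice for \<open>f\<close> and
    \<open>g\<close>.\<close>
  have "\<not> (\<exists>f'. (g has_derivative f') (at x))" "\<not> (\<exists>f'. (f has_derivative f') (at x))"
    using False has_derivative_transform_within_open[OF _ assms(1,2), of g _ UNIV f] assms(3)
    unfolding differentiable_def by auto
  then show ?thesis by (simp add: partial_def frechet_derivative_def)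
qed

lemma partial_affine:
  fixes f :: "real^'n::finite \<Rightarrow> real"
  assumes "\<And>x. f differentiable (at x)"
  shows "partial i (\<lambda>y. f (c *\<^sub>R (y - x))) y = c * partial i f (c *\<^sub>R (y - x))"
    and "(\<lambda>y. f (c *\<^sub>R (y - x))) differentiable (at y)"
proof -
  have f: "(f has_derivative frechet_derivative f (at (c *\<^sub>R (y - x)))) (at (c *\<^sub>R (y - x)))"
    using assms by (simp add: frechet_derivative_works[symmetric])
  have "((\<lambda>y. c *\<^sub>R (y - x)) has_derivative (\<lambda>y. c *\<^sub>R y)) (at y)"
    by (auto intro!: derivative_eq_intros)
  from has_derivative_compose[OF this f]
  have *: "((\<lambda>y. f (c *\<^sub>R (y - x))) has_derivative
      (\<lambda>v. frechet_derivative f (at (c *\<^sub>R (y - x))) (c *\<^sub>R v))) (at y)" .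
  show "partial i (\<lambda>y. f (c *\<^sub>R (y - x))) y = c * partial i f (c *\<^sub>R (y - x))"
    using partial_eq[OF *] linear_cmul[OF linear_frechet_derivative[OF assms]]
    by (simp add: partial_def)
  show "(\<lambda>y. f (c *\<^sub>R (y - x))) differentiable (at y)"
    using * by (rule differentiableI)
qed

lemma smooth_differentiable: "smooth f \<Longrightarrow> f differentiable (at x)"
  unfolding smooth_def by (metis foldr.simps(1) id_apply)

lemma smooth_partial: assumes "smooth f" shows "smooth (partial i f)"
  unfolding smooth_def
proof safe
  fix "is" x
  have "foldr partial (is @ [i]) f differentiable (at x)"
    using assms unfolding smooth_def by blast
  then show "foldr partial is (partial i f) differentiable (at x)" by simp
qed

lemma smooth_continuous: "smooth f \<Longrightarrow> continuous_on S f"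
  by (meson smooth_differentiable differentiable_imp_continuous_on differentiable_at_withinI
      differentiable_on_def)

text \<open>Smooth functions form the largest class of differentiable functions closed under
  \<open>partial\<close>, so any class with these two properties witnesses smoothness.\<close>

lemma smooth_coinduct:
  assumes "P f" "\<And>g x. P g \<Longrightarrow> g differentiable (at x)" "\<And>g i. P g \<Longrightarrow> P (partial i g)"
  shows "smooth f"
proof -
  have "P (foldr partial is f)" for "is" by (induction "is") (auto simp: assms)
  then show ?thesis using assms(2) unfolding smooth_def by blast
qed

lemma smoothI:
  assumes "\<And>x. f differentiable (at x)" "\<And>i. smooth (partial i f)"
  shows "smooth f"
  unfolding smooth_def
proof safe
  fix "is" x
  show "foldr partial is f differentiable (at x)"
  proof (cases "is" rule: rev_cases)
    case Nil then show ?thesis using assms(1) by simp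
  next
    case (snoc xs i) then show ?thesis using assms(2)[of i] by (simp add: smooth_def)
  qed
qed

lemma smooth_const: "smooth (\<lambda>x. c)"
  by (rule smooth_coinduct[where P = "\<lambda>f. \<exists>c. f = (\<lambda>x. c)"]) (auto simp: partial_const)

lemma smooth_coord: "smooth (\<lambda>x. x $ j)"
  by (rule smoothI)
    (auto simp: partial_coord smooth_const
      intro!: bounded_linear_imp_differentiable bounded_linear_vec_nth)

lemma smooth_add: assumes "smooth f" "smooth g" shows "smooth (\<lambda>x. f x + g x)"
proof (rule smooth_coinduct[where P = "\<lambda>h. \<exists>f g. smooth f \<and> smooth g \<and> h = (\<lambda>x. f x + g x)"])
  show "\<exists>f g. smooth f \<and> smooth g \<and> partial i h = (\<lambda>x. f x + g x)"
    if h: "\<exists>f g. smooth f \<and> smooth g \<and> h = (\<lambda>x. f x + g x)" for h i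
  proof -
    from h obtain f g where fg: "smooth f" "smooth g" "h = (\<lambda>x. f x + g x)" by blast
    have "partial i h = (\<lambda>x. partial i f x + partial i g x)"
      unfolding fg(3) using fg(1,2) by (simp add: fun_eq_iff partial_add smooth_differentiable)
    with fg smooth_partial show ?thesis by blast
  qed
  show "h differentiable (at x)"
    if h: "\<exists>f g. smooth f \<and> smooth g \<and> h = (\<lambda>x. f x + g x)" for h x
    using h differentiable_add[OF smooth_differentiable smooth_differentiable] by blast
qed (use assms in blast)

text \<open>The product rule leads from products to sums of products. This class is closed under
  \<open>partial\<close> and so serves as the invariant for \<open>smooth_coinduct\<close>.\<close>

inductive sum_of_products :: "(real^'n::finite \<Rightarrow> real) \<Rightarrow> bool" where
  prod: "smooth f \<Longrightarrow> smooth g \<Longrightarrow> sum_of_products (\<lambda>x. f x * g x)"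
| add: "sum_of_products f \<Longrightarrow> sum_of_products g \<Longrightarrow> sum_of_products (\<lambda>x. f x + g x)"

lemma smooth_mult: assumes "smooth f" "smooth g" shows "smooth (\<lambda>x. f x * g x)"
proof -
  have d: "h differentiable (at x)" if "sum_of_products h" for h :: "real^'n \<Rightarrow> real" and x
    using that by induction (auto intro!: differentiable_mult differentiable_add intro: smooth_differentiable)
  have p: "sum_of_products (partial i h)" if "sum_of_products h" for h :: "real^'n \<Rightarrow> real" and i
      using that
    proof induction
      case (prod f g)
      have "partial i (\<lambda>x. f x * g x) = (\<lambda>x. (f x * partial i g x) + (partial i f x * g x))"
        using prod by (simp add: fun_eq_iff partial_mult smooth_differentiable)
      then show ?case
        using prod by (auto intro!: sum_of_products.intros smooth_partial)
    next
      case (add f g)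
      then have "partial i (\<lambda>x. f x + g x) = (\<lambda>x. partial i f x + partial i g x)"
        by (simp add: fun_eq_iff partial_add d)
      with add show ?case by (auto intro: sum_of_products.intros)
    qed
  show ?thesis
    by (rule smooth_coinduct[where P = sum_of_products, OF sum_of_products.prod[OF assms] d p])
qed

lemma smooth_cmult: "smooth f \<Longrightarrow> smooth (\<lambda>x. c * f x)"
  by (intro smooth_mult smooth_const)

lemma smooth_sum: "(\<And>i. i \<in> I \<Longrightarrow> smooth (f i)) \<Longrightarrow> smooth (\<lambda>x. \<Sum>i\<in>I. f i x)"
  by (induction I rule: infinite_finite_induct) (auto simp: smooth_const smooth_add)

lemma smooth_prod: "(\<And>i. i \<in> I \<Longrightarrow> smooth (f i)) \<Longrightarrow> smooth (\<lambda>x. \<Prod>i\<in>I. f i x)"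
  by (induction I rule: infinite_finite_induct) (auto simp: smooth_const smooth_mult)

lemma partial_sum:
  "(\<And>i. i \<in> I \<Longrightarrow> smooth (f i)) \<Longrightarrow>
    partial j (\<lambda>x. \<Sum>i\<in>I. f i x) x = (\<Sum>i\<in>I. partial j (f i) x)"
  by (induction I rule: infinite_finite_induct)
    (auto simp: partial_const partial_add smooth_differentiable smooth_sum)

lemma partial_cmult: "smooth f \<Longrightarrow> partial i (\<lambda>x. c * f x) = (\<lambda>x. c * partial i f x)"
  by (simp add: fun_eq_iff partial_mult smooth_differentiable partial_const)

lemma smooth_affine:
  assumes "smooth f" shows "smooth (\<lambda>y. f (c *\<^sub>R (y - x)))"
\<comment> \<open>Each derivative brings out a factor \<open>c\<close>; the scalar \<open>k\<close>
  absorbs these factors and keeps the class closed.\<close>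
proof (rule smooth_coinduct[where P = "\<lambda>h. \<exists>f k. smooth f \<and> h = (\<lambda>y. k * f (c *\<^sub>R (y - x)))"])
  show "\<exists>g k. smooth g \<and> (\<lambda>y. f (c *\<^sub>R (y - x))) = (\<lambda>y. k * g (c *\<^sub>R (y - x)))"
    using assms by (intro exI[of _ f] exI[of _ 1]) simp
  show "h differentiable (at y)"
    if "\<exists>f k. smooth f \<and> h = (\<lambda>y. k * f (c *\<^sub>R (y - x)))" for h y
    using that partial_affine(2)[OF smooth_differentiable] by (auto intro!: differentiable_mult)
  show "\<exists>f k. smooth f \<and> partial i h = (\<lambda>y. k * f (c *\<^sub>R (y - x)))"
    if h: "\<exists>f k. smooth f \<and> h = (\<lambda>y. k * f (c *\<^sub>R (y - x)))" for h i
  proof -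
    from h obtain f k where f: "smooth f" "h = (\<lambda>y. k * f (c *\<^sub>R (y - x)))" by blast
    have "partial i h y = (k * c) * partial i f (c *\<^sub>R (y - x))" for y
      unfolding f(2) using smooth_differentiable[OF f(1)]
      by (subst partial_mult) (auto simp: partial_affine partial_const)
    then have "partial i h = (\<lambda>y. (k * c) * partial i f (c *\<^sub>R (y - x)))" by blast
    with f(1) smooth_partial show ?thesis by blast
  qed
qed

section \<open>Symmetry of mixed derivatives and multi-index derivatives\<close>

text \<open>The second difference in directions \<open>i\<close> and \<open>j\<close> is symmetric
  in them, and two applications of the mean value theorem express it by either mixed derivative at a
  nearby point. Continuity of both mixed derivatives then forces equality.\<close>

lemma partial_commute:
  fixes f :: "real^'n::finite \<Rightarrow> real"
  assumes "smooth f"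
  shows "partial i (partial j f) = partial j (partial i f)"
proof
  fix x
  have df: "smooth g \<Longrightarrow> g differentiable (at y)" for g :: "real^'n \<Rightarrow> real" and y
    by (rule smooth_differentiable)
  have key: "\<exists>y\<in>ball x (3 * h).
      f (x + h *\<^sub>R axis i 1 + h *\<^sub>R axis j 1) - f (x + h *\<^sub>R axis i 1) - f (x + h *\<^sub>R axis j 1) + f x
      = h^2 * partial i (partial j f) y" if h: "h > 0" for h i j
  proof -
    define \<phi> where "\<phi> = (\<lambda>t. f (x + h *\<^sub>R axis i 1 + t *\<^sub>R axis j 1) - f (x + t *\<^sub>R axis j 1))"
    have "\<exists>z>0. z < h \<and> \<phi> h - \<phi> 0 = (h - 0) * (partial j f (x + h *\<^sub>R axis i 1 + z *\<^sub>R axis j 1)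
        - partial j f (x + z *\<^sub>R axis j 1))"
      unfolding \<phi>_def
      by (rule MVT2[OF h]) (rule DERIV_diff; rule partial_along_line; rule df; rule assms)
    then obtain z where z: "0 < z" "z < h" "\<phi> h - \<phi> 0 = h *
        (partial j f (x + h *\<^sub>R axis i 1 + z *\<^sub>R axis j 1) - partial j f (x + z *\<^sub>R axis j 1))"
      by auto
    have "\<exists>w>0. w < h \<and> partial j f (x + z *\<^sub>R axis j 1 + h *\<^sub>R axis i 1)
        - partial j f (x + z *\<^sub>R axis j 1 + 0 *\<^sub>R axis i 1)
        = (h - 0) * partial i (partial j f) (x + z *\<^sub>R axis j 1 + w *\<^sub>R axis i 1)"
      by (rule MVT2[OF h]) (rule partial_along_line; rule df; rule smooth_partial; rule assms)
    then obtain w where w: "0 < w" "w < h" "partial j f (x + z *\<^sub>R axis j 1 + h *\<^sub>R axis i 1)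
        - partial j f (x + z *\<^sub>R axis j 1)
        = h * partial i (partial j f) (x + z *\<^sub>R axis j 1 + w *\<^sub>R axis i 1)"
      by auto
    have "norm (z *\<^sub>R axis j (1::real) + w *\<^sub>R axis i 1) \<le> z + w"
      by (rule order_trans[OF norm_triangle_ineq]) (use z w in simp)
    moreover have "dist x (x + z *\<^sub>R axis j 1 + w *\<^sub>R axis i 1) = norm (z *\<^sub>R axis j (1::real) + w *\<^sub>R axis i 1)"
      unfolding dist_norm by (subst norm_minus_commute) (simp add: add.assoc)
    ultimately have "x + z *\<^sub>R axis j 1 + w *\<^sub>R axis i 1 \<in> ball x (3 * h)"
      using z w h by simp
    moreover have "f (x + h *\<^sub>R axis i 1 + h *\<^sub>R axis j 1) - f (x + h *\<^sub>R axis i 1) - f (x + h *\<^sub>R axis j 1) + f x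
        = \<phi> h - \<phi> 0"
      by (simp add: \<phi>_def)
    moreover have "\<phi> h - \<phi> 0 = h^2 * partial i (partial j f) (x + z *\<^sub>R axis j 1 + w *\<^sub>R axis i 1)"
      using z(3) w(3) by (simp add: power2_eq_square algebra_simps)
    ultimately show ?thesis by auto
  qed
  have cont: "isCont (partial i (partial j f)) x" for i j
    using df[of "partial i (partial j f)" x] assms
    by (simp add: smooth_partial differentiable_imp_continuous_within)
  show "partial i (partial j f) x = partial j (partial i f) x"
  proof (rule ccontr)
    assume ne: "partial i (partial j f) x \<noteq> partial j (partial i f) x"
    define e where "e = \<bar>partial i (partial j f) x - partial j (partial i f) x\<bar> / 2"
    have "e > 0" using ne by (simp add: e_def)
    from cont[of i j, unfolded continuous_at_eps_delta, rule_format, OF this]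
    obtain d1 where d1: "d1 > 0"
      "\<And>y. dist y x < d1 \<Longrightarrow> dist (partial i (partial j f) y) (partial i (partial j f) x) < e" by metis
    from cont[of j i, unfolded continuous_at_eps_delta, rule_format, OF \<open>e > 0\<close>]
    obtain d2 where d2: "d2 > 0"
      "\<And>y. dist y x < d2 \<Longrightarrow> dist (partial j (partial i f) y) (partial j (partial i f) x) < e" by metis
    \<comment> \<open>The points from the mean value theorem lie within \<open>3 * h\<close>, which
      is now the smaller radius of continuity. As \<open>e\<close> is half the gap, two errors below
      \<open>e\<close> cannot bridge it.\<close>
    define h where "h = min d1 d2 / 3"
    have h: "h > 0" using d1 d2 by (simp add: h_def)
    obtain y where y: "y \<in> ball x (3*h)" "f (x + h *\<^sub>R axis i 1 + h *\<^sub>R axis j 1) -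
      f (x + h *\<^sub>R axis i 1) - f (x + h *\<^sub>R axis j 1) + f x = h^2 * partial i (partial j f) y"
      using key[OF h, of i j] by blast
    obtain z where z: "z \<in> ball x (3*h)" "f (x + h *\<^sub>R axis j 1 + h *\<^sub>R axis i 1) -
      f (x + h *\<^sub>R axis j 1) - f (x + h *\<^sub>R axis i 1) + f x = h^2 * partial j (partial i f) z"
      using key[OF h, of j i] by blast
    have "h^2 * partial i (partial j f) y = h^2 * partial j (partial i f) z"
      using y(2) z(2) by (simp add: algebra_simps)
    then have eq: "partial i (partial j f) y = partial j (partial i f) z" using h by simp
    have "dist (partial i (partial j f) y) (partial i (partial j f) x) < e"
      using y(1) by (intro d1(2)) (simp add: h_def dist_commute)
    moreover have "dist (partial j (partial i f) z) (partial j (partial i f) x) < e"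
      using z(1) by (intro d2(2)) (simp add: h_def dist_commute)
    ultimately show False
      unfolding eq by (simp add: e_def dist_real_def abs_if split: if_splits)
  qed
qed

lemma smooth_foldr_partial: "smooth f \<Longrightarrow> smooth (foldr partial is f)"
  by (induction "is") (auto intro: smooth_partial)

lemma partial_funpow_commute:
  "smooth f \<Longrightarrow> partial i ((partial j ^^ k) f) = (partial j ^^ k) (partial i f)"
  "smooth f \<Longrightarrow> smooth ((partial j ^^ k) f)"
proof -
  have 1: "smooth ((partial j ^^ k) f)" if "smooth f" for k f
    using that by (induction k) (auto simp: smooth_partial)
  show "smooth f \<Longrightarrow> smooth ((partial j ^^ k) f)" by (rule 1)
  show "smooth f \<Longrightarrow> partial i ((partial j ^^ k) f) = (partial j ^^ k) (partial i f)"
  proof (induction k)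
    case (Suc k)
    then show ?case using partial_commute[OF 1[OF Suc.prems], of i j k] by simp
  qed simp
qed

text \<open>\<open>mpartial\<close> differentiates in a fixed order, so the extra derivative has to
  be commuted to the place of \<open>i\<close> in the list. Distinctness of the list ensures that it
  is absorbed once.\<close>

lemma mpartial_partial:
  fixes f :: "real^'n::{finite,linorder} \<Rightarrow> real"
  assumes "smooth f"
  shows "mpartial \<alpha> (partial i f) = mpartial (\<alpha>(i := Suc (\<alpha> i))) f"
proof -
  let ?\<beta> = "\<alpha>(i := Suc (\<alpha> i))"
  have sm: "smooth (foldr (\<lambda>i. partial i ^^ \<alpha> i) xs f)" for xs and \<alpha> :: "'n \<Rightarrow> nat"
    by (induction xs) (auto simp: assms partial_funpow_commute)
  have sm': "smooth (foldr (\<lambda>i. partial i ^^ \<alpha> i) xs (partial i f))" for xs and \<alpha> :: "'n \<Rightarrow> nat"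
    by (induction xs) (auto simp: assms partial_funpow_commute smooth_partial)
  have out: "foldr (\<lambda>i. partial i ^^ \<alpha> i) xs (partial i f) = partial i (foldr (\<lambda>i. partial i ^^ \<alpha> i) xs f)"
    for xs
    by (induction xs) (auto simp: partial_funpow_commute sm)
  have notin: "foldr (\<lambda>i. partial i ^^ ?\<beta> i) xs f = foldr (\<lambda>i. partial i ^^ \<alpha> i) xs f"
    if "i \<notin> set xs" for xs
    using that by (induction xs) auto
  have "foldr (\<lambda>i. partial i ^^ ?\<beta> i) xs f = foldr (\<lambda>i. partial i ^^ \<alpha> i) xs (partial i f)"
    if "distinct xs" "i \<in> set xs" for xs
    using that
  proof (induction xs)
    case (Cons a xs)
    show ?case
    proof (cases "a = i")
      case True
      then have "i \<notin> set xs" using Cons.prems by simp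
      then have "foldr (\<lambda>i. partial i ^^ ?\<beta> i) (a # xs) f
          = partial i ((partial i ^^ \<alpha> i) (foldr (\<lambda>i. partial i ^^ \<alpha> i) xs f))"
        using notin True by simp
      also have "\<dots> = (partial i ^^ \<alpha> i) (foldr (\<lambda>i. partial i ^^ \<alpha> i) xs (partial i f))"
        by (simp add: partial_funpow_commute sm out)
      finally show ?thesis using True by simp
    next
      case False
      then show ?thesis using Cons by simp
    qed
  qed simp
  from this[of "sorted_list_of_set UNIV"] show ?thesis
    unfolding mpartial_def by simp
qed

lemma mpartial_zero: "mpartial (\<lambda>_. 0) f = f"
proof -
  have "foldr (\<lambda>i. partial i ^^ (0::nat)) xs f = f" for xs by (induction xs) auto
  then show ?thesis by (simp add: mpartial_def)
qed

lemma mi_order_upd: "mi_order (\<alpha>(i := Suc (\<alpha> i))) = Suc (mi_order \<alpha>)"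
proof -
  have "sum (\<alpha>(i := Suc (\<alpha> i))) UNIV = Suc (\<alpha> i) + sum (\<alpha>(i := Suc (\<alpha> i))) (UNIV - {i})"
    by (subst sum.remove[of _ i]) auto
  also have "sum (\<alpha>(i := Suc (\<alpha> i))) (UNIV - {i}) = sum \<alpha> (UNIV - {i})"
    by (rule sum.cong) auto
  also have "Suc (\<alpha> i) + sum \<alpha> (UNIV - {i}) = Suc (sum \<alpha> UNIV)"
    by (subst sum.remove[of UNIV i \<alpha>]) auto
  finally show ?thesis by (simp add: mi_order_def)
qed

subsection \<open>Smooth bumps on boxes\<close>

text \<open>With polynomials in \<open>1 / t\<close> as coefficients, the flat exponentials become a
  class closed under differentiation.\<close>

definition flat :: "real poly \<Rightarrow> real \<Rightarrow> real" where
  "flat q t = (if t > 0 then poly q (1 / t) * exp (- (1 / t)) else 0)"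

text \<open>Differentiating \<open>q(1/t) exp(-1/t)\<close> gives
  \<open>(q - q')(1/t) exp(-1/t) / t^2\<close>, and the polynomial \<open>[:0, 0, 1:]\<close> is the
  factor \<open>1/t^2\<close>. Only \<open>t = 0\<close> needs a limit.\<close>

lemma flat_deriv:
  "(flat q has_real_derivative flat ([:0, 0, 1:] * (q - pderiv q)) t) (at t)"
proof -
  consider "t < 0" | "t > 0" | "t = 0" by linarith
  then show ?thesis
  proof cases
    case 1
    have "((\<lambda>t. 0) has_real_derivative flat ([:0, 0, 1:] * (q - pderiv q)) t) (at t)"
      using 1 by (simp add: flat_def)
    then show ?thesis
      by (rule has_field_derivative_transform_within_open[where S="{..<0}"])
        (use 1 in \<open>auto simp: flat_def\<close>)
  next
    case 2
    have "((\<lambda>t. poly q (1 / t) * exp (- (1 / t))) has_real_derivative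
        flat ([:0, 0, 1:] * (q - pderiv q)) t) (at t)"
      using 2 by (auto intro!: derivative_eq_intros simp: flat_def field_simps power2_eq_square)
    then show ?thesis
      by (rule has_field_derivative_transform_within_open[where S="{0<..}"])
        (use 2 in \<open>auto simp: flat_def\<close>)
  next
    case 3
    \<comment> \<open>With \<open>s = 1 / t\<close> the right difference quotient at 0 becomes
      \<open>s q(s) exp(-s)\<close>, a finite sum of terms that the exponential kills.\<close>
    have "((\<lambda>s. \<Sum>i\<le>degree q. coeff q i * (s ^ Suc i / exp s)) \<longlongrightarrow> (\<Sum>i\<le>degree q. coeff q i * 0)) at_top"
      by (intro tendsto_intros tendsto_power_div_exp_0)
    also have "(\<lambda>s. \<Sum>i\<le>degree q. coeff q i * (s ^ Suc i / exp s)) = (\<lambda>s. poly q s * exp (- s) * s)"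
      by (auto simp: fun_eq_iff poly_altdef sum_distrib_left sum_distrib_right exp_minus field_simps intro!: sum.cong)
    finally have "((\<lambda>s. poly q s * exp (- s) * s) \<longlongrightarrow> 0) at_top" by simp
    then have "((\<lambda>t. poly q (inverse t) * exp (- inverse t) * inverse t) \<longlongrightarrow> 0) (at_right 0)"
      by (rule filterlim_compose[OF _ filterlim_inverse_at_top_right])
    then have r: "((\<lambda>t. flat q t / t) \<longlongrightarrow> 0) (at_right 0)"
      by (rule Lim_transform_eventually)
        (auto simp: flat_def eventually_at_right_less field_simps intro!: eventually_at_rightI[of 0 1])
    have l: "((\<lambda>t. flat q t / t) \<longlongrightarrow> 0) (at_left 0)"
      by (rule Lim_transform_eventually[OF tendsto_const])
        (auto simp: flat_def intro!: eventually_at_leftI[of "-1"])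
    show ?thesis
      using l r 3 by (simp add: has_field_derivative_iff flat_def filterlim_split_at)
  qed
qed

lemma smooth_flat_coord: "smooth (\<lambda>x::real^'n::finite. flat q (c * x $ i + b))"
proof (rule smooth_coinduct[where P = "\<lambda>h. \<exists>k q. h = (\<lambda>x. k * flat q (c * x $ i + b))"])
  have d: "((\<lambda>x. k * flat q (c * x $ i + b)) has_derivative
      (\<lambda>v. k * (flat ([:0, 0, 1:] * (q - pderiv q)) (c * x $ i + b) * (c * v $ i)))) (at x)"
    for k q and x :: "real^'n"
  proof -
    have "((\<lambda>x::real^'n. c * x $ i + b) has_derivative (\<lambda>v. c * v $ i)) (at x)"
      by (auto intro!: derivative_eq_intros bounded_linear_imp_has_derivative bounded_linear_vec_nth)
    from has_derivative_compose[OF this flat_deriv[unfolded has_field_derivative_def]]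
    show ?thesis by (intro has_derivative_mult_right) (simp add: mult.commute mult.left_commute)
  qed
  show "g differentiable (at x)" if "\<exists>k q. g = (\<lambda>x. k * flat q (c * x $ i + b))" for g x
    using that d differentiableI by blast
  show "\<exists>k q. partial j g = (\<lambda>x. k * flat q (c * x $ i + b))"
    if "\<exists>k q. g = (\<lambda>x. k * flat q (c * x $ i + b))" for g j
  proof -
    from that obtain k q where g: "g = (\<lambda>x. k * flat q (c * x $ i + b))" by blast
    have "partial j g = (\<lambda>x. (k * c * axis j 1 $ i) * flat ([:0, 0, 1:] * (q - pderiv q)) (c * x $ i + b))"
      unfolding g by (auto simp: fun_eq_iff partial_eq[OF d])
    then show ?thesis by blast
  qed
  show "\<exists>k qa. (\<lambda>x. flat q (c * x $ i + b)) = (\<lambda>x. k * flat qa (c * x $ i + b))"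
    by (intro exI[of _ 1] exI[of _ q]) simp
qed

text \<open>The factors are written as instances of the pattern \<open>c * x $ i + b\<close> of
  \<open>smooth_flat_coord\<close>.\<close>

definition box_bump :: "real^'n \<Rightarrow> real^'n \<Rightarrow> real^'n::finite \<Rightarrow> real" where
  "box_bump a b x = (\<Prod>i\<in>UNIV. flat 1 (1 * x $ i + - a $ i) * flat 1 (- 1 * x $ i + b $ i))"

lemma smooth_box_bump: "smooth (box_bump a b)"
proof -
  have "smooth (\<lambda>x. \<Prod>i\<in>UNIV. flat 1 (1 * x $ i + - a $ i) * flat 1 (- 1 * x $ i + b $ i))"
    by (intro smooth_prod smooth_mult smooth_flat_coord)
  then show ?thesis by (simp add: box_bump_def[abs_def])
qed

lemma box_bump_nonneg: "0 \<le> box_bump a b x"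
  unfolding box_bump_def by (auto intro!: prod_nonneg simp: flat_def)

lemma box_bump_outside: assumes "x \<notin> box a b" shows "box_bump a b x = 0"
proof -
  from assms obtain i where "x $ i \<le> a $ i \<or> b $ i \<le> x $ i"
    by (auto simp: mem_box_cart not_less)
  then have "flat 1 (1 * x $ i + - a $ i) * flat 1 (- 1 * x $ i + b $ i) = 0"
    by (auto simp: flat_def)
  then show ?thesis unfolding box_bump_def by (meson UNIV_I finite prod_zero)
qed

lemma box_bump_pos: assumes "x \<in> box a b" shows "box_bump a b x > 0"
  unfolding box_bump_def using assms
  by (auto intro!: prod_pos mult_pos_pos simp: flat_def mem_box_cart algebra_simps)

subsection \<open>The Hardy--Littlewood maximal function\<close>

text \<open>Only radii up to \<open>1\<close> are used, which keeps the radii bounded as Vitali's covering lemma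
  requires. Averages are normalised by \<open>r ^ DIM('a)\<close> instead of the volume of the ball.\<close>

definition maximal :: "('a::euclidean_space \<Rightarrow> ennreal) \<Rightarrow> 'a \<Rightarrow> ennreal" where
  "maximal f x = (SUP r\<in>{0<..1}. ennreal (1 / r ^ DIM('a)) * (\<integral>\<^sup>+y\<in>ball x r. f y \<partial>lborel))"

lemma sets_borel_ball [measurable]: "ball x r \<in> sets borel"
  for x :: "'a::euclidean_space"
  by simp

lemma ennreal_less_inverse_mult_iff:
  assumes "d > 0" "c \<ge> 0"
  shows "ennreal c < ennreal (1 / d) * I \<longleftrightarrow> ennreal (c * d) < I"
proof (cases I)
  case (real i)
  then show ?thesis using assms
    by (auto simp: ennreal_mult[symmetric] ennreal_less_iff field_simps)
next
  case top
  then show ?thesis using assms by (simp add: ennreal_mult_top)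
qed

lemma less_maximal_iff:
  fixes f :: "'a::euclidean_space \<Rightarrow> ennreal"
  assumes "c \<ge> 0"
  shows "ennreal c < maximal f x \<longleftrightarrow>
    (\<exists>r. 0 < r \<and> r \<le> 1 \<and> ennreal (c * r ^ DIM('a)) < (\<integral>\<^sup>+y\<in>ball x r. f y \<partial>lborel))"
proof -
  have "ennreal c < maximal f x \<longleftrightarrow>
    (\<exists>r\<in>{0<..1}. ennreal c < ennreal (1 / r ^ DIM('a)) * (\<integral>\<^sup>+y\<in>ball x r. f y \<partial>lborel))"
    unfolding maximal_def by (rule less_SUP_iff)
  also have "\<dots> \<longleftrightarrow> (\<exists>r\<in>{0<..1}. ennreal (c * r ^ DIM('a)) < (\<integral>\<^sup>+y\<in>ball x r. f y \<partial>lborel))"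
    using assms by (intro bex_cong refl ennreal_less_inverse_mult_iff) auto
  finally show ?thesis by auto
qed

text \<open>Lower semicontinuity: a strict lower bound on the mass of a ball survives a slight
  shrinking of the ball, and the gap so gained allows the centre to move.\<close>

lemma open_maximal_gt:
  fixes f :: "'a::euclidean_space \<Rightarrow> ennreal"
  assumes f[measurable]: "f \<in> borel_measurable borel" and c: "c \<ge> 0"
  shows "open {x. ennreal c < maximal f x}"
  unfolding open_contains_ball
proof safe
  fix x assume "ennreal c < maximal f x"
  then obtain r where r: "0 < r" "r \<le> 1" "ennreal (c * r ^ DIM('a)) < (\<integral>\<^sup>+y\<in>ball x r. f y \<partial>lborel)"
    using less_maximal_iff[OF c] by blast
  \<comment> \<open>Concentric balls exhausting \<open>ball x r\<close>; the offset 2 keeps all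
    radii positive.\<close>
  define B where "B n = ball x (r - r / real (n + 2))" for n
  have "(\<integral>\<^sup>+y\<in>ball x r. f y \<partial>lborel) = (\<integral>\<^sup>+y. (SUP n. f y * indicator (B n) y) \<partial>lborel)"
  proof (rule nn_integral_cong)
    fix y
    show "f y * indicator (ball x r) y = (SUP n. f y * indicator (B n) y)"
    proof (cases "y \<in> ball x r")
      case True
      have "(\<lambda>n. r - r / real (n + 2)) \<longlonglongrightarrow> r - 0"
        by (intro tendsto_intros LIMSEQ_ignore_initial_segment[OF lim_const_over_n])
      then have "eventually (\<lambda>n. dist x y < r - r / real (n + 2)) sequentially"
        using True by (intro order_tendstoD(1)[where y = r]) auto
      then obtain n where n: "y \<in> B n" unfolding B_def eventually_sequentially by auto
      have "(SUP n. f y * indicator (B n) y) = f y"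
      proof (rule antisym)
        show "(SUP n. f y * indicator (B n) y) \<le> f y"
          by (rule SUP_least) (auto simp: indicator_def)
        show "f y \<le> (SUP n. f y * indicator (B n) y)"
          by (rule SUP_upper2[of n]) (use n in auto)
      qed
      with True show ?thesis by simp
    next
      case False
      have "B n \<subseteq> ball x r" for n unfolding B_def using r by (intro subset_ball) simp
      with False have "y \<notin> B n" for n by blast
      with False show ?thesis by simp
    qed
  qed
  also have "\<dots> = (SUP n. \<integral>\<^sup>+y\<in>B n. f y \<partial>lborel)"
  proof (rule nn_integral_monotone_convergence_SUP)
    have "B i \<subseteq> B j" if "i \<le> j" for i j
      unfolding B_def using that r by (intro subset_ball) (simp add: frac_le)
    then show "incseq (\<lambda>n y. f y * indicator (B n) y)"
      by (intro monoI le_funI mult_left_mono) (auto simp: indicator_def)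
  qed (simp add: B_def, measurable)
  finally obtain n where n: "ennreal (c * r ^ DIM('a)) < (\<integral>\<^sup>+y\<in>B n. f y \<partial>lborel)"
    using r(3) by (auto simp: less_SUP_iff)
  show "\<exists>e>0. ball x e \<subseteq> {x. ennreal c < maximal f x}"
  proof (intro exI conjI subsetI)
    show "r / real (n + 2) > 0" using r by simp
    fix z assume z: "z \<in> ball x (r / real (n + 2))"
    \<comment> \<open>The centre moves by less than the amount \<open>r / real (n + 2)\<close> by
      which \<open>B n\<close> was shrunk.\<close>
    have "B n \<subseteq> ball z r"
    proof
      fix y assume "y \<in> B n"
      then show "y \<in> ball z r" using z dist_triangle[of z y x] unfolding B_def
        by (simp add: dist_commute)
    qed
    then have "(\<integral>\<^sup>+y\<in>B n. f y \<partial>lborel) \<le> (\<integral>\<^sup>+y\<in>ball z r. f y \<partial>lborel)"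
      by (intro nn_integral_mono mult_left_mono) (auto simp: indicator_def)
    with n have "ennreal (c * r ^ DIM('a)) < (\<integral>\<^sup>+y\<in>ball z r. f y \<partial>lborel)" by simp
    with r show "z \<in> {x. ennreal c < maximal f x}" using less_maximal_iff[OF c] by blast
  qed
qed

lemma measurable_maximal:
  fixes f :: "'a::euclidean_space \<Rightarrow> ennreal"
  assumes f: "f \<in> borel_measurable borel"
  shows "maximal f \<in> borel_measurable borel"
proof (rule borel_measurableI_greater)
  fix y :: ennreal
  show "{x \<in> space borel. y < maximal f x} \<in> sets borel"
  proof (cases y)
    case (real c)
    then show ?thesis using open_maximal_gt[OF f, of c] by simp
  qed simp
qed

text \<open>Each point of the level set has a ball whose mass exceeds
  \<open>c * r ^ DIM('a)\<close>. Vitali selects disjoint ones whose fivefold enlargements still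
  cover; the volume of an enlargement is the constant on the right times
  \<open>r ^ DIM('a)\<close>.\<close>

lemma maximal_weak_type:
  fixes f :: "'a::euclidean_space \<Rightarrow> ennreal"
  assumes f[measurable]: "f \<in> borel_measurable borel" and c: "c > 0"
  shows "ennreal c * emeasure lborel {x. ennreal c < maximal f x}
    \<le> ennreal (unit_ball_vol DIM('a) * 5 ^ DIM('a)) * (\<integral>\<^sup>+y. f y \<partial>lborel)"
proof -
  let ?E = "{x. ennreal c < maximal f x}" and ?n = "DIM('a)"
  have "\<exists>r. 0 < r \<and> r \<le> 1 \<and> ennreal (c * r ^ ?n) < (\<integral>\<^sup>+y\<in>ball x r. f y \<partial>lborel)"
    if "x \<in> ?E" for x using that less_maximal_iff[of c f x] c by auto
  then obtain r where r: "\<And>x. x \<in> ?E \<Longrightarrow> 0 < r x \<and> r x \<le> 1"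
    "\<And>x. x \<in> ?E \<Longrightarrow> ennreal (c * r x ^ ?n) < (\<integral>\<^sup>+y\<in>ball x (r x). f y \<partial>lborel)"
    by metis
  have "?E \<subseteq> (\<Union>x\<in>?E. ball x (r x))" using r(1) by (intro subsetI UN_I) auto
  from Vitali_covering_lemma_balls[OF this r(1)]
  obtain C where C: "countable C" "C \<subseteq> ?E"
    "pairwise (\<lambda>i j. disjnt (ball i (r i)) (ball j (r j))) C"
    "?E \<subseteq> (\<Union>i\<in>C. ball i (5 * r i))" by blast
  define g where "g = to_nat_on C"
  have inj: "inj_on g C" unfolding g_def by (rule inj_on_to_nat_on[OF C(1)])
  \<comment> \<open>Numbers the selected balls by naturals, for countable subadditivity and sums.
    The set is empty when \<open>k\<close> is not the code of a centre, which covers finite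
    selections.\<close>
  define A where "A k s = (\<Union>x\<in>C \<inter> {x. g x = k}. ball x (s * r x))" for k s
  have A: "A (g x) s = ball x (s * r x)" if "x \<in> C" for x s
  proof -
    have "C \<inter> {y. g y = g x} = {x}" using inj that by (auto dest: inj_onD)
    then show ?thesis by (simp add: A_def)
  qed
  have A0: "A k s = {}" if "k \<notin> g ` C" for k s
    using that unfolding A_def by auto
  have op: "open (A k s)" for k s unfolding A_def by auto
  have "ennreal c * emeasure lborel (A k 5)
      \<le> ennreal (unit_ball_vol ?n * 5 ^ ?n) * (\<integral>\<^sup>+y\<in>A k 1. f y \<partial>lborel)" for k
  proof (cases "k \<in> g ` C")
    case True
    then obtain x where x: "x \<in> C" "k = g x" by blast
    then have r': "0 < r x" "ennreal (c * r x ^ ?n) < (\<integral>\<^sup>+y\<in>ball x (r x). f y \<partial>lborel)"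
      using r C(2) by auto
    have "ennreal c * emeasure lborel (A k 5) = ennreal (unit_ball_vol ?n * 5 ^ ?n) * ennreal (c * r x ^ ?n)"
      using x r'(1) c by (simp add: A emeasure_ball ennreal_mult[symmetric] power_mult_distrib mult_ac)
    also have "\<dots> \<le> ennreal (unit_ball_vol ?n * 5 ^ ?n) * (\<integral>\<^sup>+y\<in>A k 1. f y \<partial>lborel)"
      using x r'(2) by (intro mult_left_mono) (auto simp: A)
    finally show ?thesis .
  qed (simp add: A0)
  note step = this
  have "?E \<subseteq> (\<Union>k. A k 5)"
  proof
    fix z assume "z \<in> ?E"
    with C(4) obtain x where "x \<in> C" "z \<in> ball x (5 * r x)" by blast
    then have "z \<in> A (g x) 5" by (simp only: A)
    then show "z \<in> (\<Union>k. A k 5)" by (rule UN_I[OF UNIV_I])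
  qed
  then have "emeasure lborel ?E \<le> emeasure lborel (\<Union>k. A k 5)"
    by (intro emeasure_mono) (auto intro!: open_UN simp: op)
  also have "\<dots> \<le> (\<Sum>k. emeasure lborel (A k 5))"
    by (intro emeasure_subadditive_countably) (auto simp: op)
  finally have "ennreal c * emeasure lborel ?E \<le> ennreal c * (\<Sum>k. emeasure lborel (A k 5))"
    by (rule mult_left_mono) simp
  also have "\<dots> = (\<Sum>k. ennreal c * emeasure lborel (A k 5))" by simp
  also have "\<dots> \<le> (\<Sum>k. ennreal (unit_ball_vol ?n * 5 ^ ?n) * (\<integral>\<^sup>+y\<in>A k 1. f y \<partial>lborel))"
    using step by (intro suminf_le) auto
  also have "\<dots> = ennreal (unit_ball_vol ?n * 5 ^ ?n) * (\<Sum>k. \<integral>\<^sup>+y\<in>A k 1. f y \<partial>lborel)"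
    by simp
  also have "(\<Sum>k. \<integral>\<^sup>+y\<in>A k 1. f y \<partial>lborel) = (\<integral>\<^sup>+y. (\<Sum>k. f y * indicator (A k 1) y) \<partial>lborel)"
    using op by (intro nn_integral_suminf[symmetric]) auto
  also have "\<dots> \<le> (\<integral>\<^sup>+y. f y \<partial>lborel)"
  proof (rule nn_integral_mono)
    fix y
    have "disjoint_family (\<lambda>k. A k 1)"
      unfolding disjoint_family_on_def
    proof safe
      fix m n x assume mn: "m \<noteq> n" and x: "x \<in> A m 1" "x \<in> A n 1"
      then obtain a b where "a \<in> C" "m = g a" "b \<in> C" "n = g b" using A0 by blast
      with mn have ab: "a \<in> C" "b \<in> C" "a \<noteq> b" "m = g a" "n = g b" by auto
      then have "disjnt (ball a (r a)) (ball b (r b))" using C(3) by (auto simp: pairwise_def)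
      with x ab show "x \<in> {}" by (simp only: A disjnt_def) auto
    qed
    then have "(\<Sum>k. indicator (A k 1) y) = (indicator (\<Union>k. A k 1) y :: ennreal)"
      by (rule suminf_indicator)
    then show "(\<Sum>k. f y * indicator (A k 1) y) \<le> f y"
      by (simp add: indicator_def)
  qed
  finally show ?thesis by (simp add: mult_left_mono)
qed

text \<open>Truncation: the part of \<open>f\<close> below \<open>c / (2 * w)\<close> contributes at
  most \<open>c / 2\<close> to every average, as \<open>w\<close> is the volume of the unit ball. So
  the rest \<open>g\<close> has maximal function above \<open>c / 2\<close>, and the weak type bound
  at that height gives the factor 2.\<close>

lemma maximal_level_set:
  fixes f :: "'a::euclidean_space \<Rightarrow> real"
  assumes f[measurable]: "f \<in> borel_measurable borel" and c: "c > 0"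
  defines "w \<equiv> unit_ball_vol DIM('a)"
  shows "ennreal c * emeasure lborel {x. ennreal c < maximal f x}
    \<le> ennreal (2 * w * 5 ^ DIM('a)) * (\<integral>\<^sup>+y. ennreal (f y) * indicator {y. c < 2 * w * f y} y \<partial>lborel)"
proof -
  have w: "w > 0" by (simp add: w_def)
  let ?n = "DIM('a)"
  define g where "g y = ennreal (f y) * indicator {y. c < 2 * w * f y} y" for y
  have g[measurable]: "g \<in> borel_measurable borel" unfolding g_def by measurable
  have "{x. ennreal c < maximal f x} \<subseteq> {x. ennreal (c / 2) < maximal g x}"
  proof safe
    fix x assume "ennreal c < maximal f x"
    then obtain r where r: "0 < r" "r \<le> 1" "ennreal (c * r ^ ?n) < (\<integral>\<^sup>+y\<in>ball x r. f y \<partial>lborel)"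
      using less_maximal_iff[of c f x] c by auto
    have "(\<integral>\<^sup>+y\<in>ball x r. f y \<partial>lborel)
        \<le> (\<integral>\<^sup>+y. g y * indicator (ball x r) y + ennreal (c / (2 * w)) * indicator (ball x r) y \<partial>lborel)"
      using c w by (intro nn_integral_mono)
        (auto simp: g_def indicator_def field_simps intro!: ennreal_leI)
    also have "\<dots> = (\<integral>\<^sup>+y\<in>ball x r. g y \<partial>lborel) + ennreal (c / (2 * w)) * ennreal (w * r ^ ?n)"
    proof -
      have "(\<integral>\<^sup>+y. ennreal (c / (2 * w)) * indicator (ball x r) y \<partial>lborel) = ennreal (c / (2 * w)) * ennreal (w * r ^ ?n)"
        using r by (subst nn_integral_cmult_indicator) (auto simp: emeasure_ball w_def)
      then show ?thesis by (subst nn_integral_add) auto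
    qed
    also have "ennreal (c / (2 * w)) * ennreal (w * r ^ ?n) = ennreal (c / 2 * r ^ ?n)"
      using w c r by (subst ennreal_mult[symmetric]) (auto simp: field_simps)
    finally have le: "(\<integral>\<^sup>+y\<in>ball x r. f y \<partial>lborel) \<le> (\<integral>\<^sup>+y\<in>ball x r. g y \<partial>lborel) + ennreal (c / 2 * r ^ ?n)" .
    have "ennreal (c / 2 * r ^ ?n) < (\<integral>\<^sup>+y\<in>ball x r. g y \<partial>lborel)"
    proof (rule ccontr)
      assume "\<not> ?thesis"
      then have "(\<integral>\<^sup>+y\<in>ball x r. f y \<partial>lborel) \<le> ennreal (c / 2 * r ^ ?n) + ennreal (c / 2 * r ^ ?n)"
        using le by (meson add_right_mono not_less order_trans)
      also have "\<dots> = ennreal (c * r ^ ?n)"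
        using c r by (subst ennreal_plus[symmetric]) auto
      finally show False using r(3) by simp
    qed
    then show "ennreal (c / 2) < maximal g x"
      using less_maximal_iff[of "c / 2" g x] c r by auto
  qed
  moreover have "{x. ennreal (c / 2) < maximal g x} \<in> sets lborel"
    using open_maximal_gt[OF g, of "c / 2"] c by simp
  ultimately have "emeasure lborel {x. ennreal c < maximal f x} \<le> emeasure lborel {x. ennreal (c / 2) < maximal g x}"
    by (rule emeasure_mono)
  then have "ennreal c * emeasure lborel {x. ennreal c < maximal f x}
      \<le> ennreal 2 * (ennreal (c / 2) * emeasure lborel {x. ennreal (c / 2) < maximal g x})"
    using c by (simp add: mult.assoc[symmetric] ennreal_mult[symmetric] mult_left_mono del: ennreal_numeral)
  also have "\<dots> \<le> ennreal 2 * (ennreal (w * 5 ^ ?n) * (\<integral>\<^sup>+y. g y \<partial>lborel))"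
    unfolding w_def using c by (intro mult_left_mono maximal_weak_type) auto
  also have "\<dots> = ennreal (2 * w * 5 ^ ?n) * (\<integral>\<^sup>+y. g y \<partial>lborel)"
    using w by (simp add: mult.assoc[symmetric] ennreal_mult[symmetric] del: ennreal_numeral)
  finally show ?thesis unfolding g_def .
qed

text \<open>The layer-cake integral, applied with exponents \<open>p\<close> and
  \<open>p - 1\<close>; for \<open>p < 2\<close> the second integrand is unbounded near 0.\<close>

lemma nn_integral_power_below:
  fixes q c :: real
  assumes "q > 0" "c \<ge> 0"
  shows "(\<integral>\<^sup>+t. ennreal (t powr (q - 1)) * indicator {t. 0 < t \<and> t < c} t \<partial>lborel) = ennreal (c powr q / q)"
proof -
  have "(\<integral>\<^sup>+t. ennreal (t powr (q - 1)) * indicator {t. 0 < t \<and> t < c} t \<partial>lborel)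
      = (\<integral>\<^sup>+t. ennreal (indicator {0..c} t * t powr (q - 1)) \<partial>lborel)"
  proof (rule nn_integral_cong_AE)
    show "AE t in lborel. ennreal (t powr (q - 1)) * indicator {t. 0 < t \<and> t < c} t
        = ennreal (indicator {0..c} t * t powr (q - 1))"
      using AE_lborel_singleton[of c] AE_lborel_singleton[of 0]
      by eventually_elim (auto simp: indicator_def)
  qed
  also have "\<dots> = ennreal (c powr (q - 1 + 1) / (q - 1 + 1))"
    using assms by (intro nn_integral_has_integral_lebesgue has_integral_powr_from_0) auto
  finally show ?thesis by simp
qed

text \<open>Marcinkiewicz interpolation in layer-cake form: integrate \<open>t powr (p - 1)\<close>
  over the heights below the maximal function, estimate each level set and exchange the integrals.
  The remaining integral of \<open>t powr (p - 1 - 1)\<close> converges at 0 because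
  \<open>p > 1\<close>. The truncation height in \<open>maximal_level_set\<close> grows with
  \<open>t\<close>, which makes the upper limit finite.\<close>

lemma maximal_strong_type:
  fixes p :: real
  assumes p: "p > 1"
  shows "\<exists>C\<ge>0. \<forall>f::'a::euclidean_space \<Rightarrow> real. f \<in> borel_measurable borel \<longrightarrow> (\<forall>x. 0 \<le> f x) \<longrightarrow>
    integrable lborel (\<lambda>x. f x powr p) \<longrightarrow>
    (\<exists>g. g \<in> borel_measurable borel \<and> (\<forall>x. 0 \<le> g x) \<and> integrable lborel (\<lambda>x. g x powr p) \<and>
      (\<integral>x. g x powr p \<partial>lborel) \<le> C * (\<integral>x. f x powr p \<partial>lborel) \<and>
      (AE x in lborel. \<forall>r. 0 < r \<longrightarrow> r \<le> 1 \<longrightarrow>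
        (\<integral>\<^sup>+y\<in>ball x r. f y \<partial>lborel) \<le> ennreal (g x * r ^ DIM('a))))"
proof -
  define w where "w = unit_ball_vol DIM('a)"
  have w: "w > 0" by (simp add: w_def)
  define C1 where "C1 = 2 * w * 5 ^ DIM('a)"
  have C1: "C1 > 0" using w by (simp add: C1_def)
  \<comment> \<open>\<open>C / p\<close> is the level-set constant times the inner integral; the
    last factor \<open>p\<close> undoes the division in \<open>I x = g x powr p / p\<close>.\<close>
  define C where "C = C1 * ((2 * w) powr (p - 1) / (p - 1)) * p"
  have C: "C \<ge> 0" using C1 p by (simp add: C_def)
  have "\<exists>g. g \<in> borel_measurable borel \<and> (\<forall>x. 0 \<le> g x) \<and> integrable lborel (\<lambda>x. g x powr p) \<and>
      (\<integral>x. g x powr p \<partial>lborel) \<le> C * (\<integral>x. f x powr p \<partial>lborel) \<and>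
      (AE x in lborel. \<forall>r. 0 < r \<longrightarrow> r \<le> 1 \<longrightarrow>
        (\<integral>\<^sup>+y\<in>ball x r. f y \<partial>lborel) \<le> ennreal (g x * r ^ DIM('a)))"
    if f[measurable]: "f \<in> borel_measurable borel" and nn: "\<And>x. 0 \<le> f x"
      and int: "integrable lborel (\<lambda>x. f x powr p)" for f :: "'a \<Rightarrow> real"
  proof -
    let ?M = "maximal (\<lambda>x. ennreal (f x))"
    have M[measurable]: "?M \<in> borel_measurable borel" by (rule measurable_maximal) simp
    define I where "I x = (\<integral>\<^sup>+t. ennreal (t powr (p - 1)) * indicator {t. 0 < t \<and> ennreal t < ?M x} t \<partial>lborel)" for x
    have I_meas[measurable]: "I \<in> borel_measurable borel"
      unfolding I_def by measurable
    have "(\<integral>\<^sup>+x. I x \<partial>lborel) = (\<integral>\<^sup>+t. (\<integral>\<^sup>+x. ennreal (t powr (p - 1)) * indicator {t. 0 < t \<and> ennreal t < ?M x} t \<partial>lborel) \<partial>lborel)"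
      unfolding I_def by (rule lborel_pair.Fubini'[symmetric]) measurable
    also have "\<dots> \<le> (\<integral>\<^sup>+t. (\<integral>\<^sup>+y. ennreal C1 * (f y * (ennreal (t powr (p - 1 - 1)) * indicator {t. 0 < t \<and> t < 2 * w * f y} t)) \<partial>lborel) \<partial>lborel)"
    proof (rule nn_integral_mono)
      fix t :: real
      show "(\<integral>\<^sup>+x. ennreal (t powr (p - 1)) * indicator {t. 0 < t \<and> ennreal t < ?M x} t \<partial>lborel)
        \<le> (\<integral>\<^sup>+y. ennreal C1 * (f y * (ennreal (t powr (p - 1 - 1)) * indicator {t. 0 < t \<and> t < 2 * w * f y} t)) \<partial>lborel)"
      proof (cases "t > 0")
        case True
        have op: "{x. ennreal t < ?M x} \<in> sets lborel" by measurable
        have "(\<integral>\<^sup>+x. ennreal (t powr (p - 1)) * indicator {t. 0 < t \<and> ennreal t < ?M x} t \<partial>lborel)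
            = (\<integral>\<^sup>+x. ennreal (t powr (p - 1)) * indicator {x. ennreal t < ?M x} x \<partial>lborel)"
          using True by (intro nn_integral_cong) (auto simp: indicator_def)
        also have "\<dots> = ennreal (t powr (p - 1)) * emeasure lborel {x. ennreal t < ?M x}"
          using op by (simp add: nn_integral_cmult)
        also have "\<dots> = ennreal (t powr (p - 1 - 1)) * (ennreal t * emeasure lborel {x. ennreal t < ?M x})"
        proof -
          have "ennreal (t powr (p - 1)) = ennreal (t powr (p - 1 - 1)) * ennreal t"
            using True by (subst ennreal_mult[symmetric]) (auto simp: powr_diff field_simps power2_eq_square)
          then show ?thesis by (simp only: mult.assoc)
        qed
        also have "\<dots> \<le> ennreal (t powr (p - 1 - 1)) * (ennreal C1 * (\<integral>\<^sup>+y. ennreal (f y) * indicator {y. t < 2 * w * f y} y \<partial>lborel))"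
          unfolding C1_def w_def using True by (intro mult_left_mono maximal_level_set) auto
        also have "\<dots> = (\<integral>\<^sup>+y. ennreal (t powr (p - 1 - 1)) * (ennreal C1 * (ennreal (f y) * indicator {y. t < 2 * w * f y} y)) \<partial>lborel)"
          by (simp add: nn_integral_cmult)
        also have "\<dots> = (\<integral>\<^sup>+y. ennreal C1 * (f y * (ennreal (t powr (p - 1 - 1)) * indicator {t. 0 < t \<and> t < 2 * w * f y} t)) \<partial>lborel)"
          using True by (intro nn_integral_cong) (auto simp: indicator_def mult_ac)
        finally show ?thesis .
      qed simp
    qed
    also have "\<dots> = (\<integral>\<^sup>+y. (\<integral>\<^sup>+t. ennreal C1 * (f y * (ennreal (t powr (p - 1 - 1)) * indicator {t. 0 < t \<and> t < 2 * w * f y} t)) \<partial>lborel) \<partial>lborel)"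
      by (rule lborel_pair.Fubini'[symmetric]) measurable
    also have "\<dots> = (\<integral>\<^sup>+y. ennreal (C / p) * ennreal (f y powr p) \<partial>lborel)"
    proof (rule nn_integral_cong)
      fix y
      have "(\<integral>\<^sup>+t. ennreal C1 * (f y * (ennreal (t powr (p - 1 - 1)) * indicator {t. 0 < t \<and> t < 2 * w * f y} t)) \<partial>lborel)
          = ennreal C1 * (f y * (\<integral>\<^sup>+t. ennreal (t powr (p - 1 - 1)) * indicator {t. 0 < t \<and> t < 2 * w * f y} t \<partial>lborel))"
        by (simp add: nn_integral_cmult)
      also have "\<dots> = ennreal C1 * (f y * ennreal ((2 * w * f y) powr (p - 1) / (p - 1)))"
        using p w nn by (subst nn_integral_power_below) auto
      also have "\<dots> = ennreal (C1 * (f y * ((2 * w * f y) powr (p - 1) / (p - 1))))"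
        using C1 p nn by (simp add: ennreal_mult[symmetric])
      also have "C1 * (f y * ((2 * w * f y) powr (p - 1) / (p - 1))) = C / p * f y powr p"
      proof (cases "f y = 0")
        case False
        then have "f y powr p = f y * f y powr (p - 1)"
          using nn[of y] by (simp add: powr_mult_base)
        moreover have "(2 * w * f y) powr (p - 1) = (2 * w) powr (p - 1) * f y powr (p - 1)"
          using w nn[of y] by (simp add: powr_mult)
        ultimately show ?thesis using p by (simp add: C_def)
      qed simp
      finally show "(\<integral>\<^sup>+t. ennreal C1 * (f y * (ennreal (t powr (p - 1 - 1)) * indicator {t. 0 < t \<and> t < 2 * w * f y} t)) \<partial>lborel)
          = ennreal (C / p) * ennreal (f y powr p)"
        using C p by (simp add: ennreal_mult[symmetric])
    qed
    also have "\<dots> = ennreal (C / p) * ennreal (\<integral>x. f x powr p \<partial>lborel)"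
      using int by (simp add: nn_integral_cmult nn_integral_eq_integral)
    finally have I: "(\<integral>\<^sup>+x. I x \<partial>lborel) \<le> ennreal (C / p * (\<integral>x. f x powr p \<partial>lborel))"
      using C p by (simp add: ennreal_mult[symmetric])
    \<comment> \<open>\<open>enn2real\<close> turns an infinite value into 0. This happens on a null
      set only, because \<open>I\<close> has finite integral and is infinite there.\<close>
    define g where "g x = enn2real (?M x)" for x
    have g[measurable]: "g \<in> borel_measurable borel" unfolding g_def by measurable
    have g0: "0 \<le> g x" for x by (simp add: g_def)
    have I_eq: "I x = ennreal (g x powr p / p)" if "?M x < \<infinity>" for x
    proof -
      have "?M x = ennreal (g x)" using that by (simp add: g_def)
      then have "I x = (\<integral>\<^sup>+t. ennreal (t powr (p - 1)) * indicator {t. 0 < t \<and> t < g x} t \<partial>lborel)"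
        unfolding I_def by (intro nn_integral_cong) (auto simp: indicator_def ennreal_less_iff)
      then show ?thesis using p g0 nn_integral_power_below[of p "g x"] by simp
    qed
    have I_top: "I x = \<infinity>" if "?M x = \<infinity>" for x
    proof (rule ccontr)
      assume "I x \<noteq> \<infinity>"
      then obtain b where b: "I x = ennreal b" "b \<ge> 0" by (cases "I x") auto
      \<comment> \<open>The height at which the layer-cake integral already equals
        \<open>b + 1\<close>.\<close>
      define c where "c = (p * (b + 1)) powr (1 / p)"
      have "ennreal (c powr p / p) = (\<integral>\<^sup>+t. ennreal (t powr (p - 1)) * indicator {t. 0 < t \<and> t < c} t \<partial>lborel)"
        using p by (subst nn_integral_power_below) (auto simp: c_def)
      also have "\<dots> \<le> I x"
        unfolding I_def using that by (intro nn_integral_mono mult_left_mono) (auto simp: indicator_def)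
      finally have "c powr p / p \<le> b" using b by simp
      moreover have "c powr p = p * (b + 1)" using p b by (simp add: c_def powr_powr)
      ultimately show False using p by simp
    qed
    have "AE x in lborel. I x \<noteq> \<infinity>"
      using I by (intro nn_integral_PInf_AE) (auto simp: top_unique)
    then have fin: "AE x in lborel. ?M x < \<infinity>"
      by eventually_elim (use I_top in \<open>auto simp: less_top[symmetric]\<close>)
    have "(\<integral>\<^sup>+x. ennreal (g x powr p) \<partial>lborel) = (\<integral>\<^sup>+x. ennreal p * I x \<partial>lborel)"
      using fin by (intro nn_integral_cong_AE; eventually_elim)
        (use p in \<open>simp add: I_eq ennreal_mult[symmetric]\<close>)
    also have "\<dots> = ennreal p * (\<integral>\<^sup>+x. I x \<partial>lborel)" by (simp add: nn_integral_cmult)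
    also have "\<dots> \<le> ennreal p * ennreal (C / p * (\<integral>x. f x powr p \<partial>lborel))"
      by (intro mult_left_mono I) simp
    also have "\<dots> = ennreal (C * (\<integral>x. f x powr p \<partial>lborel))"
      using p C by (subst ennreal_mult[symmetric]) auto
    finally have le: "(\<integral>\<^sup>+x. ennreal (g x powr p) \<partial>lborel) \<le> ennreal (C * (\<integral>x. f x powr p \<partial>lborel))" .
    then have gint: "integrable lborel (\<lambda>x. g x powr p)"
      by (intro integrableI_nonneg) (auto simp: less_top[symmetric] top_unique)
    have "(\<integral>x. g x powr p \<partial>lborel) \<le> C * (\<integral>x. f x powr p \<partial>lborel)"
      using le C nn_integral_eq_integral[OF gint] by simp
    moreover have "AE x in lborel. \<forall>r. 0 < r \<longrightarrow> r \<le> 1 \<longrightarrow>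
        (\<integral>\<^sup>+y\<in>ball x r. f y \<partial>lborel) \<le> ennreal (g x * r ^ DIM('a))"
      using fin
    proof eventually_elim
      case (elim x)
      then have "?M x = ennreal (g x)" by (simp add: g_def)
      then have "\<not> ennreal (g x) < ?M x" by simp
      then show ?case using less_maximal_iff[of "g x" "\<lambda>x. ennreal (f x)" x] g0 by (auto simp: not_less)
    qed
    ultimately show ?thesis using g g0 gint by blast
  qed
  with C show ?thesis by blast
qed

subsection \<open>Differentiation under the integral and integration by parts\<close>

lemma has_vector_derivative_iff_tendsto:
  fixes F :: "real \<Rightarrow> 'b::real_normed_vector"
  shows "(F has_vector_derivative D) (at t) \<longleftrightarrow>
    ((\<lambda>h. (F (t + h) - F t) /\<^sub>R h) \<longlongrightarrow> D) (at 0)"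
proof -
  have "((\<lambda>h. norm (F (t + h) - F t - h *\<^sub>R D) / norm h) \<longlongrightarrow> 0) (at 0) \<longleftrightarrow>
      ((\<lambda>h. norm ((F (t + h) - F t) /\<^sub>R h - D)) \<longlongrightarrow> 0) (at 0)"
  proof (rule filterlim_cong[OF refl refl])
    show "eventually (\<lambda>h. norm (F (t + h) - F t - h *\<^sub>R D) / norm h = norm ((F (t + h) - F t) /\<^sub>R h - D)) (at 0)"
      unfolding eventually_at_filter
    proof (intro always_eventually allI impI)
      fix h :: real assume "h \<noteq> 0"
      then have "(F (t + h) - F t) /\<^sub>R h - D = (F (t + h) - F t - h *\<^sub>R D) /\<^sub>R h"
        by (simp add: scaleR_diff_right)
      then show "norm (F (t + h) - F t - h *\<^sub>R D) / norm h = norm ((F (t + h) - F t) /\<^sub>R h - D)"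
        by (simp add: divide_inverse_commute)
    qed
  qed
  then show ?thesis
    by (simp add: has_vector_derivative_def has_derivative_at bounded_linear_scaleR_left
        tendsto_norm_zero_iff LIM_zero_iff)
qed

lemma vector_lipschitz_bound:
  fixes F :: "real \<Rightarrow> 'b::real_normed_vector"
  assumes "\<And>t. t \<in> {a..b} \<Longrightarrow> (F has_vector_derivative F' t) (at t)"
    and "\<And>t. t \<in> {a..b} \<Longrightarrow> norm (F' t) \<le> B" and "s \<in> {a..b}" "t \<in> {a..b}"
  shows "norm (F t - F s) \<le> B * \<bar>t - s\<bar>"
proof -
  have "norm (F t - F s) \<le> B * norm (t - s)"
  proof (rule differentiable_bound[where S = "{a..b}" and f' = "\<lambda>t h. h *\<^sub>R F' t"])
    show "(F has_derivative (\<lambda>h. h *\<^sub>R F' t)) (at t within {a..b})" if "t \<in> {a..b}" for t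
      using assms(1)[OF that] by (auto simp: has_vector_derivative_def intro: has_derivative_at_withinI)
    show "onorm (\<lambda>h. h *\<^sub>R F' t) \<le> B" if "t \<in> {a..b}" for t
      using assms(2)[OF that] by (intro onorm_le) (simp add: mult.commute[of B] mult_left_mono)
  qed (use assms in auto)
  then show ?thesis by simp
qed

text \<open>The parameter enters only through the scalar kernel, so by the mean value inequality
  \<open>B * norm (f y)\<close> majorises all difference quotients.\<close>

lemma has_vector_derivative_integral_kernel:
  fixes f :: "'a \<Rightarrow> 'b::{banach, second_countable_topology}" and k :: "real \<Rightarrow> 'a \<Rightarrow> real"
  assumes f: "integrable M f" and d: "\<delta> > 0"
    and k: "\<And>t y. \<bar>t - t0\<bar> \<le> \<delta> \<Longrightarrow> ((\<lambda>t. k t y) has_real_derivative k' t y) (at t)"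
    and B: "\<And>t y. \<bar>t - t0\<bar> \<le> \<delta> \<Longrightarrow> \<bar>k' t y\<bar> \<le> B"
    and int: "\<And>t. \<bar>t - t0\<bar> \<le> \<delta> \<Longrightarrow> integrable M (\<lambda>y. k t y *\<^sub>R f y)"
    and k'm: "k' t0 \<in> borel_measurable M"
  shows "((\<lambda>t. \<integral>y. k t y *\<^sub>R f y \<partial>M) has_vector_derivative (\<integral>y. k' t0 y *\<^sub>R f y \<partial>M)) (at t0)"
  unfolding has_vector_derivative_iff_tendsto tendsto_at_iff_sequentially
proof safe
  fix X :: "nat \<Rightarrow> real" assume X: "\<forall>i. X i \<in> UNIV - {0}" "X \<longlonglongrightarrow> 0"
  have [measurable]: "f \<in> borel_measurable M" using f by simp
  note k'm[measurable]
  have "eventually (\<lambda>n. \<bar>X n\<bar> < \<delta>) sequentially"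
    using X(2) d tendstoD[OF X(2) d] by (simp add: dist_real_def)
  then obtain n0 where n0: "\<And>n. n \<ge> n0 \<Longrightarrow> \<bar>X n\<bar> < \<delta>" by (auto simp: eventually_sequentially)
  \<comment> \<open>Dropping an initial segment brings every \<open>t0 + Y n\<close> into the
    interval on which the kernel is controlled.\<close>
  define Y where "Y n = X (n + n0)" for n
  have Y: "\<bar>Y n\<bar> \<le> \<delta>" "Y n \<noteq> 0" for n using n0[of "n + n0"] X(1) unfolding Y_def by auto
  have Ylim: "Y \<longlonglongrightarrow> 0" unfolding Y_def by (rule LIMSEQ_ignore_initial_segment[OF X(2)])
  have "(\<lambda>n. \<integral>y. ((k (t0 + Y n) y - k t0 y) / Y n) *\<^sub>R f y \<partial>M) \<longlonglongrightarrow> (\<integral>y. k' t0 y *\<^sub>R f y \<partial>M)"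
  proof (rule integral_dominated_convergence[where w = "\<lambda>y. B * norm (f y)"])
    show "integrable M (\<lambda>y. B * norm (f y))" using f by simp
    have "((k (t0 + Y n) y - k t0 y) / Y n) *\<^sub>R f y = (k (t0 + Y n) y *\<^sub>R f y - k t0 y *\<^sub>R f y) /\<^sub>R Y n" for n y
      by (simp add: divide_inverse_commute scaleR_diff_left[symmetric])
    then show "(\<lambda>y. ((k (t0 + Y n) y - k t0 y) / Y n) *\<^sub>R f y) \<in> borel_measurable M" for n
      using borel_measurable_integrable[OF int[of "t0 + Y n"]] borel_measurable_integrable[OF int[of t0]] Y d
      by simp
    show "AE y in M. (\<lambda>n. ((k (t0 + Y n) y - k t0 y) / Y n) *\<^sub>R f y) \<longlonglongrightarrow> k' t0 y *\<^sub>R f y"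
    proof (rule AE_I2)
      fix y
      have "((\<lambda>h. (k (t0 + h) y - k t0 y) / h) \<longlongrightarrow> k' t0 y) (at 0)"
        using k[of t0 y] d by (simp add: DERIV_def)
      then have "(\<lambda>n. (k (t0 + Y n) y - k t0 y) / Y n) \<longlonglongrightarrow> k' t0 y"
        using Ylim Y(2) unfolding tendsto_at_iff_sequentially o_def by auto
      then show "(\<lambda>n. ((k (t0 + Y n) y - k t0 y) / Y n) *\<^sub>R f y) \<longlonglongrightarrow> k' t0 y *\<^sub>R f y"
        by (intro tendsto_intros)
    qed
    show "AE y in M. norm (((k (t0 + Y n) y - k t0 y) / Y n) *\<^sub>R f y) \<le> B * norm (f y)" for n
    proof (rule AE_I2)
      fix y
      have "norm (k (t0 + Y n) y - k t0 y) \<le> B * \<bar>(t0 + Y n) - t0\<bar>"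
        by (rule vector_lipschitz_bound[where a = "t0 - \<delta>" and b = "t0 + \<delta>" and F' = "\<lambda>t. k' t y"])
          (use k B Y[of n] d in \<open>auto simp: has_real_derivative_iff_has_vector_derivative[symmetric] abs_le_iff\<close>)
      then have "\<bar>(k (t0 + Y n) y - k t0 y) / Y n\<bar> \<le> B"
        using Y(2)[of n] by (simp add: field_simps)
      then show "norm (((k (t0 + Y n) y - k t0 y) / Y n) *\<^sub>R f y) \<le> B * norm (f y)"
        using mult_right_mono[of _ B "norm (f y)"] by (simp del: abs_divide)
    qed
  qed auto
  also have "(\<lambda>n. \<integral>y. ((k (t0 + Y n) y - k t0 y) / Y n) *\<^sub>R f y \<partial>M)
      = (\<lambda>n. ((\<integral>y. k (t0 + Y n) y *\<^sub>R f y \<partial>M) - (\<integral>y. k t0 y *\<^sub>R f y \<partial>M)) /\<^sub>R Y n)"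
  proof
    fix n
    have "((\<integral>y. k (t0 + Y n) y *\<^sub>R f y \<partial>M) - (\<integral>y. k t0 y *\<^sub>R f y \<partial>M)) /\<^sub>R Y n
        = (\<integral>y. (k (t0 + Y n) y *\<^sub>R f y - k t0 y *\<^sub>R f y) /\<^sub>R Y n \<partial>M)"
      using int[of "t0 + Y n"] int[of t0] Y d by simp
    then show "(\<integral>y. ((k (t0 + Y n) y - k t0 y) / Y n) *\<^sub>R f y \<partial>M)
      = ((\<integral>y. k (t0 + Y n) y *\<^sub>R f y \<partial>M) - (\<integral>y. k t0 y *\<^sub>R f y \<partial>M)) /\<^sub>R Y n"
      by (simp add: divide_inverse_commute scaleR_diff_left[symmetric])
  qed
  finally show "((\<lambda>h. ((\<integral>y. k (t0 + h) y *\<^sub>R f y \<partial>M) - (\<integral>y. k t0 y *\<^sub>R f y \<partial>M)) /\<^sub>R h) \<circ> X)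
      \<longlonglongrightarrow> (\<integral>y. k' t0 y *\<^sub>R f y \<partial>M)"
    unfolding Y_def o_def by (rule LIMSEQ_offset)
qed

lemma lborel_integral_shift:
  fixes h :: "'a::euclidean_space \<Rightarrow> 'b::{banach, second_countable_topology}"
  assumes [measurable]: "h \<in> borel_measurable borel"
  shows "(\<integral>x. h (x + c) \<partial>lborel) = (\<integral>x. h x \<partial>lborel)"
    and "integrable lborel (\<lambda>x. h (x + c)) \<longleftrightarrow> integrable lborel h"
proof -
  have 1: "(\<integral>x. h x \<partial>distr lborel borel ((+) c)) = (\<integral>x. h (c + x) \<partial>lborel)"
    by (subst integral_distr) auto
  show "(\<integral>x. h (x + c) \<partial>lborel) = (\<integral>x. h x \<partial>lborel)"
    using 1 unfolding lborel_distr_plus by (simp add: add.commute)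
  have 2: "integrable (distr lborel borel ((+) c)) h \<longleftrightarrow> integrable lborel (\<lambda>x. h (c + x))"
    by (subst integrable_distr_eq) auto
  show "integrable lborel (\<lambda>x. h (x + c)) \<longleftrightarrow> integrable lborel h"
    using 2 unfolding lborel_distr_plus by (simp add: add.commute)
qed

lemma integrable_lborel_bounded_support:
  fixes h :: "'a::euclidean_space \<Rightarrow> 'b::{banach, second_countable_topology}"
  assumes h: "continuous_on UNIV h" and supp: "\<And>x. norm x > R \<Longrightarrow> h x = 0"
  shows "integrable lborel h" and "\<exists>B\<ge>0. \<forall>x. norm (h x) \<le> B"
proof -
  have "compact ((\<lambda>x. norm (h x)) ` cball 0 R)"
    by (intro compact_continuous_image continuous_intros continuous_on_subset[OF h]) auto
  then obtain B0 where B0: "\<And>x. x \<in> cball 0 R \<Longrightarrow> norm (norm (h x)) \<le> B0"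
    using compact_imp_bounded bounded_iff by (metis (no_types, lifting) imageI)
  have B: "norm (h x) \<le> max B0 0" for x
    using B0[of x] supp[of x] by (cases "norm x > R") (auto simp: le_max_iff_disj)
  then show "\<exists>B\<ge>0. \<forall>x. norm (h x) \<le> B" by (intro exI[of _ "max B0 0"]) auto
  have "integrable lborel (\<lambda>x. indicator (cball 0 R) x *\<^sub>R h x)"
    using borel_integrable_compact[of "cball 0 R" h] continuous_on_subset[OF h]
    by (simp add: set_integrable_def)
  also have "(\<lambda>x. indicator (cball 0 R) x *\<^sub>R h x) = h"
    using supp by (auto simp: fun_eq_iff indicator_def not_le)
  finally show "integrable lborel h" .
qed

text \<open>The integral is translation invariant, so the difference quotients integrate to \<open>0\<close>.\<close>

lemma integral_directional_derivative_eq_0: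
  fixes h :: "'a::euclidean_space \<Rightarrow> 'b::{banach, second_countable_topology}"
  assumes h: "continuous_on UNIV h" and h': "continuous_on UNIV h'"
    and d: "\<And>x. ((\<lambda>t. h (x + t *\<^sub>R e)) has_vector_derivative h' x) (at 0)"
    and supp: "\<And>x. norm x > R \<Longrightarrow> h x = 0" "\<And>x. norm x > R \<Longrightarrow> h' x = 0"
  shows "(\<integral>x. h' x \<partial>lborel) = 0"
proof -
  obtain B where B: "B \<ge> 0" "\<And>x. norm (h' x) \<le> B"
    using integrable_lborel_bounded_support(2)[OF h' supp(2)] by blast
  have [measurable]: "h \<in> borel_measurable borel" "h' \<in> borel_measurable borel"
    using h h' by (auto intro: borel_measurable_continuous_onI)
  have int: "integrable lborel h" by (rule integrable_lborel_bounded_support(1)[OF h supp(1)])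
  have line: "((\<lambda>t. h (x + t *\<^sub>R e)) has_vector_derivative h' (x + s *\<^sub>R e)) (at s)" for x s
  proof -
    have "((\<lambda>t. h ((x + s *\<^sub>R e) + t *\<^sub>R e)) has_vector_derivative h' (x + s *\<^sub>R e)) (at 0)"
      by (rule d)
    then show ?thesis
      unfolding has_vector_derivative_iff_tendsto by (simp add: algebra_simps)
  qed
  have lip: "norm (h (x + t *\<^sub>R e) - h x) \<le> B * \<bar>t\<bar>" for x t
    using vector_lipschitz_bound[where a = "- \<bar>t\<bar>" and b = "\<bar>t\<bar>" and F = "\<lambda>t. h (x + t *\<^sub>R e)"
      and F' = "\<lambda>t. h' (x + t *\<^sub>R e)" and s = 0 and t = t and B = B] line B
    abs_ge_self[of t] abs_ge_minus_self[of t] by (simp add: minus_le_iff)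
  define t where "t n = 1 / real (Suc n)" for n
  have t: "t n > 0" "t n \<le> 1" for n by (auto simp: t_def)
  have tlim: "t \<longlonglongrightarrow> 0" unfolding t_def by (rule LIMSEQ_Suc[OF lim_1_over_n])
  have "(\<lambda>n. \<integral>x. (h (x + t n *\<^sub>R e) - h x) /\<^sub>R t n \<partial>lborel) \<longlonglongrightarrow> (\<integral>x. h' x \<partial>lborel)"
  \<comment> \<open>The steps \<open>t n\<close> are at most 1, so the difference quotients vanish
    outside the ball of radius \<open>R + norm e\<close>; inside it they are at most
    \<open>B\<close>.\<close>
  proof (rule integral_dominated_convergence[where w = "\<lambda>x. B * indicator (cball 0 (R + norm e)) x"])
    show "integrable lborel (\<lambda>x. B * indicator (cball 0 (R + norm e)) x :: real)"
      by (intro integrable_mult_right integrable_real_indicator) (use emeasure_bounded_finite[OF bounded_cball, of 0 "R + norm e"] in auto)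
    show "AE x in lborel. (\<lambda>n. (h (x + t n *\<^sub>R e) - h x) /\<^sub>R t n) \<longlonglongrightarrow> h' x"
    proof (rule AE_I2)
      fix x
      have "((\<lambda>s. (h (x + s *\<^sub>R e) - h x) /\<^sub>R s) \<longlongrightarrow> h' x) (at 0)"
        using d[of x] unfolding has_vector_derivative_iff_tendsto by simp
      then show "(\<lambda>n. (h (x + t n *\<^sub>R e) - h x) /\<^sub>R t n) \<longlonglongrightarrow> h' x"
        unfolding tendsto_at_iff_sequentially o_def
      proof (elim allE[of _ t] impE)
        show "\<forall>i. t i \<in> UNIV - {0}" using t(1) by (simp add: less_imp_neq[THEN not_sym])
      qed (use tlim in auto)
    qed
    show "AE x in lborel. norm ((h (x + t n *\<^sub>R e) - h x) /\<^sub>R t n) \<le> B * indicator (cball 0 (R + norm e)) x" for n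
    proof (rule AE_I2)
      fix x
      show "norm ((h (x + t n *\<^sub>R e) - h x) /\<^sub>R t n) \<le> B * indicator (cball 0 (R + norm e)) x"
      proof (cases "norm x \<le> R + norm e")
        case True
        have "norm ((h (x + t n *\<^sub>R e) - h x) /\<^sub>R t n) = norm (h (x + t n *\<^sub>R e) - h x) / t n"
          using t(1)[of n] by (simp add: divide_inverse_commute)
        also have "\<dots> \<le> (B * \<bar>t n\<bar>) / t n"
          using lip[of x "t n"] t(1)[of n] by (intro divide_right_mono) auto
        also have "\<dots> = B" using t(1)[of n] by simp
        finally show ?thesis using True by simp
      next
        case False
        have "norm x - norm (t n *\<^sub>R e) \<le> norm (x + t n *\<^sub>R e)"
          by (metis norm_diff_ineq)
        moreover have "norm (t n *\<^sub>R e) \<le> norm e" using t[of n] by (simp add: mult_left_le_one_le)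
        moreover have "norm x > R" using False norm_ge_zero[of e] by linarith
        ultimately show ?thesis using False supp(1)[of x] supp(1)[of "x + t n *\<^sub>R e"] B by simp
      qed
    qed
  qed measurable
  moreover have "(\<integral>x. (h (x + t n *\<^sub>R e) - h x) /\<^sub>R t n \<partial>lborel) = 0" for n
    using int lborel_integral_shift[of h "t n *\<^sub>R e"] by simp
  ultimately have "(\<lambda>n. 0) \<longlonglongrightarrow> (\<integral>x. h' x \<partial>lborel)" by (simp only:)
  then show ?thesis using LIMSEQ_unique tendsto_const by blast
qed

subsection \<open>Mollifiers\<close>

text \<open>The kernels live in a corner box because the differentiation theorem
  \<open>integrable_ccontinuous_explicit\<close> is about the cubes \<open>cbox x (x + h *\<^sub>R One)\<close>, and in a ball
  because the maximal function is.\<close>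

definition bumps :: "(real^'n::finite \<Rightarrow> real) set" where
  "bumps = {\<kappa>. smooth \<kappa> \<and> (\<forall>x. x \<notin> cball 0 (1/2) \<inter> cbox 0 One \<longrightarrow> \<kappa> x = 0)}"

lemma bumps_smooth: "\<kappa> \<in> bumps \<Longrightarrow> smooth \<kappa>"
  by (simp add: bumps_def)

lemma bumps_outside:
  "\<kappa> \<in> bumps \<Longrightarrow> norm x > 1/2 \<Longrightarrow> \<kappa> x = 0" "\<kappa> \<in> bumps \<Longrightarrow> x \<notin> cbox 0 One \<Longrightarrow> \<kappa> x = 0"
  unfolding bumps_def by auto

lemma bumps_partial: assumes "\<kappa> \<in> bumps" shows "partial i \<kappa> \<in> bumps"
proof -
  let ?S = "- (cball 0 (1/2) \<inter> cbox 0 One) :: (real^'a) set"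
  have S: "open ?S" by (intro open_Compl closed_Int closed_cball closed_cbox)
  have "partial i \<kappa> x = 0" if "x \<in> ?S" for x
    using partial_cong_open[OF S that, of \<kappa> "\<lambda>_. 0" i] assms
    by (auto simp: bumps_def partial_const)
  then show ?thesis using assms by (auto simp: bumps_def smooth_partial)
qed

lemma bumps_add: "\<kappa> \<in> bumps \<Longrightarrow> \<eta> \<in> bumps \<Longrightarrow> (\<lambda>x. \<kappa> x + \<eta> x) \<in> bumps"
  by (auto simp: bumps_def intro: smooth_add)

lemma bumps_mult: "smooth g \<Longrightarrow> \<kappa> \<in> bumps \<Longrightarrow> (\<lambda>x. g x * \<kappa> x) \<in> bumps"
  by (auto simp: bumps_def intro: smooth_mult)

lemma bumps_cmult: "\<kappa> \<in> bumps \<Longrightarrow> (\<lambda>x. c * \<kappa> x) \<in> bumps"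
  by (intro bumps_mult smooth_const)

lemma bumps_sum: "(\<And>i. i \<in> I \<Longrightarrow> f i \<in> bumps) \<Longrightarrow> (\<lambda>x. \<Sum>i\<in>I. f i x) \<in> bumps"
  by (induction I rule: infinite_finite_induct) (auto simp: bumps_add, auto simp: bumps_def smooth_const)

lemma bumps_integrable:
  assumes "\<kappa> \<in> bumps" shows "integrable lborel \<kappa>" "\<exists>B\<ge>0. \<forall>x. \<bar>\<kappa> x\<bar> \<le> B"
  using integrable_lborel_bounded_support[of \<kappa> "1/2"] assms bumps_outside(1)[OF assms]
    smooth_continuous[OF bumps_smooth[OF assms]] by auto

lemma bumps_measurable [measurable_dest]: "\<kappa> \<in> bumps \<Longrightarrow> \<kappa> \<in> borel_measurable borel"
  using smooth_continuous bumps_smooth borel_measurable_continuous_onI by blast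

lemma integral_partial_bump:
  assumes "\<kappa> \<in> bumps" shows "(\<integral>x. partial i \<kappa> x \<partial>lborel) = 0"
proof (rule integral_directional_derivative_eq_0[where h = \<kappa> and e = "axis i 1" and R = "1/2"])
  show "((\<lambda>t. \<kappa> (x + t *\<^sub>R axis i 1)) has_vector_derivative partial i \<kappa> x) (at 0)" for x
    using partial_has_vector_derivative[OF smooth_differentiable[OF bumps_smooth[OF assms]]]
    by (simp add: has_real_derivative_iff_has_vector_derivative)
qed (use assms bumps_outside bumps_partial bumps_smooth smooth_continuous in blast)+

lemma One_nth: "(One :: real^'n::finite) $ i = 1"
  using inner_sum_left_Basis[of "axis i 1 :: real^'n" "\<lambda>_. 1"] by (simp add: cart_eq_inner_axis)

lemma exists_bump: "\<exists>\<kappa>\<in>(bumps :: (real^'n::finite \<Rightarrow> real) set). (\<integral>x. \<kappa> x \<partial>lborel) = 1"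
proof -
  let ?n = "real CARD('n)"
  \<comment> \<open>With this side length the coordinates of a point of the box add up to at most
    1/2, which bounds its Euclidean norm.\<close>
  define b :: "real^'n" where "b = (\<chi> i. 1 / (2 * ?n))"
  define \<eta> where "\<eta> = box_bump 0 b"
  have n: "?n \<ge> 1" by simp
  have out: "\<eta> x = 0" if "x \<notin> cball 0 (1/2) \<inter> cbox 0 One" for x
  proof -
    have "x \<notin> box 0 b"
    proof
      assume x: "x \<in> box 0 b"
      then have xi: "0 < x $ i" "x $ i < 1 / (2 * ?n)" for i by (auto simp: mem_box_cart b_def)
      have "norm x \<le> (\<Sum>i\<in>UNIV. \<bar>x $ i\<bar>)" by (rule norm_le_l1_cart)
      also have "\<dots> \<le> (\<Sum>i\<in>(UNIV::'n set). 1 / (2 * ?n))"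
        using xi(1) less_imp_le[OF xi(2)] less_imp_le[OF xi(1)] by (intro sum_mono) simp
      also have "\<dots> = 1/2" using n by simp
      finally have "norm x \<le> 1/2" .
      moreover have "1 / (2 * ?n) \<le> 1" using n by (subst divide_le_eq_1_pos; linarith)
      then have "x $ i \<le> 1" for i using xi[of i] by linarith
      then have "x \<in> cbox 0 One" using xi
        by (simp add: mem_box_cart less_imp_le One_nth del: sum_component)
      ultimately show False using that by simp
    qed
    then show ?thesis unfolding \<eta>_def by (intro box_bump_outside) auto
  qed
  have \<eta>: "\<eta> \<in> bumps" using out by (auto simp: bumps_def \<eta>_def smooth_box_bump)
  have ne: "(\<integral>x. \<eta> x \<partial>lborel) \<noteq> 0"
  proof
    assume "(\<integral>x. \<eta> x \<partial>lborel) = 0"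
    moreover have "AE x in lborel. 0 \<le> \<eta> x" by (simp add: \<eta>_def box_bump_nonneg)
    ultimately have "AE x in lborel. \<eta> x = 0"
      using integral_nonneg_eq_0_iff_AE[OF bumps_integrable(1)[OF \<eta>]] by blast
    then have "AE x in lborel. x \<notin> box 0 b"
      by eventually_elim (use box_bump_pos[of _ 0 b] in \<open>force simp: \<eta>_def\<close>)
    then have "emeasure lborel (box 0 b) = 0"
      using AE_iff_null_sets[of "box 0 b" lborel] by auto
    moreover have "emeasure lborel (box 0 b) > 0"
      using n by (subst emeasure_lborel_box)
        (auto simp: b_def Basis_vec_def inner_axis intro!: prod_pos)
    ultimately show False by simp
  qed
  then have "(\<integral>x. (1 / (\<integral>x. \<eta> x \<partial>lborel)) * \<eta> x \<partial>lborel) = 1" by simp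
  with bumps_cmult[OF \<eta>] show ?thesis by blast
qed

section \<open>The Euler operator and kernels with vanishing moments\<close>

text \<open>The divergence of the field \<open>\<kappa> x *\<^sub>R x\<close>. It is minus the
  derivative of the rescaled kernel with respect to the logarithm of the scale, and as a divergence
  it can be integrated by parts.\<close>

definition euler :: "(real^'n::finite \<Rightarrow> real) \<Rightarrow> real^'n \<Rightarrow> real" where
  "euler \<kappa> x = (\<Sum>i\<in>UNIV. partial i (\<lambda>x. x $ i * \<kappa> x) x)"

lemma euler_eq:
  fixes \<kappa> :: "real^'n::finite \<Rightarrow> real"
  assumes "smooth \<kappa>"
  shows "euler \<kappa> x = real CARD('n) * \<kappa> x + frechet_derivative \<kappa> (at x) x"
proof -
  have lin: "linear (frechet_derivative \<kappa> (at x))"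
    using linear_frechet_derivative smooth_differentiable assms by blast
  have "frechet_derivative \<kappa> (at x) x = frechet_derivative \<kappa> (at x) (\<Sum>i\<in>UNIV. x $ i *\<^sub>R axis i 1)"
    using basis_expansion[of x] by (simp add: scalar_mult_eq_scaleR)
  also have "\<dots> = (\<Sum>i\<in>UNIV. x $ i * partial i \<kappa> x)"
    by (simp add: linear_sum[OF lin] linear_cmul[OF lin] partial_def)
  finally show ?thesis
    by (simp add: euler_def partial_mult smooth_differentiable smooth_coord assms partial_coord
        sum.distrib mult.commute)
qed

text \<open>Kernels in \<open>moment k\<close> annihilate polynomials of degree below \<open>k\<close>.\<close>

fun moment :: "nat \<Rightarrow> (real^'n::finite \<Rightarrow> real) set" where
  "moment 0 = bumps"
| "moment (Suc k) = {\<lambda>x. \<Sum>i\<in>UNIV. partial i (\<kappa> i) x | \<kappa>. \<forall>i. \<kappa> i \<in> moment k}"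

lemma moment_bumps: "\<xi> \<in> moment k \<Longrightarrow> \<xi> \<in> bumps"
proof (induction k arbitrary: \<xi>)
  case (Suc k)
  then obtain \<kappa> where \<kappa>: "\<xi> = (\<lambda>x. \<Sum>i\<in>UNIV. partial i (\<kappa> i) x)" "\<And>i. \<kappa> i \<in> moment k" by auto
  show ?case unfolding \<kappa>(1) by (intro bumps_sum bumps_partial Suc.IH \<kappa>)
qed simp

lemma moment_antimono: "j \<le> k \<Longrightarrow> \<xi> \<in> moment k \<Longrightarrow> \<xi> \<in> moment j"
proof (induction j arbitrary: k \<xi>)
  case 0 then show ?case by (auto intro: moment_bumps)
next
  case (Suc j)
  then obtain k' where k': "k = Suc k'" "j \<le> k'" by (cases k) auto
  then show ?case using Suc.prems Suc.IH[OF k'(2)] by auto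
qed

lemma moment_cmult: "\<xi> \<in> moment k \<Longrightarrow> (\<lambda>x. c * \<xi> x) \<in> moment k"
proof (induction k arbitrary: \<xi>)
  case (Suc k)
  then obtain \<kappa> where \<kappa>: "\<xi> = (\<lambda>x. \<Sum>i\<in>UNIV. partial i (\<kappa> i) x)" "\<And>i. \<kappa> i \<in> moment k" by auto
  have "(\<lambda>x. c * \<xi> x) = (\<lambda>x. \<Sum>i\<in>UNIV. partial i (\<lambda>x. c * \<kappa> i x) x)"
    using bumps_smooth[OF moment_bumps[OF \<kappa>(2)]] by (simp add: \<kappa>(1) sum_distrib_left partial_cmult)
  then show ?case using Suc.IH[OF \<kappa>(2)] by auto
qed (simp add: bumps_cmult)

text \<open>Uses that the Euler operator \<open>\<Sum> x\<^sub>i \<partial>\<^sub>i\<close> satisfies \<open>[\<partial>\<^sub>j, \<Sum> x\<^sub>i \<partial>\<^sub>i] = \<partial>\<^sub>j\<close>.\<close>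

lemma euler_moment:
  fixes \<xi> :: "real^'n::finite \<Rightarrow> real"
  assumes "\<xi> \<in> moment k"
  shows "(\<lambda>x. euler \<xi> x + real k * \<xi> x) \<in> moment (Suc k)"
  using assms
proof (induction k arbitrary: \<xi>)
  case 0
  have "euler \<xi> = (\<lambda>x. \<Sum>i\<in>UNIV. partial i (\<lambda>x. x $ i * \<xi> x) x)" by (simp add: euler_def fun_eq_iff)
  moreover have "\<forall>i. (\<lambda>x. x $ i * \<xi> x) \<in> moment 0" using 0 by (auto intro: bumps_mult smooth_coord)
  ultimately show ?case by auto
next
  case (Suc k)
  then obtain \<kappa> where \<kappa>: "\<xi> = (\<lambda>x. \<Sum>j\<in>UNIV. partial j (\<kappa> j) x)" "\<And>j. \<kappa> j \<in> moment k" by auto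
  have sm: "smooth (\<kappa> j)" for j using \<kappa>(2) moment_bumps bumps_smooth by blast
  note s = sm smooth_partial smooth_mult smooth_coord smooth_sum smooth_add smooth_const
  define \<zeta> where "\<zeta> j x = euler (\<kappa> j) x + real k * \<kappa> j x" for j x
  have \<zeta>: "\<zeta> j \<in> moment (Suc k)" for j using Suc.IH[OF \<kappa>(2)] by (simp add: \<zeta>_def[abs_def])
  \<comment> \<open>The commutator relation in divergence form: differentiating
    \<open>x $ i * \<kappa> j x\<close> yields an additional term only for
    \<open>i = j\<close>.\<close>
  have eu: "euler (partial j (\<kappa> j)) x = partial j (euler (\<kappa> j)) x - partial j (\<kappa> j) x" for j x
  proof -
    have "partial i (\<lambda>x. x $ i * partial j (\<kappa> j) x) x
        = partial j (partial i (\<lambda>x. x $ i * \<kappa> j x)) x - (if i = j then partial i (\<kappa> j) x else 0)" for i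
    proof -
      have "partial j (\<lambda>x. x $ i * \<kappa> j x) = (\<lambda>x. x $ i * partial j (\<kappa> j) x + (if j = i then \<kappa> j x else 0))"
        by (auto simp: fun_eq_iff partial_mult smooth_differentiable s partial_coord)
      then have "partial i (partial j (\<lambda>x. x $ i * \<kappa> j x)) x
          = partial i (\<lambda>x. x $ i * partial j (\<kappa> j) x + (if j = i then \<kappa> j x else 0)) x" by simp
      also have "\<dots> = partial i (\<lambda>x. x $ i * partial j (\<kappa> j) x) x + partial i (\<lambda>x. if j = i then \<kappa> j x else 0) x"
      proof (intro partial_add smooth_differentiable)
        show "smooth (\<lambda>x. x $ i * partial j (\<kappa> j) x)" by (intro s)
        show "smooth (\<lambda>x. if j = i then \<kappa> j x else 0)" by (cases "j = i") (simp_all add: s)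
      qed
      also have "partial i (\<lambda>x. if j = i then \<kappa> j x else 0) x = (if i = j then partial i (\<kappa> j) x else 0)"
        by (auto simp: partial_const)
      finally show ?thesis by (simp add: partial_commute[of "\<lambda>x. x $ i * \<kappa> j x" j i] s)
    qed
    then have "euler (partial j (\<kappa> j)) x
        = (\<Sum>i\<in>UNIV. partial j (partial i (\<lambda>x. x $ i * \<kappa> j x)) x) - partial j (\<kappa> j) x"
      by (simp add: euler_def sum_subtractf)
    also have "(\<Sum>i\<in>UNIV. partial j (partial i (\<lambda>x. x $ i * \<kappa> j x)) x) = partial j (euler (\<kappa> j)) x"
      unfolding euler_def[abs_def] by (subst partial_sum) (auto intro!: s)
    finally show ?thesis .
  qed
  have smE: "smooth (euler (\<kappa> j))" for j unfolding euler_def[abs_def] by (intro s)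
  have "euler \<xi> x = (\<Sum>j\<in>UNIV. euler (partial j (\<kappa> j)) x)" for x
  proof -
    have "partial i (\<lambda>x. x $ i * \<xi> x) x = (\<Sum>j\<in>UNIV. partial i (\<lambda>x. x $ i * partial j (\<kappa> j) x) x)" for i
      unfolding \<kappa>(1) sum_distrib_left by (rule partial_sum) (intro s)
    then have "euler \<xi> x = (\<Sum>i\<in>UNIV. \<Sum>j\<in>UNIV. partial i (\<lambda>x. x $ i * partial j (\<kappa> j) x) x)"
      by (simp add: euler_def)
    also have "\<dots> = (\<Sum>j\<in>UNIV. \<Sum>i\<in>UNIV. partial i (\<lambda>x. x $ i * partial j (\<kappa> j) x) x)"
      by (rule sum.swap)
    finally show ?thesis by (simp add: euler_def)
  qed
  \<comment> \<open>The term lost in the commutator raises the factor from \<open>k\<close> to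
    \<open>Suc k\<close>.\<close>
  moreover have "partial j (\<zeta> j) x = euler (partial j (\<kappa> j)) x + real (Suc k) * partial j (\<kappa> j) x" for j x
    by (simp add: eu \<zeta>_def[abs_def] partial_add partial_cmult smooth_differentiable sm smE smooth_cmult algebra_simps)
  ultimately have "euler \<xi> x + real (Suc k) * \<xi> x = (\<Sum>j\<in>UNIV. partial j (\<zeta> j) x)" for x
    by (simp only: \<kappa>(1) sum_distrib_left sum.distrib)
  then have "(\<lambda>x. euler \<xi> x + real (Suc k) * \<xi> x) = (\<lambda>x. \<Sum>j\<in>UNIV. partial j (\<zeta> j) x)" by blast
  then show ?case using \<zeta> by auto
qed

lemma euler_add_cmult:
  assumes "smooth f" "smooth g"
  shows "euler (\<lambda>x. f x + c * g x) x = euler f x + c * euler g x"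
proof -
  have "((\<lambda>x. f x + c * g x) has_derivative
      (\<lambda>v. frechet_derivative f (at x) v + c * frechet_derivative g (at x) v)) (at x)"
    using assms smooth_differentiable frechet_derivative_works
    by (intro has_derivative_add has_derivative_mult_right) blast+
  from frechet_derivative_at[OF this, symmetric]
  have 1: "frechet_derivative (\<lambda>x. f x + c * g x) (at x)
      = (\<lambda>v. frechet_derivative f (at x) v + c * frechet_derivative g (at x) v)" .
  have "smooth (\<lambda>x. f x + c * g x)" using assms by (intro smooth_add smooth_cmult)
  from euler_eq[OF this] show ?thesis
    by (simp add: 1 euler_eq assms algebra_simps)
qed

text \<open>Put \<open>\<psi> = \<phi> + c * euler \<phi>\<close> with
  \<open>c = 1 / real (Suc k)\<close>. Then \<open>euler \<psi>\<close> is \<open>c\<close> times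
  \<open>euler (euler \<phi>) + real (Suc k) * euler \<phi>\<close>, which
  \<open>euler_moment\<close> places one level higher. The integral stays 1, since
  \<open>euler \<phi>\<close> is a sum of derivatives of bumps.\<close>

lemma exists_moment_bump:
  "\<exists>\<phi>\<in>bumps. (\<integral>x. \<phi> x \<partial>lborel) = 1 \<and> euler \<phi> \<in> (moment (Suc k) :: (real^'n::finite \<Rightarrow> real) set)"
proof (induction k)
  case 0
  obtain \<phi> :: "real^'n \<Rightarrow> real" where \<phi>: "\<phi> \<in> bumps" "(\<integral>x. \<phi> x \<partial>lborel) = 1" using exists_bump by blast
  with euler_moment[of \<phi> 0] show ?case by (intro bexI[of _ \<phi>]) auto
next
  case (Suc k)
  then obtain \<phi> :: "real^'n \<Rightarrow> real" where \<phi>: "\<phi> \<in> bumps" "(\<integral>x. \<phi> x \<partial>lborel) = 1"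
    "euler \<phi> \<in> moment (Suc k)" by blast
  let ?c = "1 / real (Suc k)"
  define \<psi> where "\<psi> x = \<phi> x + ?c * euler \<phi> x" for x
  have e: "euler \<phi> \<in> bumps" using \<phi>(3) moment_bumps by blast
  have sm: "smooth \<phi>" "smooth (euler \<phi>)" using \<phi>(1) e bumps_smooth by auto
  have \<psi>: "\<psi> \<in> bumps" unfolding \<psi>_def[abs_def] by (intro bumps_add bumps_cmult \<phi> e)
  have "(\<integral>x. euler \<phi> x \<partial>lborel) = (\<Sum>i\<in>UNIV. \<integral>x. partial i (\<lambda>x. x $ i * \<phi> x) x \<partial>lborel)"
    unfolding euler_def
    by (rule Bochner_Integration.integral_sum)
      (intro bumps_integrable bumps_partial bumps_mult smooth_coord \<phi>)
  also have "\<dots> = 0" by (intro sum.neutral ballI integral_partial_bump bumps_mult smooth_coord \<phi>)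
  finally have "(\<integral>x. \<psi> x \<partial>lborel) = 1"
    unfolding \<psi>_def using bumps_integrable[OF \<phi>(1)] bumps_integrable[OF e] \<phi>(2) by simp
  moreover have "euler \<psi> \<in> moment (Suc (Suc k))"
  proof -
    have "euler \<psi> x = ?c * (euler (euler \<phi>) x + real (Suc k) * euler \<phi> x)" for x
      unfolding \<psi>_def[abs_def] euler_add_cmult[OF sm] by (simp add: field_simps)
    then have "euler \<psi> = (\<lambda>x. ?c * (euler (euler \<phi>) x + real (Suc k) * euler \<phi> x))" by blast
    then show ?thesis using euler_moment[OF \<phi>(3)] by (simp only: moment_cmult)
  qed
  ultimately show ?case using \<psi> by blast
qed

section \<open>Rescaled kernels and mollification\<close>

text \<open>The argument is \<open>y - x\<close> and not \<open>x - y\<close>, so that the support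
  lies in the cube with corner \<open>x\<close>. This is the source of the sign in derivatives with
  respect to \<open>x\<close>.\<close>

definition rescale :: "(real^'n::finite \<Rightarrow> real) \<Rightarrow> real \<Rightarrow> real^'n \<Rightarrow> real^'n \<Rightarrow> real" where
  "rescale \<kappa> s x y = \<kappa> ((1 / s) *\<^sub>R (y - x)) / s ^ CARD('n)"

definition mollify ::
    "(real^'n::finite \<Rightarrow> 'b::euclidean_space) \<Rightarrow> (real^'n \<Rightarrow> real) \<Rightarrow> real \<Rightarrow> real^'n \<Rightarrow> 'b" where
  "mollify f \<kappa> s x = (LINT y|lebesgue. rescale \<kappa> s x y *\<^sub>R f y)"

lemma rescale_outside:
  assumes "\<kappa> \<in> bumps" "s > 0"
  shows "y \<notin> cball x (s/2) \<Longrightarrow> rescale \<kappa> s x y = 0"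
    and "y \<notin> ball x s \<Longrightarrow> rescale \<kappa> s x y = 0"
    and "y \<notin> cbox x (x + s *\<^sub>R One) \<Longrightarrow> rescale \<kappa> s x y = 0"
proof -
  show 1: "rescale \<kappa> s x y = 0" if "y \<notin> cball x (s/2)" for y
  proof -
    have "norm ((1 / s) *\<^sub>R (y - x)) > 1/2"
    proof -
      have eq: "norm ((1 / s) *\<^sub>R (y - x)) = dist x y / s"
        using assms(2) by (simp only: norm_scaleR dist_norm norm_minus_commute) simp
      show ?thesis unfolding eq using that assms(2) by (simp add: field_simps)
    qed
    then show ?thesis using bumps_outside(1)[OF assms(1)] by (simp add: rescale_def)
  qed
  show "y \<notin> ball x s \<Longrightarrow> rescale \<kappa> s x y = 0"
    using 1[of y] assms(2) by auto
  show "rescale \<kappa> s x y = 0" if "y \<notin> cbox x (x + s *\<^sub>R One)"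
  proof -
    have "(1 / s) *\<^sub>R (y - x) \<notin> cbox 0 One"
    proof
      assume *: "(1 / s) *\<^sub>R (y - x) \<in> cbox 0 One"
      have "x \<bullet> b \<le> y \<bullet> b \<and> y \<bullet> b \<le> (x + s *\<^sub>R One) \<bullet> b" if "b \<in> Basis" for b
      proof -
        have "0 \<le> ((1 / s) *\<^sub>R (y - x)) \<bullet> b" "((1 / s) *\<^sub>R (y - x)) \<bullet> b \<le> 1"
          using * that by (auto simp: mem_box)
        then show ?thesis using assms(2) that by (simp add: inner_simps field_simps)
      qed
      then show False using \<open>y \<notin> cbox x (x + s *\<^sub>R One)\<close> by (simp add: mem_box)
    qed
    then show ?thesis using bumps_outside(2)[OF assms(1)] by (simp add: rescale_def)
  qed
qed

lemma rescale_altdef: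
  fixes \<kappa> :: "real^'n::finite \<Rightarrow> real"
  shows "rescale \<kappa> s x = (\<lambda>y. (1 / s ^ CARD('n)) * \<kappa> ((1 / s) *\<^sub>R (y - x)))"
  by (simp add: rescale_def fun_eq_iff)

lemma smooth_rescale: "smooth \<kappa> \<Longrightarrow> smooth (rescale \<kappa> s x)"
  unfolding rescale_altdef by (intro smooth_cmult smooth_affine)

lemma partial_rescale:
  assumes "smooth \<kappa>"
  shows "partial i (rescale \<kappa> s x) y = (1 / s) * rescale (partial i \<kappa>) s x y"
  unfolding rescale_altdef partial_cmult[OF smooth_affine[OF assms]]
    partial_affine(1)[OF smooth_differentiable[OF assms]] by simp

lemma measurable_rescale: "\<kappa> \<in> bumps \<Longrightarrow> rescale \<kappa> s x \<in> borel_measurable borel"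
  using smooth_continuous[OF smooth_rescale[OF bumps_smooth]] by (intro borel_measurable_continuous_onI)

lemma rescale_test_function:
  assumes "\<kappa> \<in> bumps" "s > 0" "cball x (s/2) \<subseteq> \<Omega>"
  shows "rescale \<kappa> s x \<in> test_functions \<Omega>"
proof -
  have sub: "closure {y. rescale \<kappa> s x y \<noteq> 0} \<subseteq> cball x (s/2)"
    using rescale_outside(1)[OF assms(1,2)] by (intro closure_minimal closed_cball) blast
  then have "compact (closure {y. rescale \<kappa> s x y \<noteq> 0})"
    by (meson bounded_cball bounded_subset closed_closure compact_eq_bounded_closed)
  then show ?thesis
    using sub assms(3) smooth_rescale[OF bumps_smooth[OF assms(1)]] by (auto simp: test_functions_def)
qed

lemma rescale_bound:
  fixes \<kappa> :: "real^'n::finite \<Rightarrow> real"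
  assumes "\<And>z. \<bar>\<kappa> z\<bar> \<le> B" "s > 0"
  shows "\<bar>rescale \<kappa> s x y\<bar> \<le> B / s ^ CARD('n)"
  unfolding rescale_def using assms by (simp add: divide_right_mono)

lemma integral_rescale:
  fixes \<kappa> :: "real^'n::finite \<Rightarrow> real"
  assumes "\<kappa> \<in> bumps" "s > 0"
  shows "integrable lebesgue (rescale \<kappa> s x)"
    and "(LINT y|lebesgue. rescale \<kappa> s x y) = (LINT y|lborel. \<kappa> y)"
proof -
  note [measurable] = measurable_rescale[OF assms(1)] bumps_measurable[OF assms(1)]
  have z: "rescale \<kappa> s x y = 0" if "norm y > norm x + s" for y
  proof (rule rescale_outside(2)[OF assms])
    have "norm y \<le> norm x + dist x y" using norm_triangle_ineq[of x "y - x"] by (simp add: dist_norm norm_minus_commute)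
    then show "y \<notin> ball x s" using that by auto
  qed
  have "integrable lborel (rescale \<kappa> s x)"
    using integrable_lborel_bounded_support(1)[OF smooth_continuous[OF smooth_rescale[OF bumps_smooth[OF assms(1)]]]] z
    by blast
  then show "integrable lebesgue (rescale \<kappa> s x)" by (simp add: integrable_completion)
  have "(LINT y|lebesgue. rescale \<kappa> s x y) = (LINT y|lborel. rescale \<kappa> s x y)"
    by (simp add: integral_completion)
  also have "\<dots> = (LINT y|density (distr lborel borel (\<lambda>z. x + s *\<^sub>R z)) (\<lambda>_. \<bar>s\<bar> ^ DIM(real^'n)). rescale \<kappa> s x y)"
    using lborel_affine[of s x] assms(2) by simp
  also have "\<dots> = (LINT y|distr lborel borel (\<lambda>z. x + s *\<^sub>R z). \<bar>s\<bar> ^ DIM(real^'n) *\<^sub>R rescale \<kappa> s x y)"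
    by (subst integral_density) auto
  also have "\<dots> = (LINT z|lborel. \<bar>s\<bar> ^ DIM(real^'n) *\<^sub>R rescale \<kappa> s x (x + s *\<^sub>R z))"
    by (subst integral_distr) auto
  also have "\<dots> = (LINT y|lborel. \<kappa> y)"
    using assms(2) by (intro Bochner_Integration.integral_cong) (auto simp: rescale_def)
  finally show "(LINT y|lebesgue. rescale \<kappa> s x y) = (LINT y|lborel. \<kappa> y)" .
qed

text \<open>Justifies all later cut-offs: a locally integrable function may be replaced by an
  integrable one without changing the mollification.\<close>

lemma mollify_cong:
  assumes "\<kappa> \<in> bumps" "s > 0" "\<And>y. y \<in> ball x s \<Longrightarrow> f y = g y"
  shows "mollify f \<kappa> s x = mollify g \<kappa> s x"
proof -
  have "rescale \<kappa> s x y *\<^sub>R f y = rescale \<kappa> s x y *\<^sub>R g y" for y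
    using assms(3)[of y] rescale_outside(2)[OF assms(1,2), of y x] by (cases "y \<in> ball x s") auto
  then show ?thesis by (simp only: mollify_def)
qed

lemma measurable_rescale_lebesgue:
  "\<kappa> \<in> bumps \<Longrightarrow> rescale \<kappa> s x \<in> borel_measurable lebesgue"
  by (rule measurable_completion) (simp add: measurable_rescale)

lemma integrable_bounded_scaleR:
  fixes f :: "'a \<Rightarrow> 'b::{banach, second_countable_topology}"
  assumes "integrable M f" "g \<in> borel_measurable M" "\<And>x. \<bar>g x\<bar> \<le> (B::real)"
  shows "integrable M (\<lambda>x. g x *\<^sub>R f x)"
proof (rule Bochner_Integration.integrable_bound)
  show "integrable M (\<lambda>x. B * norm (f x))" using assms(1) by simp
  show "(\<lambda>x. g x *\<^sub>R f x) \<in> borel_measurable M" using assms by simp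
  show "AE x in M. norm (g x *\<^sub>R f x) \<le> norm (B * norm (f x))"
    using assms(3) by (intro AE_I2) (auto simp: abs_mult intro!: mult_right_mono order_trans[OF assms(3)])
qed

lemma integrable_rescale_scaleR:
  assumes "integrable lebesgue f" "\<kappa> \<in> bumps" "s > 0"
  shows "integrable lebesgue (\<lambda>y. rescale \<kappa> s x y *\<^sub>R (f y :: 'b::euclidean_space))"
proof -
  obtain B where "\<bar>\<kappa> z\<bar> \<le> B" for z using bumps_integrable(2)[OF assms(2)] by blast
  from rescale_bound[of \<kappa> B, OF this assms(3)] show ?thesis
    by (rule integrable_bounded_scaleR[OF assms(1) measurable_rescale_lebesgue[OF assms(2)]])
qed

lemma norm_mollify_le:
  fixes f :: "real^'n::finite \<Rightarrow> 'b::euclidean_space"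
  assumes "\<kappa> \<in> bumps" "s > 0" "\<And>z. \<bar>\<kappa> z\<bar> \<le> B" "set_integrable lebesgue (ball x s) f"
  shows "norm (mollify f \<kappa> s x) \<le> B / s ^ CARD('n) * (LINT y:ball x s|lebesgue. norm (f y))"
proof -
  have fi: "integrable lebesgue (\<lambda>y. indicator (ball x s) y *\<^sub>R f y)"
    using assms(4) by (simp add: set_integrable_def)
  have "mollify f \<kappa> s x = (LINT y|lebesgue. rescale \<kappa> s x y *\<^sub>R (indicator (ball x s) y *\<^sub>R f y))"
    using mollify_cong[OF assms(1,2), of x f "\<lambda>y. indicator (ball x s) y *\<^sub>R f y"] by (simp add: mollify_def)
  also have "norm \<dots> \<le> (LINT y|lebesgue. B / s ^ CARD('n) * (indicator (ball x s) y *\<^sub>R norm (f y)))"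
  proof (rule order_trans[OF integral_norm_bound integral_mono])
    show "integrable lebesgue (\<lambda>y. norm (rescale \<kappa> s x y *\<^sub>R (indicator (ball x s) y *\<^sub>R f y)))"
      by (intro integrable_norm integrable_rescale_scaleR fi assms)
    have "integrable lebesgue (\<lambda>y. norm (indicator (ball x s) y *\<^sub>R f y))" by (intro integrable_norm fi)
    then show "integrable lebesgue (\<lambda>y. B / s ^ CARD('n) * (indicator (ball x s) y *\<^sub>R norm (f y)))"
      by (intro integrable_mult_right) simp
    show "norm (rescale \<kappa> s x y *\<^sub>R (indicator (ball x s) y *\<^sub>R f y))
        \<le> B / s ^ CARD('n) * (indicator (ball x s) y *\<^sub>R norm (f y))" for y
      using rescale_bound[of \<kappa> B s x y, OF assms(3,2)] mult_right_mono[of _ _ "norm (f y)"]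
      by (simp add: indicator_def del: times_divide_eq_left)
  qed
  also have "\<dots> = B / s ^ CARD('n) * (LINT y:ball x s|lebesgue. norm (f y))"
    by (simp add: set_lebesgue_integral_def)
  finally show ?thesis .
qed

lemma mollify_has_partial:
  fixes f :: "real^'n::finite \<Rightarrow> 'b::euclidean_space"
  assumes f: "integrable lebesgue f" and \<kappa>: "\<kappa> \<in> bumps" and s: "s > 0"
  shows "((\<lambda>t. mollify f \<kappa> s (x + t *\<^sub>R axis i 1)) has_vector_derivative
    (- (1 / s)) *\<^sub>R mollify f (partial i \<kappa>) s x) (at 0)"
proof -
  obtain B where B: "\<And>z. \<bar>partial i \<kappa> z\<bar> \<le> B" using bumps_integrable(2)[OF bumps_partial[OF \<kappa>]] by blast
  have "((\<lambda>t. LINT y|lebesgue. rescale \<kappa> s (x + t *\<^sub>R axis i 1) y *\<^sub>R f y) has_vector_derivative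
    (LINT y|lebesgue. (- (1 / s) * rescale (partial i \<kappa>) s (x + 0 *\<^sub>R axis i 1) y) *\<^sub>R f y)) (at 0)"
  proof (rule has_vector_derivative_integral_kernel[OF f, of 1 0 _ _ "1 / s * (B / s ^ CARD('n))"])
    fix t :: real and y
    have "((\<lambda>\<tau>. \<kappa> ((1 / s) *\<^sub>R (y - x) + \<tau> *\<^sub>R axis i 1)) has_real_derivative
        partial i \<kappa> ((1 / s) *\<^sub>R (y - x) + (- t / s) *\<^sub>R axis i 1)) (at (- t / s))"
      by (rule partial_along_line[OF smooth_differentiable[OF bumps_smooth[OF \<kappa>]]])
    moreover have "((\<lambda>t. - t / s) has_real_derivative - 1 / s) (at t)"
      using s by (auto intro!: derivative_eq_intros)
    ultimately have "((\<lambda>t. \<kappa> ((1 / s) *\<^sub>R (y - x) + (- t / s) *\<^sub>R axis i 1)) has_real_derivative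
        partial i \<kappa> ((1 / s) *\<^sub>R (y - x) + (- t / s) *\<^sub>R axis i 1) * (- 1 / s)) (at t)"
      by (rule DERIV_chain2)
    then have "((\<lambda>t. \<kappa> ((1 / s) *\<^sub>R (y - (x + t *\<^sub>R axis i 1))) / s ^ CARD('n)) has_real_derivative
        (partial i \<kappa> ((1 / s) *\<^sub>R (y - (x + t *\<^sub>R axis i 1))) * (- 1 / s)) / s ^ CARD('n)) (at t)"
      by (intro DERIV_cdivide) (simp add: algebra_simps)
    then show "((\<lambda>t. rescale \<kappa> s (x + t *\<^sub>R axis i 1) y) has_real_derivative
        - (1 / s) * rescale (partial i \<kappa>) s (x + t *\<^sub>R axis i 1) y) (at t)"
      by (simp add: rescale_def)
    show "\<bar>- (1 / s) * rescale (partial i \<kappa>) s (x + t *\<^sub>R axis i 1) y\<bar> \<le> 1 / s * (B / s ^ CARD('n))"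
      unfolding abs_mult using s rescale_bound[OF B s] by (intro mult_mono) auto
  next
    show "integrable lebesgue (\<lambda>y. rescale \<kappa> s (x + t *\<^sub>R axis i 1) y *\<^sub>R f y)" for t
      by (rule integrable_rescale_scaleR[OF f \<kappa> s])
    show "(\<lambda>y. - (1 / s) * rescale (partial i \<kappa>) s (x + 0 *\<^sub>R axis i 1) y) \<in> borel_measurable lebesgue"
      by (intro borel_measurable_times borel_measurable_const measurable_rescale_lebesgue bumps_partial \<kappa>)
  qed simp
  moreover have "(LINT y|lebesgue. (- (1 / s) * rescale (partial i \<kappa>) s (x + 0 *\<^sub>R axis i 1) y) *\<^sub>R f y)
      = (- (1 / s)) *\<^sub>R mollify f (partial i \<kappa>) s x"
    unfolding scaleR_scaleR[symmetric] mollify_def integral_scaleR_right by simp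
  ultimately show ?thesis by (simp only: mollify_def)
qed

lemma mollify_continuous:
  fixes f :: "real^'n::finite \<Rightarrow> 'b::euclidean_space"
  assumes f: "integrable lebesgue f" and \<kappa>: "\<kappa> \<in> bumps" and s: "s > 0"
  shows "continuous_on UNIV (mollify f \<kappa> s)"
proof (rule continuous_on_sequentiallyI)
  fix X :: "nat \<Rightarrow> real^'n" and x assume X: "X \<longlonglongrightarrow> x"
  obtain B where B: "\<And>z. \<bar>\<kappa> z\<bar> \<le> B" using bumps_integrable(2)[OF \<kappa>] by blast
  show "(\<lambda>n. mollify f \<kappa> s (X n)) \<longlonglongrightarrow> mollify f \<kappa> s x"
    unfolding mollify_def
  proof (rule integral_dominated_convergence[where w = "\<lambda>y. B / s ^ CARD('n) * norm (f y)"])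
    show "(\<lambda>y. rescale \<kappa> s x y *\<^sub>R f y) \<in> borel_measurable lebesgue" for x
      by (rule borel_measurable_integrable[OF integrable_rescale_scaleR[OF f \<kappa> s]])
    then show "(\<lambda>y. rescale \<kappa> s (X n) y *\<^sub>R f y) \<in> borel_measurable lebesgue" for n .
    show "AE y in lebesgue. norm (rescale \<kappa> s (X n) y *\<^sub>R f y) \<le> B / s ^ CARD('n) * norm (f y)" for n
      using rescale_bound[of \<kappa> B s "X n", OF B s] by (intro AE_I2) (simp add: mult_right_mono del: times_divide_eq_left)
    have "continuous_on UNIV \<kappa>" by (rule smooth_continuous[OF bumps_smooth[OF \<kappa>]])
    then have "(\<lambda>n. \<kappa> ((1 / s) *\<^sub>R (y - X n))) \<longlonglongrightarrow> \<kappa> ((1 / s) *\<^sub>R (y - x))" for y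
      by (rule continuous_on_tendsto_compose) (auto intro!: tendsto_intros X)
    then show "AE y in lebesgue. (\<lambda>n. rescale \<kappa> s (X n) y *\<^sub>R f y) \<longlonglongrightarrow> rescale \<kappa> s x y *\<^sub>R f y"
      unfolding rescale_def using s by (intro AE_I2 tendsto_intros) auto
    show "integrable lebesgue (\<lambda>y. B / s ^ CARD('n) * norm (f y))" using f by simp
  qed
qed

lemma euler_bumps: "\<kappa> \<in> bumps \<Longrightarrow> euler \<kappa> \<in> bumps"
  using euler_moment[of \<kappa> 0] moment_bumps[of _ 1] by simp

text \<open>Writing \<open>z\<close> for the rescaled argument, the derivative in \<open>s\<close>
  of the kernel is \<open>- (1 / s)\<close> times the rescaled sum of \<open>CARD('n)\<close> times
  \<open>\<kappa> z\<close> and the directional derivative of \<open>\<kappa>\<close> at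
  \<open>z\<close> along \<open>z\<close>; by \<open>euler_eq\<close> that sum is
  \<open>euler \<kappa>\<close>.\<close>

lemma mollify_has_scale_derivative:
  fixes f :: "real^'n::finite \<Rightarrow> 'b::euclidean_space"
  assumes f: "integrable lebesgue f" and \<kappa>: "\<kappa> \<in> bumps" and s: "s > 0"
  shows "((\<lambda>t. mollify f \<kappa> t x) has_vector_derivative
    (- (1 / s)) *\<^sub>R mollify f (euler \<kappa>) s x) (at s)"
proof -
  obtain B where B: "B \<ge> 0" "\<And>z. \<bar>euler \<kappa> z\<bar> \<le> B" using bumps_integrable(2)[OF euler_bumps[OF \<kappa>]] by blast
  have sm: "smooth \<kappa>" using \<kappa> by (rule bumps_smooth)
  \<comment> \<open>Scales within \<open>s / 2\<close> of \<open>s\<close> stay above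
    \<open>s / 2\<close>; this gives the uniform bound on the kernel derivative.\<close>
  have near: "t \<ge> s / 2 \<and> t > 0" if "\<bar>t - s\<bar> \<le> s / 2" for t using that s by (auto simp: abs_if field_simps split: if_splits)
  have "((\<lambda>t. LINT y|lebesgue. rescale \<kappa> t x y *\<^sub>R f y) has_vector_derivative
    (LINT y|lebesgue. (- (1 / s) * rescale (euler \<kappa>) s x y) *\<^sub>R f y)) (at s)"
  proof (rule has_vector_derivative_integral_kernel[OF f, of "s / 2" s _ _ "1 / (s / 2) * (B / (s / 2) ^ CARD('n))"])
    fix t :: real and y assume t': "\<bar>t - s\<bar> \<le> s / 2"
    note t = near[OF t']
    let ?z = "(1 / t) *\<^sub>R (y - x)"
    have k: "(\<kappa> has_derivative frechet_derivative \<kappa> (at ?z)) (at ?z)"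
      using smooth_differentiable[OF sm] frechet_derivative_works by blast
    have "((\<lambda>t. (1 / t) *\<^sub>R (y - x)) has_derivative (\<lambda>h. (- (h / t\<^sup>2)) *\<^sub>R (y - x))) (at t)"
      using t by (auto intro!: derivative_eq_intros simp: power2_eq_square)
    from has_derivative_compose[OF this k]
    have "((\<lambda>t. \<kappa> ((1 / t) *\<^sub>R (y - x))) has_derivative
        (\<lambda>h. frechet_derivative \<kappa> (at ?z) ((- (h / t\<^sup>2)) *\<^sub>R (y - x)))) (at t)" .
    moreover have "frechet_derivative \<kappa> (at ?z) ((- (h / t\<^sup>2)) *\<^sub>R (y - x))
        = - (frechet_derivative \<kappa> (at ?z) ?z / t) * h" for h
    proof -
      have eq: "(- (h / t\<^sup>2)) *\<^sub>R (y - x) = (- (h / t)) *\<^sub>R ?z"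
        using t by (simp add: power2_eq_square)
      show ?thesis
        unfolding eq linear_cmul[OF linear_frechet_derivative[OF smooth_differentiable[OF sm]]] by simp
    qed
    ultimately have "((\<lambda>t. \<kappa> ((1 / t) *\<^sub>R (y - x))) has_real_derivative
        - (frechet_derivative \<kappa> (at ?z) ?z / t)) (at t)"
      unfolding has_field_derivative_def by (simp only:)
    moreover have "((\<lambda>t. t ^ CARD('n)) has_real_derivative real CARD('n) * t ^ (CARD('n) - 1)) (at t)"
      by (auto intro!: derivative_eq_intros)
    ultimately have "((\<lambda>t. \<kappa> ((1 / t) *\<^sub>R (y - x)) / t ^ CARD('n)) has_real_derivative
        (- (frechet_derivative \<kappa> (at ?z) ?z / t) * t ^ CARD('n) - \<kappa> ?z * (real CARD('n) * t ^ (CARD('n) - 1)))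
          / (t ^ CARD('n) * t ^ CARD('n))) (at t)"
      using t by (intro DERIV_divide) auto
    moreover have "(- (frechet_derivative \<kappa> (at ?z) ?z / t) * t ^ CARD('n) - \<kappa> ?z * (real CARD('n) * t ^ (CARD('n) - 1)))
          / (t ^ CARD('n) * t ^ CARD('n)) = - (1 / t) * rescale (euler \<kappa>) t x y"
    proof -
      have "t ^ (CARD('n) - 1) = t ^ CARD('n) / t"
        using t by (simp add: power_diff)
      then show ?thesis using t by (simp add: rescale_def euler_eq[OF sm] field_simps)
    qed
    ultimately show "((\<lambda>t. rescale \<kappa> t x y) has_real_derivative - (1 / t) * rescale (euler \<kappa>) t x y) (at t)"
      by (simp add: rescale_def)
    have "\<bar>rescale (euler \<kappa>) t x y\<bar> \<le> B / t ^ CARD('n)" by (rule rescale_bound) (use B(2) t in auto)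
    also have "\<dots> \<le> B / (s / 2) ^ CARD('n)"
      using t s B(1) by (intro divide_left_mono power_mono mult_pos_pos zero_less_power) auto
    finally show "\<bar>- (1 / t) * rescale (euler \<kappa>) t x y\<bar> \<le> 1 / (s / 2) * (B / (s / 2) ^ CARD('n))"
      unfolding abs_mult using t s by (intro mult_mono) (auto simp: field_simps)
    show "integrable lebesgue (\<lambda>y. rescale \<kappa> t x y *\<^sub>R f y)"
      using t by (intro integrable_rescale_scaleR[OF f \<kappa>]) auto
  next
    show "(\<lambda>y. - (1 / s) * rescale (euler \<kappa>) s x y) \<in> borel_measurable lebesgue"
      by (intro borel_measurable_times borel_measurable_const measurable_rescale_lebesgue euler_bumps \<kappa>)
  qed (use s in simp)
  moreover have "(LINT y|lebesgue. (- (1 / s) * rescale (euler \<kappa>) s x y) *\<^sub>R f y)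
      = (- (1 / s)) *\<^sub>R mollify f (euler \<kappa>) s x"
    unfolding scaleR_scaleR[symmetric] mollify_def by (rule integral_scaleR_right)
  ultimately show ?thesis by (simp only: mollify_def)
qed

subsection \<open>Lebesgue points\<close>

lemma set_integrable_cbox_const: "set_integrable lebesgue (cbox a b) (\<lambda>_. c :: 'b::euclidean_space)"
  for a :: "'a::euclidean_space"
  unfolding set_integrable_def
  by (intro integrable_scaleR_left integrable_real_indicator)
    (use emeasure_bounded_finite[OF bounded_cbox, of a b] in auto)

text \<open>Differentiation of the indefinite integrals of \<open>norm (f y - q)\<close> for all \<open>q\<close> of a countable dense
  set gives strong Lebesgue points.\<close>

lemma AE_lebesgue_point:
  fixes f :: "'a::euclidean_space \<Rightarrow> 'b::euclidean_space"
  assumes f: "integrable lebesgue f"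
  shows "AE x in lebesgue. \<forall>e>0. \<exists>d>0. \<forall>h. 0 < h \<longrightarrow> h < d \<longrightarrow>
    (LINT y:cbox x (x + h *\<^sub>R One)|lebesgue. norm (f y - f x)) \<le> e * h ^ DIM('a)"
proof -
  obtain D :: "'b set" where D: "countable D" "\<And>X. open X \<Longrightarrow> X \<noteq> {} \<Longrightarrow> \<exists>d\<in>D. d \<in> X"
    using countable_dense_setE by blast
  have fi: "set_integrable lebesgue (cbox a b) f" for a b
    using integrable_mult_indicator[of "cbox a b" lebesgue f] f by (simp add: set_integrable_def)
  have gi: "set_integrable lebesgue (cbox a b) (\<lambda>y. norm (f y - q))" for a b q
    by (intro set_integrable_norm set_integral_diff fi set_integrable_cbox_const)
  have "AE x in lebesgue. \<forall>e>0. \<exists>d>0. \<forall>h. 0 < h \<and> h < d \<longrightarrow>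
      norm (integral (cbox x (x + h *\<^sub>R One)) (\<lambda>y. norm (f y - q)) /\<^sub>R h ^ DIM('a) - norm (f x - q)) < e" for q
  proof -
    have "(\<lambda>y. norm (f y - q)) integrable_on cbox a b" for a b
      using set_lebesgue_integral_eq_integral(1)[OF gi] .
    from integrable_ccontinuous_explicit[OF this]
    obtain N where N: "negligible N" "\<And>x e. x \<notin> N \<Longrightarrow> 0 < e \<Longrightarrow> \<exists>d>0. \<forall>h. 0 < h \<and> h < d \<longrightarrow>
      norm (integral (cbox x (x + h *\<^sub>R One)) (\<lambda>y. norm (f y - q)) /\<^sub>R h ^ DIM('a) - norm (f x - q)) < e"
      by blast
    show ?thesis
    proof (rule AE_I'[of N])
      show "N \<in> null_sets lebesgue" using N(1) by (simp add: negligible_iff_null_sets)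
    qed (use N(2) in blast)
  qed
  then have "AE x in lebesgue. \<forall>q\<in>D. \<forall>e>0. \<exists>d>0. \<forall>h. 0 < h \<and> h < d \<longrightarrow>
      norm (integral (cbox x (x + h *\<^sub>R One)) (\<lambda>y. norm (f y - q)) /\<^sub>R h ^ DIM('a) - norm (f x - q)) < e"
    using D(1) by (simp add: AE_ball_countable)
  then show ?thesis
  proof eventually_elim
    case (elim x)
    show ?case
    proof (intro allI impI)
      fix e :: real assume e: "e > 0"
      \<comment> \<open>The error splits into thirds: the average of \<open>norm (f y - q)\<close>
        is within \<open>e / 3\<close> of \<open>norm (f x - q)\<close>, and replacing
        \<open>q\<close> by \<open>f x\<close> costs \<open>norm (f x - q)\<close> once
        more.\<close>
      obtain q where q: "q \<in> D" "norm (f x - q) < e / 3"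
        using D(2)[of "ball (f x) (e / 3)"] e by (auto simp: dist_norm)
      obtain d where d: "d > 0" "\<And>h. 0 < h \<Longrightarrow> h < d \<Longrightarrow>
        norm (integral (cbox x (x + h *\<^sub>R One)) (\<lambda>y. norm (f y - q)) /\<^sub>R h ^ DIM('a) - norm (f x - q)) < e / 3"
        using elim[rule_format, OF q(1), of "e / 3"] e by auto
      show "\<exists>d>0. \<forall>h. 0 < h \<longrightarrow> h < d \<longrightarrow>
        (LINT y:cbox x (x + h *\<^sub>R One)|lebesgue. norm (f y - f x)) \<le> e * h ^ DIM('a)"
      proof (intro exI conjI allI impI)
        fix h :: real assume h: "0 < h" "h < d"
        let ?C = "cbox x (x + h *\<^sub>R One)"
        have c: "measure lebesgue ?C = h ^ DIM('a)"
          using h by (simp add: content_cbox_cases inner_simps)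
        have "(LINT y:?C|lebesgue. norm (f y - f x)) \<le> (LINT y:?C|lebesgue. norm (f y - q) + norm (f x - q))"
        proof (rule set_integral_mono)
          show "norm (f y - f x) \<le> norm (f y - q) + norm (f x - q)" for y
            using norm_triangle_ineq[of "f y - q" "q - f x"] by (simp add: norm_minus_commute)
          show "set_integrable lebesgue ?C (\<lambda>y. norm (f y - q) + norm (f x - q))"
            by (intro set_integral_add gi set_integrable_cbox_const)
        qed (rule gi)
        also have "\<dots> = (LINT y:?C|lebesgue. norm (f y - q)) + norm (f x - q) * h ^ DIM('a)"
        proof -
          have "(LINT y:?C|lebesgue. norm (f x - q)) = norm (f x - q) * h ^ DIM('a)"
            using c by (simp add: set_lebesgue_integral_def)
          then show ?thesis
            by (subst set_integral_add) (auto intro!: gi set_integrable_cbox_const)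
        qed
        also have "(LINT y:?C|lebesgue. norm (f y - q)) = integral ?C (\<lambda>y. norm (f y - q))"
          by (rule set_lebesgue_integral_eq_integral(2)[OF gi])
        also have "\<dots> \<le> (2 * e / 3) * h ^ DIM('a)"
        proof -
          have "integral ?C (\<lambda>y. norm (f y - q)) /\<^sub>R h ^ DIM('a) < 2 * e / 3"
            using d(2)[OF h] q(2) unfolding real_norm_def by linarith
          then show ?thesis using h by (simp add: field_simps)
        qed
        also have "(2 * e / 3) * h ^ DIM('a) + norm (f x - q) * h ^ DIM('a) \<le> e * h ^ DIM('a)"
        proof -
          have "norm (f x - q) * h ^ DIM('a) \<le> e / 3 * h ^ DIM('a)"
            using q(2) h by (intro mult_right_mono) auto
          then show ?thesis by (simp add: field_simps)
        qed
        finally show "(LINT y:?C|lebesgue. norm (f y - f x)) \<le> e * h ^ DIM('a)" by simp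
      qed (rule d)
    qed
  qed
qed

section \<open>Convergence of mollifications almost everywhere\<close>

text \<open>The kernel is at most \<open>B / s ^ CARD('n)\<close> and vanishes off a cube of volume
  \<open>s ^ CARD('n)\<close> with corner \<open>x\<close>. So convergence holds at every Lebesgue
  point, and the exceptional set is the same for all kernels.\<close>

lemma AE_mollify_tendsto:
  fixes f :: "real^'n::finite \<Rightarrow> 'b::euclidean_space"
  assumes f: "integrable lebesgue f"
  shows "AE x in lebesgue. \<forall>\<kappa>\<in>bumps. ((\<lambda>s. mollify f \<kappa> s x) \<longlongrightarrow> (LINT y|lborel. \<kappa> y) *\<^sub>R f x) (at_right 0)"
  using AE_lebesgue_point[OF f]
proof eventually_elim
  case (elim x)
  show ?case
  proof
    fix \<kappa> :: "real^'n \<Rightarrow> real" assume \<kappa>: "\<kappa> \<in> bumps"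
    obtain B where B: "B \<ge> 0" "\<And>z. \<bar>\<kappa> z\<bar> \<le> B" using bumps_integrable(2)[OF \<kappa>] by blast
    show "((\<lambda>s. mollify f \<kappa> s x) \<longlongrightarrow> (LINT y|lborel. \<kappa> y) *\<^sub>R f x) (at_right 0)"
    proof (rule tendstoI)
      fix e :: real assume "e > 0"
      \<comment> \<open>The denominator \<open>B + 1\<close> admits \<open>B = 0\<close> and makes
        the final inequality strict.\<close>
      then have "e / (B + 1) > 0" using B by simp
      then obtain d where d: "d > 0" "\<And>h. 0 < h \<Longrightarrow> h < d \<Longrightarrow>
        (LINT y:cbox x (x + h *\<^sub>R One)|lebesgue. norm (f y - f x)) \<le> e / (B + 1) * h ^ CARD('n)"
        using elim by (metis DIM_cart DIM_real mult.right_neutral)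
      have "dist (mollify f \<kappa> s x) ((LINT y|lborel. \<kappa> y) *\<^sub>R f x) < e" if s: "0 < s" "s < d" for s
      proof -
        let ?C = "cbox x (x + s *\<^sub>R One)"
        note i1 = integrable_rescale_scaleR[OF f \<kappa> s(1), of x]
        have i2: "integrable lebesgue (\<lambda>y. rescale \<kappa> s x y *\<^sub>R f x)"
          by (intro integrable_scaleR_left integral_rescale \<kappa> s)
        have "mollify f \<kappa> s x - (LINT y|lborel. \<kappa> y) *\<^sub>R f x
            = (LINT y|lebesgue. rescale \<kappa> s x y *\<^sub>R f y - rescale \<kappa> s x y *\<^sub>R f x)"
          using i1 i2 integral_rescale[OF \<kappa> s(1), of x] by (simp add: mollify_def)
        also have "\<dots> = (LINT y|lebesgue. rescale \<kappa> s x y *\<^sub>R (f y - f x))"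
          by (simp add: scaleR_diff_right)
        also have "norm \<dots> \<le> (LINT y|lebesgue. B / s ^ CARD('n) * (indicator ?C y *\<^sub>R norm (f y - f x)))"
        proof (rule order_trans[OF integral_norm_bound integral_mono])
          show "integrable lebesgue (\<lambda>y. norm (rescale \<kappa> s x y *\<^sub>R (f y - f x)))"
            using Bochner_Integration.integrable_diff[OF i1 i2] by (simp add: scaleR_diff_right[symmetric] del: norm_scaleR)
          have "set_integrable lebesgue ?C f"
            using integrable_mult_indicator[of ?C lebesgue f] f by (simp add: set_integrable_def)
          then have "set_integrable lebesgue ?C (\<lambda>y. norm (f y - f x))"
            by (intro set_integrable_norm set_integral_diff set_integrable_cbox_const)
          then show "integrable lebesgue (\<lambda>y. B / s ^ CARD('n) * (indicator ?C y *\<^sub>R norm (f y - f x)))"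
            unfolding set_integrable_def by (rule integrable_mult_right)
          show "norm (rescale \<kappa> s x y *\<^sub>R (f y - f x)) \<le> B / s ^ CARD('n) * (indicator ?C y *\<^sub>R norm (f y - f x))" for y
            using rescale_bound[of \<kappa> B s x y, OF B(2) s(1)] rescale_outside(3)[OF \<kappa> s(1), of y x]
              mult_right_mono[of _ _ "norm (f y - f x)"]
            by (cases "y \<in> ?C") (auto simp del: times_divide_eq_left)
        qed
        also have "\<dots> = B / s ^ CARD('n) * (LINT y:?C|lebesgue. norm (f y - f x))"
          by (simp add: set_lebesgue_integral_def)
        also have "\<dots> \<le> B / s ^ CARD('n) * (e / (B + 1) * s ^ CARD('n))"
          using B s by (intro mult_left_mono d) auto
        also have "\<dots> = (B / (B + 1)) * e" using s by simp
        also have "\<dots> < 1 * e" using B \<open>e > 0\<close> by (intro mult_strict_right_mono) auto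
        finally show ?thesis by (simp add: dist_norm)
      qed
      then show "\<forall>\<^sub>F s in at_right 0. dist (mollify f \<kappa> s x) ((LINT y|lborel. \<kappa> y) *\<^sub>R f x) < e"
        using d(1) by (intro eventually_at_rightI[of 0 d]) auto
    qed
  qed
qed

text \<open>An open set is a countable union of closed boxes, and their boundaries are negligible.
  Passing to open boxes leaves room for small balls around each point.\<close>

lemma AE_lebesgue_open_from_boxes:
  fixes \<Omega> :: "'a::euclidean_space set"
  assumes "open \<Omega>"
    and P: "\<And>a b. cbox a b \<subseteq> \<Omega> \<Longrightarrow> AE x in lebesgue. x \<in> box a b \<longrightarrow> P x"
  shows "AE x in lebesgue. x \<in> \<Omega> \<longrightarrow> P x"
proof -
  obtain D :: "'a set set" where D: "countable D" "D \<subseteq> Pow \<Omega>" "\<And>X. X \<in> D \<Longrightarrow> \<exists>a b. X = cbox a b" "\<Union>D = \<Omega>"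
    using open_countable_Union_open_cbox[OF assms(1)] by metis
  have "AE x in lebesgue. x \<in> X \<longrightarrow> P x" if XD: "X \<in> D" for X
  proof -
    obtain a b where X: "X = cbox a b" using D(3)[OF XD] by blast
    have "AE x in lebesgue. x \<notin> cbox a b - box a b"
      using negligible_frontier_interval[of a b] unfolding negligible_iff_null_sets by (rule AE_not_in)
    moreover have "AE x in lebesgue. x \<in> box a b \<longrightarrow> P x" using D(2) XD X by (intro P) auto
    ultimately show ?thesis by eventually_elim (auto simp: X)
  qed
  then have "AE x in lebesgue. \<forall>X\<in>D. x \<in> X \<longrightarrow> P x" by (subst AE_ball_countable[OF D(1)]) blast
  then show ?thesis by eventually_elim (use D(4) in blast)
qed

lemma AE_mollify_tendsto_local:
  fixes f :: "real^'n::finite \<Rightarrow> 'b::euclidean_space"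
  assumes \<Omega>: "open \<Omega>" and f: "locally_integrable \<Omega> f"
  shows "AE x in lebesgue. x \<in> \<Omega> \<longrightarrow> (\<forall>\<kappa>\<in>bumps.
    ((\<lambda>s. mollify f \<kappa> s x) \<longlongrightarrow> (LINT y|lborel. \<kappa> y) *\<^sub>R f x) (at_right 0))"
proof (rule AE_lebesgue_open_from_boxes[OF \<Omega>])
  fix a b :: "real^'n" assume ab: "cbox a b \<subseteq> \<Omega>"
  \<comment> \<open>The cut-off is integrable on the whole space, and near an interior point of the
    box it does not affect small scales.\<close>
  let ?g = "\<lambda>y. indicator (cbox a b) y *\<^sub>R f y"
  have "integrable lebesgue ?g"
    using f ab by (auto simp: locally_integrable_def set_integrable_def)
  from AE_mollify_tendsto[OF this]
  show "AE x in lebesgue. x \<in> box a b \<longrightarrow> (\<forall>\<kappa>\<in>bumps.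
    ((\<lambda>s. mollify f \<kappa> s x) \<longlongrightarrow> (LINT y|lborel. \<kappa> y) *\<^sub>R f x) (at_right 0))"
  proof eventually_elim
    case (elim x)
    show ?case
    proof (intro impI ballI)
      fix \<kappa> :: "real^'n \<Rightarrow> real" assume x: "x \<in> box a b" and \<kappa>: "\<kappa> \<in> bumps"
      have xc: "x \<in> cbox a b" using x box_subset_cbox by blast
      obtain r where r: "r > 0" "ball x r \<subseteq> box a b"
        using x open_box open_contains_ball by blast
      have "mollify ?g \<kappa> s x = mollify f \<kappa> s x" if "0 < s" "s < r" for s
      proof (rule mollify_cong[OF \<kappa> that(1)])
        fix y assume "y \<in> ball x s"
        then have "y \<in> cbox a b" using r(2) that box_subset_cbox by fastforce
        then show "?g y = f y" by simp
      qed
      then have "\<forall>\<^sub>F s in at_right 0. mollify ?g \<kappa> s x = mollify f \<kappa> s x"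
        using r(1) by (intro eventually_at_rightI[of 0 r]) auto
      moreover have "((\<lambda>s. mollify ?g \<kappa> s x) \<longlongrightarrow> (LINT y|lborel. \<kappa> y) *\<^sub>R f x) (at_right 0)"
        using elim \<kappa> xc by auto
      ultimately show "((\<lambda>s. mollify f \<kappa> s x) \<longlongrightarrow> (LINT y|lborel. \<kappa> y) *\<^sub>R f x) (at_right 0)"
        by (rule Lim_transform_eventually[rotated])
    qed
  qed
qed

lemma set_integral_test_function:
  assumes "\<psi> \<in> test_functions \<Omega>"
  shows "(LINT x:\<Omega>|lebesgue. \<psi> x *\<^sub>R f x) = (LINT x|lebesgue. \<psi> x *\<^sub>R f x)"
proof -
  have "\<psi> x = 0" if "x \<notin> \<Omega>" for x
    using assms that closure_subset[of "{x. \<psi> x \<noteq> 0}"] by (auto simp: test_functions_def)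
  then have "indicator \<Omega> x *\<^sub>R \<psi> x *\<^sub>R f x = \<psi> x *\<^sub>R f x" for x by (auto simp: indicator_def)
  then show ?thesis by (simp only: set_lebesgue_integral_def)
qed

text \<open>Rescaled bumps around a point of \<open>\<Omega>\<close> are test functions for small
  scales, so the mollifications vanish, while they converge to \<open>f x\<close> almost
  everywhere.\<close>

lemma du_Bois_Reymond:
  fixes f :: "real^'n::finite \<Rightarrow> 'b::euclidean_space"
  assumes \<Omega>: "open \<Omega>" and f: "locally_integrable \<Omega> f"
    and z: "\<And>\<psi>. \<psi> \<in> test_functions \<Omega> \<Longrightarrow> (LINT x:\<Omega>|lebesgue. \<psi> x *\<^sub>R f x) = 0"
  shows "AE x in lebesgue. x \<in> \<Omega> \<longrightarrow> f x = 0"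
  using AE_mollify_tendsto_local[OF \<Omega> f]
proof eventually_elim
  case (elim x)
  show ?case
  proof
    assume x: "x \<in> \<Omega>"
    obtain \<phi> :: "real^'n \<Rightarrow> real" where \<phi>: "\<phi> \<in> bumps" "(LINT y|lborel. \<phi> y) = 1" using exists_bump by blast
    obtain r where r: "r > 0" "cball x r \<subseteq> \<Omega>" using x \<Omega> open_contains_cball by blast
    have "mollify f \<phi> s x = 0" if "0 < s" "s < r" for s
    proof -
      have "rescale \<phi> s x \<in> test_functions \<Omega>"
        using r(2) that by (intro rescale_test_function \<phi>) (auto intro: order_trans[OF subset_cball])
      from z[OF this] set_integral_test_function[OF this, of f] show ?thesis by (simp add: mollify_def)
    qed
    then have "\<forall>\<^sub>F s in at_right 0. mollify f \<phi> s x = 0"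
      using r(1) by (intro eventually_at_rightI[of 0 r]) auto
    then have "((\<lambda>s. mollify f \<phi> s x) \<longlongrightarrow> 0) (at_right 0)"
      by (rule tendsto_eventually)
    moreover have "((\<lambda>s. mollify f \<phi> s x) \<longlongrightarrow> f x) (at_right 0)" using elim x \<phi> by force
    ultimately show "f x = 0" using tendsto_unique trivial_limit_at_right_real by blast
  qed
qed

subsection \<open>Families of weak derivatives\<close>

abbreviation bump_index :: "'n \<Rightarrow> ('n \<Rightarrow> nat) \<Rightarrow> 'n \<Rightarrow> nat" where
  "bump_index i \<alpha> \<equiv> \<alpha>(i := Suc (\<alpha> i))"

text \<open>Links only neighbouring orders and tests with first derivatives, which is what moving
  derivatives to a kernel one at a time requires. The underlying function is
  \<open>D (\<lambda>_. 0)\<close>. The integrals may run over the whole space because test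
  functions vanish off \<open>\<Omega>\<close>.\<close>

definition weak_family ::
    "(real^'n::finite) set \<Rightarrow> nat \<Rightarrow> (('n \<Rightarrow> nat) \<Rightarrow> real^'n \<Rightarrow> 'b::euclidean_space) \<Rightarrow> bool" where
  "weak_family \<Omega> m D \<longleftrightarrow>
    (\<forall>\<alpha>. mi_order \<alpha> \<le> m \<longrightarrow> locally_integrable \<Omega> (D \<alpha>)) \<and>
    (\<forall>\<alpha> i. \<forall>\<psi>\<in>test_functions \<Omega>. mi_order \<alpha> < m \<longrightarrow>
      (LINT x|lebesgue. partial i \<psi> x *\<^sub>R D \<alpha> x) = - (LINT x|lebesgue. \<psi> x *\<^sub>R D (bump_index i \<alpha>) x))"

lemma partial_outside_support:
  assumes "x \<notin> closure {x. \<psi> x \<noteq> 0}" shows "partial i \<psi> x = 0"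
proof -
  have "partial i \<psi> x = partial i (\<lambda>_. 0) x"
    by (rule partial_cong_open[of "- closure {x. \<psi> x \<noteq> 0}"])
      (use assms closure_subset[of "{x. \<psi> x \<noteq> 0}"] in auto)
  then show ?thesis by (simp add: partial_const)
qed

lemma partial_test_function:
  assumes "\<psi> \<in> test_functions \<Omega>" shows "partial i \<psi> \<in> test_functions \<Omega>"
proof -
  have "closure {x. partial i \<psi> x \<noteq> 0} \<subseteq> closure {x. \<psi> x \<noteq> 0}"
    by (rule closure_minimal) (use partial_outside_support in blast)+
  moreover have "compact (closure {x. \<psi> x \<noteq> 0})" using assms by (simp add: test_functions_def)
  moreover from calculation have "compact (closure {x. partial i \<psi> x \<noteq> 0})"
    unfolding compact_eq_bounded_closed using bounded_subset closed_closure by blast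
  ultimately show ?thesis using assms by (auto simp: test_functions_def smooth_partial)
qed

text \<open>Testing \<open>D \<alpha>\<close> with \<open>partial i \<psi>\<close> and the next
  derivative with \<open>\<psi>\<close> leads to the same integral of \<open>u\<close>, with signs
  that differ by one factor \<open>-1\<close>.\<close>

lemma weak_familyI:
  fixes D :: "('n::{finite,linorder} \<Rightarrow> nat) \<Rightarrow> real^'n::{finite,linorder} \<Rightarrow> 'b::euclidean_space"
  assumes D: "\<And>\<alpha>. mi_order \<alpha> \<le> m \<Longrightarrow> has_weak_derivative \<Omega> \<alpha> u (D \<alpha>)"
  shows "weak_family \<Omega> m D"
  unfolding weak_family_def
proof safe
  show "locally_integrable \<Omega> (D \<alpha>)" if "mi_order \<alpha> \<le> m" for \<alpha>
    using D[OF that] by (simp add: has_weak_derivative_def)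
next
  fix \<alpha> :: "'n \<Rightarrow> nat" and i \<psi> assume \<psi>: "\<psi> \<in> test_functions \<Omega>" and \<alpha>: "mi_order \<alpha> < m"
  have \<psi>': "partial i \<psi> \<in> test_functions \<Omega>" by (rule partial_test_function[OF \<psi>])
  have sm: "smooth \<psi>" using \<psi> by (simp add: test_functions_def)
  let ?\<beta> = "bump_index i \<alpha>" and ?k = "mi_order \<alpha>"
  have "(LINT x:\<Omega>|lebesgue. mpartial \<alpha> (partial i \<psi>) x *\<^sub>R u x)
      = (-1) ^ ?k *\<^sub>R (LINT x:\<Omega>|lebesgue. partial i \<psi> x *\<^sub>R D \<alpha> x)"
    using D[of \<alpha>] \<alpha> \<psi>' by (simp add: has_weak_derivative_def)
  moreover have "(LINT x:\<Omega>|lebesgue. mpartial ?\<beta> \<psi> x *\<^sub>R u x)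
      = (-1) ^ Suc ?k *\<^sub>R (LINT x:\<Omega>|lebesgue. \<psi> x *\<^sub>R D ?\<beta> x)"
    using D[of ?\<beta>] \<alpha> \<psi> by (simp add: has_weak_derivative_def mi_order_upd)
  ultimately have eq: "(-1) ^ ?k *\<^sub>R (LINT x:\<Omega>|lebesgue. partial i \<psi> x *\<^sub>R D \<alpha> x)
      = (-1) ^ ?k *\<^sub>R (- (LINT x:\<Omega>|lebesgue. \<psi> x *\<^sub>R D ?\<beta> x))"
    by (simp add: mpartial_partial[OF sm])
  have "(LINT x:\<Omega>|lebesgue. partial i \<psi> x *\<^sub>R D \<alpha> x) = - (LINT x:\<Omega>|lebesgue. \<psi> x *\<^sub>R D ?\<beta> x)"
    by (rule scaleR_left_imp_eq[OF _ eq]) simp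
  then show "(LINT x|lebesgue. partial i \<psi> x *\<^sub>R D \<alpha> x) = - (LINT x|lebesgue. \<psi> x *\<^sub>R D ?\<beta> x)"
    by (simp add: set_integral_test_function[OF \<psi>] set_integral_test_function[OF \<psi>'])
qed

lemma weak_family_integrable_ball:
  assumes "weak_family \<Omega> m D" "mi_order \<alpha> \<le> m" "cball x t \<subseteq> \<Omega>" "s \<le> t"
  shows "set_integrable lebesgue (ball x s) (D \<alpha>)" "set_integrable lebesgue (cball x t) (D \<alpha>)"
proof -
  show 1: "set_integrable lebesgue (cball x t) (D \<alpha>)"
    using assms by (auto simp: weak_family_def locally_integrable_def)
  show "set_integrable lebesgue (ball x s) (D \<alpha>)"
    by (rule set_integrable_subset[OF 1]) (use assms(4) in auto)
qed

text \<open>The weak derivative is tested with the rescaled kernel, whose partial derivative carries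
  a factor \<open>1 / s\<close>.\<close>

lemma mollify_partial:
  assumes D: "weak_family \<Omega> m D" and \<alpha>: "mi_order \<alpha> < m" and \<kappa>: "\<kappa> \<in> bumps"
    and s: "s > 0" "cball x (s / 2) \<subseteq> \<Omega>"
  shows "mollify (D \<alpha>) (partial i \<kappa>) s x = (- s) *\<^sub>R mollify (D (bump_index i \<alpha>)) \<kappa> s x"
proof -
  have "rescale \<kappa> s x \<in> test_functions \<Omega>" by (rule rescale_test_function[OF \<kappa> s])
  then have "(LINT y|lebesgue. ((1 / s) * rescale (partial i \<kappa>) s x y) *\<^sub>R D \<alpha> y)
      = - mollify (D (bump_index i \<alpha>)) \<kappa> s x"
    using D \<alpha> unfolding weak_family_def mollify_def partial_rescale[OF bumps_smooth[OF \<kappa>], symmetric] by blast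
  then have "(1 / s) *\<^sub>R mollify (D \<alpha>) (partial i \<kappa>) s x = - mollify (D (bump_index i \<alpha>)) \<kappa> s x"
    unfolding scaleR_scaleR[symmetric] integral_scaleR_right mollify_def .
  then have "s *\<^sub>R ((1 / s) *\<^sub>R mollify (D \<alpha>) (partial i \<kappa>) s x) = s *\<^sub>R (- mollify (D (bump_index i \<alpha>)) \<kappa> s x)"
    by (rule arg_cong)
  then show ?thesis using s(1) by simp
qed

lemma mollify_sum:
  assumes f: "set_integrable lebesgue (ball x s) f" and s: "s > 0" and "finite I"
    and \<kappa>: "\<And>i. i \<in> I \<Longrightarrow> \<kappa> i \<in> bumps"
  shows "mollify f (\<lambda>z. \<Sum>i\<in>I. \<kappa> i z) s x = (\<Sum>i\<in>I. mollify f (\<kappa> i) s x)"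
proof -
  let ?g = "\<lambda>y. indicator (ball x s) y *\<^sub>R f y"
  have g: "integrable lebesgue ?g" using f by (simp add: set_integrable_def)
  have eq: "mollify f \<eta> s x = mollify ?g \<eta> s x" if "\<eta> \<in> bumps" for \<eta>
    by (rule mollify_cong[OF that s]) simp
  have "rescale (\<lambda>z. \<Sum>i\<in>I. \<kappa> i z) s x y *\<^sub>R ?g y = (\<Sum>i\<in>I. rescale (\<kappa> i) s x y *\<^sub>R ?g y)" for y
    by (simp only: rescale_def sum_divide_distrib scaleR_sum_left)
  then have "mollify ?g (\<lambda>z. \<Sum>i\<in>I. \<kappa> i z) s x = (LINT y|lebesgue. (\<Sum>i\<in>I. rescale (\<kappa> i) s x y *\<^sub>R ?g y))"
    by (simp only: mollify_def)
  also have "\<dots> = (\<Sum>i\<in>I. mollify ?g (\<kappa> i) s x)"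
    unfolding mollify_def using integrable_rescale_scaleR[OF g \<kappa> s]
    by (intro Bochner_Integration.integral_sum) blast
  finally show ?thesis using eq \<kappa> bumps_sum[of I \<kappa>] by simp
qed

section \<open>Pointwise bounds for mollified weak derivatives\<close>

text \<open>Such a kernel is a \<open>k\<close>-fold divergence; integrating by parts
  \<open>k\<close> times passes \<open>k\<close> derivatives to \<open>D \<alpha>\<close> and gains
  a factor \<open>s\<close> each time. The constant comes before all other quantifiers since it has
  to be uniform in the function, the point and the scale.\<close>

lemma norm_mollify_moment:
  fixes \<xi> :: "real^'n::finite \<Rightarrow> real"
  assumes "\<xi> \<in> moment k"
  shows "\<exists>C\<ge>0. \<forall>\<Omega> m (D :: ('n \<Rightarrow> nat) \<Rightarrow> real^'n \<Rightarrow> 'b::euclidean_space) \<alpha> s x Q.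
    weak_family \<Omega> m D \<longrightarrow> mi_order \<alpha> + k \<le> m \<longrightarrow> s > 0 \<longrightarrow> cball x s \<subseteq> \<Omega> \<longrightarrow>
    (\<forall>\<beta>. mi_order \<beta> = mi_order \<alpha> + k \<longrightarrow>
      (LINT y:ball x s|lebesgue. norm (D \<beta> y)) \<le> Q * s ^ CARD('n)) \<longrightarrow>
    norm (mollify (D \<alpha>) \<xi> s x) \<le> C * s ^ k * Q"
  using assms
proof (induction k arbitrary: \<xi>)
  case 0
  then obtain B where B: "B \<ge> 0" "\<And>z. \<bar>\<xi> z\<bar> \<le> B" using bumps_integrable(2)[of \<xi>] by auto
  show ?case
  proof (intro exI[of _ B] conjI allI impI B(1))
    fix \<Omega> m and D :: "('n \<Rightarrow> nat) \<Rightarrow> real^'n \<Rightarrow> 'b" and \<alpha> :: "'n \<Rightarrow> nat" and s x Q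
    assume *: "weak_family \<Omega> m D" "mi_order \<alpha> + 0 \<le> m" "s > 0" "cball x s \<subseteq> \<Omega>"
      "\<forall>\<beta>. mi_order \<beta> = mi_order \<alpha> + 0 \<longrightarrow> (LINT y:ball x s|lebesgue. norm (D \<beta> y)) \<le> Q * s ^ CARD('n)"
    have "norm (mollify (D \<alpha>) \<xi> s x) \<le> B / s ^ CARD('n) * (LINT y:ball x s|lebesgue. norm (D \<alpha> y))"
      using 0 * weak_family_integrable_ball(1)[OF *(1) _ *(4), of \<alpha> s] by (intro norm_mollify_le B) auto
    also have "\<dots> \<le> B / s ^ CARD('n) * (Q * s ^ CARD('n))"
      using * B(1) by (intro mult_left_mono) auto
    finally show "norm (mollify (D \<alpha>) \<xi> s x) \<le> B * s ^ 0 * Q" using *(3) by simp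
  qed
next
  case (Suc k)
  then obtain \<kappa> where \<xi>: "\<xi> = (\<lambda>z. \<Sum>i\<in>UNIV. partial i (\<kappa> i) z)" and \<kappa>: "\<And>i. \<kappa> i \<in> moment k" by auto
  have \<kappa>b: "\<kappa> i \<in> bumps" for i using \<kappa> moment_bumps by blast
  from Suc.IH[OF \<kappa>] obtain C where C: "\<And>i. C i \<ge> 0"
    "\<And>i \<Omega> m (D :: ('n \<Rightarrow> nat) \<Rightarrow> real^'n \<Rightarrow> 'b) \<alpha> s x Q.
    weak_family \<Omega> m D \<Longrightarrow> mi_order \<alpha> + k \<le> m \<Longrightarrow> s > 0 \<Longrightarrow> cball x s \<subseteq> \<Omega> \<Longrightarrow>
    (\<And>\<beta>. mi_order \<beta> = mi_order \<alpha> + k \<Longrightarrow>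
      (LINT y:ball x s|lebesgue. norm (D \<beta> y)) \<le> Q * s ^ CARD('n)) \<Longrightarrow>
    norm (mollify (D \<alpha>) (\<kappa> i) s x) \<le> C i * s ^ k * Q" by metis
  show ?case
  proof (intro exI[of _ "\<Sum>i\<in>UNIV. C i"] conjI allI impI sum_nonneg C(1))
    fix \<Omega> m and D :: "('n \<Rightarrow> nat) \<Rightarrow> real^'n \<Rightarrow> 'b" and \<alpha> :: "'n \<Rightarrow> nat" and s x Q
    assume *: "weak_family \<Omega> m D" "mi_order \<alpha> + Suc k \<le> m" "s > 0" "cball x s \<subseteq> \<Omega>"
      "\<forall>\<beta>. mi_order \<beta> = mi_order \<alpha> + Suc k \<longrightarrow> (LINT y:ball x s|lebesgue. norm (D \<beta> y)) \<le> Q * s ^ CARD('n)"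
    have sub: "cball x (s / 2) \<subseteq> \<Omega>" using *(3,4) by (intro order_trans[OF subset_cball *(4)]) auto
    have "mollify (D \<alpha>) \<xi> s x = (\<Sum>i\<in>UNIV. mollify (D \<alpha>) (partial i (\<kappa> i)) s x)"
      unfolding \<xi> using * weak_family_integrable_ball(1)[OF *(1) _ *(4), of \<alpha> s]
      by (intro mollify_sum bumps_partial \<kappa>b) auto
    also have "\<dots> = (\<Sum>i\<in>UNIV. (- s) *\<^sub>R mollify (D (bump_index i \<alpha>)) (\<kappa> i) s x)"
      using * sub by (intro sum.cong refl mollify_partial[OF *(1)] \<kappa>b) auto
    finally have "norm (mollify (D \<alpha>) \<xi> s x) \<le> (\<Sum>i\<in>UNIV. norm ((- s) *\<^sub>R mollify (D (bump_index i \<alpha>)) (\<kappa> i) s x))"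
      by (simp only: norm_sum)
    also have "\<dots> \<le> (\<Sum>i\<in>UNIV. s * (C i * s ^ k * Q))"
    proof (rule sum_mono)
      fix i
      have "norm (mollify (D (bump_index i \<alpha>)) (\<kappa> i) s x) \<le> C i * s ^ k * Q"
        using * by (intro C(2)[OF *(1)]) (auto simp: mi_order_upd)
      then show "norm ((- s) *\<^sub>R mollify (D (bump_index i \<alpha>)) (\<kappa> i) s x) \<le> s * (C i * s ^ k * Q)"
        using *(3) by (simp add: mult_left_mono)
    qed
    also have "\<dots> = (\<Sum>i\<in>UNIV. C i) * s ^ Suc k * Q"
      by (simp add: sum_distrib_left sum_distrib_right mult_ac)
    finally show "norm (mollify (D \<alpha>) \<xi> s x) \<le> (\<Sum>i\<in>UNIV. C i) * s ^ Suc k * Q" .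
  qed
qed

lemma mi_order_0_iff: "mi_order \<alpha> = 0 \<longleftrightarrow> \<alpha> = (\<lambda>_. 0)"
  by (auto simp: mi_order_def fun_eq_iff)

lemma mi_order_SucE:
  assumes "mi_order \<alpha> = Suc k"
  obtains i \<beta> where "\<alpha> = bump_index i \<beta>" "mi_order \<beta> = k"
proof -
  have "mi_order \<alpha> \<noteq> 0" using assms by simp
  then obtain i where i: "\<alpha> i \<noteq> 0" using mi_order_0_iff[of \<alpha>] by auto
  then have "\<alpha> = bump_index i (\<alpha>(i := \<alpha> i - 1))" by (auto simp: fun_eq_iff)
  moreover from this have "mi_order (\<alpha>(i := \<alpha> i - 1)) = k"
    using assms mi_order_upd[of "\<alpha>(i := \<alpha> i - 1)" i] by simp
  ultimately show ?thesis by (rule that)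
qed

text \<open>The opposite direction to \<open>norm_mollify_moment\<close>: all derivatives of the
  function go to the kernel, each at the price of a factor \<open>1 / s\<close>.\<close>

lemma norm_mollify_derivative:
  fixes \<kappa> :: "real^'n::finite \<Rightarrow> real"
  assumes "\<kappa> \<in> bumps" "mi_order \<alpha> = j"
  shows "\<exists>C\<ge>0. \<forall>\<Omega> m (D :: ('n \<Rightarrow> nat) \<Rightarrow> real^'n \<Rightarrow> 'b::euclidean_space) s x P.
    weak_family \<Omega> m D \<longrightarrow> j \<le> m \<longrightarrow> s > 0 \<longrightarrow> cball x s \<subseteq> \<Omega> \<longrightarrow>
    (LINT y:ball x s|lebesgue. norm (D (\<lambda>_. 0) y)) \<le> P * s ^ CARD('n) \<longrightarrow>
    norm (mollify (D \<alpha>) \<kappa> s x) \<le> C * (P / s ^ j)"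
  using assms
proof (induction j arbitrary: \<kappa> \<alpha>)
  case 0
  then have \<alpha>: "\<alpha> = (\<lambda>_. 0)" and "\<kappa> \<in> moment 0" by (auto simp: mi_order_0_iff)
  from norm_mollify_moment[OF this(2), where 'b = 'b] obtain C where C: "C \<ge> 0"
    "\<And>\<Omega> m (D :: ('n \<Rightarrow> nat) \<Rightarrow> real^'n \<Rightarrow> 'b) \<alpha> s x Q.
    weak_family \<Omega> m D \<Longrightarrow> mi_order \<alpha> + 0 \<le> m \<Longrightarrow> s > 0 \<Longrightarrow> cball x s \<subseteq> \<Omega> \<Longrightarrow>
    (\<And>\<beta>. mi_order \<beta> = mi_order \<alpha> + 0 \<Longrightarrow>
      (LINT y:ball x s|lebesgue. norm (D \<beta> y)) \<le> Q * s ^ CARD('n)) \<Longrightarrow>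
    norm (mollify (D \<alpha>) \<kappa> s x) \<le> C * s ^ 0 * Q" by blast
  have [simp]: "mi_order (\<lambda>_::'n. 0) = 0" by (simp add: mi_order_0_iff)
  show ?case
  proof (intro exI[of _ C] conjI allI impI C(1))
    fix \<Omega> m and D :: "('n \<Rightarrow> nat) \<Rightarrow> real^'n \<Rightarrow> 'b" and s x P
    assume *: "weak_family \<Omega> m D" "0 \<le> m" "s > 0" "cball x s \<subseteq> \<Omega>"
      "(LINT y:ball x s|lebesgue. norm (D (\<lambda>_. 0) y)) \<le> P * s ^ CARD('n)"
    have "norm (mollify (D \<alpha>) \<kappa> s x) \<le> C * s ^ 0 * P"
      by (rule C(2)[OF *(1)]) (use * in \<open>auto simp: \<alpha> mi_order_0_iff\<close>)
    then show "norm (mollify (D \<alpha>) \<kappa> s x) \<le> C * (P / s ^ 0)" by simp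
  qed
next
  case (Suc j)
  obtain i \<beta> where \<alpha>: "\<alpha> = bump_index i \<beta>" "mi_order \<beta> = j" by (rule mi_order_SucE[OF Suc.prems(2)])
  from Suc.IH[OF bumps_partial[OF Suc.prems(1), of i] \<alpha>(2)] obtain C where C: "C \<ge> 0"
    "\<And>\<Omega> m (D :: ('n \<Rightarrow> nat) \<Rightarrow> real^'n \<Rightarrow> 'b) s x P.
    weak_family \<Omega> m D \<Longrightarrow> j \<le> m \<Longrightarrow> s > 0 \<Longrightarrow> cball x s \<subseteq> \<Omega> \<Longrightarrow>
    (LINT y:ball x s|lebesgue. norm (D (\<lambda>_. 0) y)) \<le> P * s ^ CARD('n) \<Longrightarrow>
    norm (mollify (D \<beta>) (partial i \<kappa>) s x) \<le> C * (P / s ^ j)" by blast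
  show ?case
  proof (intro exI[of _ C] conjI allI impI C(1))
    fix \<Omega> m and D :: "('n \<Rightarrow> nat) \<Rightarrow> real^'n \<Rightarrow> 'b" and s x P
    assume *: "weak_family \<Omega> m D" "Suc j \<le> m" "s > 0" "cball x s \<subseteq> \<Omega>"
      "(LINT y:ball x s|lebesgue. norm (D (\<lambda>_. 0) y)) \<le> P * s ^ CARD('n)"
    have sub: "cball x (s / 2) \<subseteq> \<Omega>" using *(3,4) by (intro order_trans[OF subset_cball *(4)]) auto
    have "mollify (D \<beta>) (partial i \<kappa>) s x = (- s) *\<^sub>R mollify (D \<alpha>) \<kappa> s x"
      unfolding \<alpha>(1) using * \<alpha>(2) by (intro mollify_partial[OF *(1)] Suc.prems sub) auto
    then have "norm (mollify (D \<beta>) (partial i \<kappa>) s x) = s * norm (mollify (D \<alpha>) \<kappa> s x)"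
      using *(3) by simp
    moreover have "norm (mollify (D \<beta>) (partial i \<kappa>) s x) \<le> C * (P / s ^ j)"
      by (rule C(2)[OF *(1)]) (use * in auto)
    ultimately show "norm (mollify (D \<alpha>) \<kappa> s x) \<le> C * (P / s ^ Suc j)"
      using *(3) by (simp add: field_simps)
  qed
qed

text \<open>The size of the scale derivative is \<open>\<tau> ^ (k - 1) * Q\<close> up to a
  constant, since \<open>euler \<phi>\<close> has enough moments. For \<open>k \<ge> 1\<close> this
  is largest at \<open>\<tau> = t\<close>, so the mean value inequality costs at most
  \<open>t ^ k * Q\<close>, whatever the distance of \<open>s\<close> from 0.\<close>

lemma norm_mollify_interpolation:
  fixes \<phi> :: "real^'n::finite \<Rightarrow> real"
  assumes \<phi>: "\<phi> \<in> bumps" "euler \<phi> \<in> moment K" and k: "k \<le> K"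
  shows "\<exists>C\<ge>0. \<forall>\<Omega> m (D :: ('n \<Rightarrow> nat) \<Rightarrow> real^'n \<Rightarrow> 'b::euclidean_space) s t x P Q.
    weak_family \<Omega> m D \<longrightarrow> mi_order \<alpha> + k \<le> m \<longrightarrow> 0 < s \<longrightarrow> s \<le> t \<longrightarrow> cball x t \<subseteq> \<Omega> \<longrightarrow> 0 \<le> P \<longrightarrow> 0 \<le> Q \<longrightarrow>
    (\<forall>\<tau>. s \<le> \<tau> \<and> \<tau> \<le> t \<longrightarrow> (LINT y:ball x \<tau>|lebesgue. norm (D (\<lambda>_. 0) y)) \<le> P * \<tau> ^ CARD('n)) \<longrightarrow>
    (\<forall>\<beta> \<tau>. mi_order \<beta> = mi_order \<alpha> + k \<and> s \<le> \<tau> \<and> \<tau> \<le> t \<longrightarrow>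
      (LINT y:ball x \<tau>|lebesgue. norm (D \<beta> y)) \<le> Q * \<tau> ^ CARD('n)) \<longrightarrow>
    norm (mollify (D \<alpha>) \<phi> s x) \<le> C * (P / t ^ mi_order \<alpha> + t ^ k * Q)"
proof -
  from norm_mollify_derivative[OF \<phi>(1) refl, of \<alpha>, where 'b = 'b] obtain C1 where C1: "C1 \<ge> 0"
    "\<And>\<Omega> m (D :: ('n \<Rightarrow> nat) \<Rightarrow> real^'n \<Rightarrow> 'b) s x P.
    weak_family \<Omega> m D \<Longrightarrow> mi_order \<alpha> \<le> m \<Longrightarrow> s > 0 \<Longrightarrow> cball x s \<subseteq> \<Omega> \<Longrightarrow>
    (LINT y:ball x s|lebesgue. norm (D (\<lambda>_. 0) y)) \<le> P * s ^ CARD('n) \<Longrightarrow>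
    norm (mollify (D \<alpha>) \<phi> s x) \<le> C1 * (P / s ^ mi_order \<alpha>)" by blast
  \<comment> \<open>For \<open>k = 0\<close> the scale derivative would be of size
    \<open>Q / \<tau>\<close>, which is not bounded uniformly in \<open>s\<close>. There
    \<open>\<phi>\<close> itself is estimated by derivatives of the order of
    \<open>\<alpha>\<close>.\<close>
  have "(if k = 0 then \<phi> else euler \<phi>) \<in> moment k" using \<phi> k moment_antimono by auto
  from norm_mollify_moment[OF this, where 'b = 'b] obtain C2 where C2: "C2 \<ge> 0"
    "\<And>\<Omega> m (D :: ('n \<Rightarrow> nat) \<Rightarrow> real^'n \<Rightarrow> 'b) \<alpha> s x Q.
    weak_family \<Omega> m D \<Longrightarrow> mi_order \<alpha> + k \<le> m \<Longrightarrow> s > 0 \<Longrightarrow> cball x s \<subseteq> \<Omega> \<Longrightarrow>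
    (\<And>\<beta>. mi_order \<beta> = mi_order \<alpha> + k \<Longrightarrow>
      (LINT y:ball x s|lebesgue. norm (D \<beta> y)) \<le> Q * s ^ CARD('n)) \<Longrightarrow>
    norm (mollify (D \<alpha>) (if k = 0 then \<phi> else euler \<phi>) s x) \<le> C2 * s ^ k * Q" by blast
  show ?thesis
  proof (intro exI[of _ "C1 + C2"] conjI allI impI)
    show "C1 + C2 \<ge> 0" using C1 C2 by simp
    fix \<Omega> m and D :: "('n \<Rightarrow> nat) \<Rightarrow> real^'n \<Rightarrow> 'b" and s t :: real and x and P Q :: real
    assume *: "weak_family \<Omega> m D" "mi_order \<alpha> + k \<le> m" "0 < s" "s \<le> t" "cball x t \<subseteq> \<Omega>" "0 \<le> P" "0 \<le> Q"
    assume P: "\<forall>\<tau>. s \<le> \<tau> \<and> \<tau> \<le> t \<longrightarrow> (LINT y:ball x \<tau>|lebesgue. norm (D (\<lambda>_. 0) y)) \<le> P * \<tau> ^ CARD('n)"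
    assume Q: "\<forall>\<beta> \<tau>. mi_order \<beta> = mi_order \<alpha> + k \<and> s \<le> \<tau> \<and> \<tau> \<le> t \<longrightarrow>
      (LINT y:ball x \<tau>|lebesgue. norm (D \<beta> y)) \<le> Q * \<tau> ^ CARD('n)"
    have t: "t > 0" using * by linarith
    have sub: "cball x \<tau> \<subseteq> \<Omega>" if "\<tau> \<le> t" for \<tau>
      using subset_cball[OF that] *(5) by blast
    have P': "norm (mollify (D \<alpha>) \<phi> t x) \<le> C1 * (P / t ^ mi_order \<alpha>)"
      by (rule C1(2)[OF *(1)]) (use * t P in auto)
    have D2: "norm (mollify (D \<alpha>) (if k = 0 then \<phi> else euler \<phi>) \<tau> x) \<le> C2 * \<tau> ^ k * Q" if "s \<le> \<tau>" "\<tau> \<le> t" for \<tau>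
      by (rule C2(2)[OF *(1)]) (use * t Q that sub in auto)
    have "norm (mollify (D \<alpha>) \<phi> s x) \<le> C1 * (P / t ^ mi_order \<alpha>) + C2 * (t ^ k * Q)"
    proof (cases "k = 0")
      case True
      have "0 \<le> C1 * (P / t ^ mi_order \<alpha>)" using C1 * t by simp
      then show ?thesis using D2[of s] True * by simp
    next
      case False
      \<comment> \<open>The cut-off is integrable, as the scale derivative requires, and invisible
        at scales up to \<open>t\<close>.\<close>
      let ?g = "\<lambda>y. indicator (ball x t) y *\<^sub>R D \<alpha> y"
      have g: "integrable lebesgue ?g"
        using weak_family_integrable_ball(1)[OF *(1) _ *(5), of \<alpha> t] * by (simp add: set_integrable_def)
      have eq: "mollify ?g \<eta> \<tau> x = mollify (D \<alpha>) \<eta> \<tau> x" if "\<eta> \<in> bumps" "s \<le> \<tau>" "\<tau> \<le> t" for \<eta> \<tau>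
        by (rule mollify_cong) (use that * in auto)
      have "norm (mollify ?g \<phi> s x - mollify ?g \<phi> t x) \<le> (C2 * t ^ (k - 1) * Q) * \<bar>s - t\<bar>"
      proof (rule vector_lipschitz_bound[where F' = "\<lambda>\<tau>. (- (1 / \<tau>)) *\<^sub>R mollify ?g (euler \<phi>) \<tau> x"])
        fix \<tau> assume \<tau>: "\<tau> \<in> {s..t}"
        then have \<tau>0: "\<tau> > 0" using * by auto
        show "((\<lambda>\<tau>. mollify ?g \<phi> \<tau> x) has_vector_derivative (- (1 / \<tau>)) *\<^sub>R mollify ?g (euler \<phi>) \<tau> x) (at \<tau>)"
          by (rule mollify_has_scale_derivative[OF g \<phi>(1) \<tau>0])
        have "norm ((- (1 / \<tau>)) *\<^sub>R mollify ?g (euler \<phi>) \<tau> x) = (1 / \<tau>) * norm (mollify (D \<alpha>) (euler \<phi>) \<tau> x)"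
          using \<tau>0 \<tau> eq[OF euler_bumps[OF \<phi>(1)], of \<tau>] by simp
        also have "\<dots> \<le> (1 / \<tau>) * (C2 * \<tau> ^ k * Q)"
          using D2[of \<tau>] False \<tau> \<tau>0 by (intro mult_left_mono) auto
        also have "\<dots> = C2 * \<tau> ^ (k - 1) * Q"
          using \<tau>0 False by (cases k) auto
        also have "\<dots> \<le> C2 * t ^ (k - 1) * Q"
          using \<tau> \<tau>0 C2(1) * by (intro mult_right_mono mult_left_mono power_mono) auto
        finally show "norm ((- (1 / \<tau>)) *\<^sub>R mollify ?g (euler \<phi>) \<tau> x) \<le> C2 * t ^ (k - 1) * Q" .
      qed (use * in auto)
      also have "\<dots> \<le> (C2 * t ^ (k - 1) * Q) * t"
        using * C2(1) t by (intro mult_left_mono) auto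
      also have "\<dots> = C2 * (t ^ k * Q)"
        using False by (cases k) auto
      finally have "norm (mollify (D \<alpha>) \<phi> s x - mollify (D \<alpha>) \<phi> t x) \<le> C2 * (t ^ k * Q)"
        using eq[OF \<phi>(1)] * by simp
      then show ?thesis using P' norm_triangle_sub[of "mollify (D \<alpha>) \<phi> s x" "mollify (D \<alpha>) \<phi> t x"] by linarith
    qed
    also have "\<dots> \<le> (C1 + C2) * (P / t ^ mi_order \<alpha> + t ^ k * Q)"
    proof -
      have "0 \<le> P / t ^ mi_order \<alpha>" "0 \<le> t ^ k * Q" using * t by auto
      then show ?thesis
        using C1(1) C2(1) by (intro order_trans[OF _ eq_refl[OF distrib_right[symmetric]]] add_mono mult_left_mono) auto
    qed
    finally show "norm (mollify (D \<alpha>) \<phi> s x) \<le> (C1 + C2) * (P / t ^ mi_order \<alpha> + t ^ k * Q)" .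
  qed
qed

text \<open>The scale \<open>t = R / \<kappa>\<close> balances the two terms of the previous estimate; \<open>\<kappa>\<close> does not depend on
  the derivative \<open>\<alpha>\<close>, so that the bounds for two factors can be multiplied.\<close>

lemma norm_mollify_optimised:
  fixes \<phi> :: "real^'n::finite \<Rightarrow> real"
  assumes \<phi>: "\<phi> \<in> bumps" "euler \<phi> \<in> moment K" and n: "n \<le> K" "mi_order \<alpha> \<le> n"
  shows "\<exists>C\<ge>0. \<forall>\<Omega> m (D :: ('n \<Rightarrow> nat) \<Rightarrow> real^'n \<Rightarrow> 'b::euclidean_space) s R x U A B \<kappa>.
    weak_family \<Omega> m D \<longrightarrow> n \<le> m \<longrightarrow> 0 < s \<longrightarrow> s \<le> R \<longrightarrow> cball x R \<subseteq> \<Omega> \<longrightarrow> 0 \<le> U \<longrightarrow> 0 \<le> A \<longrightarrow> 0 \<le> B \<longrightarrow>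
    (\<forall>\<tau>. 0 < \<tau> \<and> \<tau> \<le> R \<longrightarrow> (LINT y:ball x \<tau>|lebesgue. norm (D (\<lambda>_. 0) y)) \<le> U * \<tau> ^ CARD('n)) \<longrightarrow>
    (\<forall>\<tau>. 0 < \<tau> \<and> \<tau> \<le> R \<longrightarrow> (LINT y:ball x \<tau>|lebesgue. norm (D (\<lambda>_. 0) y)) \<le> A * \<tau> ^ CARD('n)) \<longrightarrow>
    (\<forall>\<beta> \<tau>. mi_order \<beta> = n \<and> 0 < \<tau> \<and> \<tau> \<le> R \<longrightarrow>
      (LINT y:ball x \<tau>|lebesgue. norm (D \<beta> y)) \<le> B * \<tau> ^ CARD('n)) \<longrightarrow>
    0 \<le> \<kappa> \<longrightarrow> U * \<kappa> ^ n = A + R ^ n * B \<longrightarrow>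
    R ^ mi_order \<alpha> * norm (mollify (D \<alpha>) \<phi> s x) \<le> C * U * \<kappa> ^ mi_order \<alpha>"
proof -
  let ?j = "mi_order \<alpha>"
  from norm_mollify_derivative[OF \<phi>(1) refl, of \<alpha>, where 'b = 'b] obtain C1 where C1: "C1 \<ge> 0"
    "\<And>\<Omega> m (D :: ('n \<Rightarrow> nat) \<Rightarrow> real^'n \<Rightarrow> 'b) s x P.
    weak_family \<Omega> m D \<Longrightarrow> ?j \<le> m \<Longrightarrow> s > 0 \<Longrightarrow> cball x s \<subseteq> \<Omega> \<Longrightarrow>
    (LINT y:ball x s|lebesgue. norm (D (\<lambda>_. 0) y)) \<le> P * s ^ CARD('n) \<Longrightarrow>
    norm (mollify (D \<alpha>) \<phi> s x) \<le> C1 * (P / s ^ ?j)" by blast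
  have "n - ?j \<le> K" using n by simp
  from norm_mollify_interpolation[OF \<phi> this, of \<alpha>, where 'b = 'b] n obtain C2 where C2: "C2 \<ge> 0"
   "\<And>\<Omega> m (D :: ('n \<Rightarrow> nat) \<Rightarrow> real^'n \<Rightarrow> 'b) s t x P Q.
    weak_family \<Omega> m D \<Longrightarrow> n \<le> m \<Longrightarrow> 0 < s \<Longrightarrow> s \<le> t \<Longrightarrow> cball x t \<subseteq> \<Omega> \<Longrightarrow> 0 \<le> P \<Longrightarrow> 0 \<le> Q \<Longrightarrow>
    (\<forall>\<tau>. s \<le> \<tau> \<and> \<tau> \<le> t \<longrightarrow> (LINT y:ball x \<tau>|lebesgue. norm (D (\<lambda>_. 0) y)) \<le> P * \<tau> ^ CARD('n)) \<Longrightarrow>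
    (\<forall>\<beta> \<tau>. mi_order \<beta> = n \<and> s \<le> \<tau> \<and> \<tau> \<le> t \<longrightarrow>
      (LINT y:ball x \<tau>|lebesgue. norm (D \<beta> y)) \<le> Q * \<tau> ^ CARD('n)) \<Longrightarrow>
    norm (mollify (D \<alpha>) \<phi> s x) \<le> C2 * (P / t ^ ?j + t ^ (n - ?j) * Q)" by auto
  show ?thesis
  proof (intro exI[of _ "C1 + 2 * C2"] conjI allI impI)
    show "C1 + 2 * C2 \<ge> 0" using C1 C2 by simp
    fix \<Omega> m and D :: "('n \<Rightarrow> nat) \<Rightarrow> real^'n \<Rightarrow> 'b" and s R :: real and x and U A B \<kappa> :: real
    assume *: "weak_family \<Omega> m D" "n \<le> m" "0 < s" "s \<le> R" "cball x R \<subseteq> \<Omega>" "0 \<le> U" "0 \<le> A" "0 \<le> B"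
    assume bU: "\<forall>\<tau>. 0 < \<tau> \<and> \<tau> \<le> R \<longrightarrow> (LINT y:ball x \<tau>|lebesgue. norm (D (\<lambda>_. 0) y)) \<le> U * \<tau> ^ CARD('n)"
    assume bA: "\<forall>\<tau>. 0 < \<tau> \<and> \<tau> \<le> R \<longrightarrow> (LINT y:ball x \<tau>|lebesgue. norm (D (\<lambda>_. 0) y)) \<le> A * \<tau> ^ CARD('n)"
    assume bB: "\<forall>\<beta> \<tau>. mi_order \<beta> = n \<and> 0 < \<tau> \<and> \<tau> \<le> R \<longrightarrow>
      (LINT y:ball x \<tau>|lebesgue. norm (D \<beta> y)) \<le> B * \<tau> ^ CARD('n)"
    assume \<kappa>: "0 \<le> \<kappa>" "U * \<kappa> ^ n = A + R ^ n * B"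
    have R: "R > 0" using * by linarith
    have Rn: "R ^ n = R ^ ?j * R ^ (n - ?j)" using n(2) by (simp add: power_add[symmetric])
    have \<kappa>n: "\<kappa> ^ n = \<kappa> ^ ?j * \<kappa> ^ (n - ?j)" using n(2) by (simp add: power_add[symmetric])
    have \<kappa>j: "0 \<le> U * \<kappa> ^ ?j" using * \<kappa> by simp
    have "R ^ ?j * norm (mollify (D \<alpha>) \<phi> s x) \<le> C1 * (U * \<kappa> ^ ?j) \<or>
      R ^ ?j * norm (mollify (D \<alpha>) \<phi> s x) \<le> 2 * C2 * (U * \<kappa> ^ ?j)"
    proof (cases "\<kappa> \<le> 1")
      case True
      \<comment> \<open>The balancing scale \<open>R / \<kappa>\<close> is not below
        \<open>R\<close>, so the largest scale \<open>R\<close> is used, with the bound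
        \<open>A\<close>. The result \<open>U * \<kappa> ^ n\<close> is at most
        \<open>U * \<kappa> ^ mi_order \<alpha>\<close> because
        \<open>\<kappa> \<le> 1\<close>.\<close>
      have "norm (mollify (D \<alpha>) \<phi> s x) \<le> C2 * (A / R ^ ?j + R ^ (n - ?j) * B)"
        by (rule C2(2)[OF *(1)]) (use * bA bB in auto)
      then have "R ^ ?j * norm (mollify (D \<alpha>) \<phi> s x) \<le> R ^ ?j * (C2 * (A / R ^ ?j + R ^ (n - ?j) * B))"
        using R by (intro mult_left_mono) auto
      also have "\<dots> = C2 * (U * \<kappa> ^ n)"
        using R unfolding \<kappa>(2) Rn by (simp add: field_simps)
      also have "\<dots> \<le> C2 * (U * \<kappa> ^ ?j)"
        using True \<kappa>(1) n(2) C2(1) * by (intro mult_left_mono power_decreasing) auto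
      also have "\<dots> \<le> 2 * C2 * (U * \<kappa> ^ ?j)" using C2(1) \<kappa>j by simp
      finally show ?thesis by simp
    next
      case False
      then have \<kappa>1: "\<kappa> > 1" by simp
      show ?thesis
      proof (cases "s \<le> R / \<kappa>")
        case True
        define t where "t = R / \<kappa>"
        have t: "s \<le> t" "t \<le> R" "0 < t" using True \<kappa>1 R * by (auto simp: t_def field_simps)
        have "cball x t \<subseteq> \<Omega>" using subset_cball[OF t(2)] *(5) by blast
        then have "norm (mollify (D \<alpha>) \<phi> s x) \<le> C2 * (U / t ^ ?j + t ^ (n - ?j) * B)"
          using t * bU bB by (intro C2(2)[OF *(1)]) auto
        then have "R ^ ?j * norm (mollify (D \<alpha>) \<phi> s x) \<le> R ^ ?j * (C2 * (U / t ^ ?j + t ^ (n - ?j) * B))"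
          using R by (intro mult_left_mono) auto
        also have "\<dots> = C2 * (U * \<kappa> ^ ?j + R ^ n * B / \<kappa> ^ (n - ?j))"
          using R \<kappa>1 unfolding t_def Rn by (simp add: power_divide field_simps)
        also have "\<dots> \<le> C2 * (U * \<kappa> ^ ?j + U * \<kappa> ^ ?j)"
        proof (intro mult_left_mono add_left_mono C2(1))
          have "R ^ n * B \<le> U * \<kappa> ^ ?j * \<kappa> ^ (n - ?j)"
            using \<kappa>(2) \<kappa>n *(7) by (simp add: mult.assoc)
          then show "R ^ n * B / \<kappa> ^ (n - ?j) \<le> U * \<kappa> ^ ?j"
            using \<kappa>1 by (simp add: divide_le_eq)
        qed
        finally show ?thesis by simp
      next
        case False
        \<comment> \<open>Here \<open>s\<close> exceeds the balancing scale. All derivatives are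
          moved to the kernel at scale \<open>s\<close> itself, and \<open>R / s\<close> is below
          \<open>\<kappa>\<close>.\<close>
        have "norm (mollify (D \<alpha>) \<phi> s x) \<le> C1 * (U / s ^ ?j)"
          using * bU n(2) subset_cball[OF *(4), of x] by (intro C1(2)[OF *(1)]) auto
        then have "R ^ ?j * norm (mollify (D \<alpha>) \<phi> s x) \<le> R ^ ?j * (C1 * (U / s ^ ?j))"
          using R by (intro mult_left_mono) auto
        also have "\<dots> = C1 * (U * (R / s) ^ ?j)" by (simp add: power_divide)
        also have "\<dots> \<le> C1 * (U * \<kappa> ^ ?j)"
          using False * \<kappa>1 C1(1) R by (intro mult_left_mono power_mono) (auto simp: field_simps)
        finally show ?thesis by simp
      qed
    qed
    then show "R ^ ?j * norm (mollify (D \<alpha>) \<phi> s x) \<le> (C1 + 2 * C2) * U * \<kappa> ^ ?j"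
    proof
      assume "R ^ ?j * norm (mollify (D \<alpha>) \<phi> s x) \<le> C1 * (U * \<kappa> ^ ?j)"
      also have "\<dots> \<le> (C1 + 2 * C2) * (U * \<kappa> ^ ?j)" using C2(1) \<kappa>j by (intro mult_right_mono) auto
      finally show ?thesis by (simp add: mult.assoc)
    next
      assume "R ^ ?j * norm (mollify (D \<alpha>) \<phi> s x) \<le> 2 * C2 * (U * \<kappa> ^ ?j)"
      also have "\<dots> \<le> (C1 + 2 * C2) * (U * \<kappa> ^ ?j)" using C1(1) \<kappa>j by (intro mult_right_mono) auto
      finally show ?thesis by (simp add: mult.assoc)
    qed
  qed
qed

subsection \<open>The weak Leibniz rule\<close>

text \<open>A list with repetitions takes the place of binomial coefficients: every letter of the
  word goes to one factor or the other.\<close>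

primrec leibniz :: "'n list \<Rightarrow> ('n \<Rightarrow> nat) \<Rightarrow> ('n \<Rightarrow> nat) \<Rightarrow> (('n \<Rightarrow> nat) \<times> ('n \<Rightarrow> nat)) list" where
  "leibniz [] \<alpha> \<beta> = [(\<alpha>, \<beta>)]"
| "leibniz (i # w) \<alpha> \<beta> = leibniz w (bump_index i \<alpha>) \<beta> @ leibniz w \<alpha> (bump_index i \<beta>)"

lemma leibniz_order:
  fixes \<alpha> \<beta> :: "'n::finite \<Rightarrow> nat"
  assumes "(\<gamma>, \<delta>) \<in> set (leibniz w \<alpha> \<beta>)"
  shows "mi_order \<gamma> + mi_order \<delta> = mi_order \<alpha> + mi_order \<beta> + length w"
  using assms
proof (induction w arbitrary: \<alpha> \<beta>)
  case (Cons i w)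
  then have "(\<gamma>, \<delta>) \<in> set (leibniz w (bump_index i \<alpha>) \<beta>) \<or> (\<gamma>, \<delta>) \<in> set (leibniz w \<alpha> (bump_index i \<beta>))"
    by (auto simp del: fun_upd_apply)
  then show ?case using Cons.IH by (auto simp: mi_order_upd simp del: fun_upd_apply)
qed simp

text \<open>Continuity and differentiability of mollifications are available for integrable
  functions. The cut-off to the \<open>\<delta>\<close>-neighbourhood of \<open>K\<close> is one and
  agrees with \<open>D \<alpha>\<close> wherever mollification at points of \<open>K\<close>
  looks.\<close>

lemma mollify_localise:
  fixes D :: "('n::finite \<Rightarrow> nat) \<Rightarrow> real^'n \<Rightarrow> 'b::euclidean_space"
  assumes D: "weak_family \<Omega> m D" "mi_order \<alpha> \<le> m" and K: "compact K" "\<And>x. x \<in> K \<Longrightarrow> cball x \<delta> \<subseteq> \<Omega>"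
  obtains F where "integrable lebesgue F"
    "\<And>x \<kappa> s. x \<in> K \<Longrightarrow> \<kappa> \<in> bumps \<Longrightarrow> 0 < s \<Longrightarrow> s \<le> \<delta> \<Longrightarrow> mollify F \<kappa> s x = mollify (D \<alpha>) \<kappa> s x"
proof
  let ?K = "{x + y | x y. x \<in> K \<and> y \<in> cball 0 \<delta>}"
  have cK: "compact ?K" by (rule compact_sums[OF K(1) compact_cball])
  have sub: "?K \<subseteq> \<Omega>"
  proof safe
    fix x y :: "real^'n" assume "x \<in> K" "y \<in> cball 0 \<delta>"
    then have "x + y \<in> cball x \<delta>" by (simp add: dist_norm)
    then show "x + y \<in> \<Omega>" using K(2)[OF \<open>x \<in> K\<close>] by blast
  qed
  show "integrable lebesgue (\<lambda>y. indicator ?K y *\<^sub>R D \<alpha> y)"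
    using D cK sub by (auto simp: weak_family_def locally_integrable_def set_integrable_def)
  fix x :: "real^'n" and \<kappa> :: "real^'n \<Rightarrow> real" and s assume x: "x \<in> K" "\<kappa> \<in> bumps" "0 < s" "s \<le> \<delta>"
  show "mollify (\<lambda>y. indicator ?K y *\<^sub>R D \<alpha> y) \<kappa> s x = mollify (D \<alpha>) \<kappa> s x"
  proof (rule mollify_cong[OF x(2,3)])
    fix y assume y: "y \<in> ball x s"
    have "y = x + (y - x) \<and> x \<in> K \<and> y - x \<in> cball 0 \<delta>"
      using x y by (auto simp: dist_norm norm_minus_commute)
    then have "y \<in> ?K" by blast
    then show "indicator ?K y *\<^sub>R D \<alpha> y = D \<alpha> y" by simp
  qed
qed

lemma integrable_lebesgue_compact_support:
  fixes h :: "'a::euclidean_space \<Rightarrow> 'b::euclidean_space"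
  assumes h: "continuous_on UNIV h" and K: "compact K" "\<And>x. x \<notin> K \<Longrightarrow> h x = 0"
  shows "integrable lebesgue h" "integrable lborel h" "(LINT x|lebesgue. h x) = (LINT x|lborel. h x)"
    "\<exists>B\<ge>0. \<forall>x. norm (h x) \<le> B"
proof -
  obtain R where R: "\<And>x. x \<in> K \<Longrightarrow> norm x \<le> R" using compact_imp_bounded[OF K(1)] by (auto simp: bounded_iff)
  have z: "h x = 0" if "norm x > R" for x using R[of x] K(2)[of x] that by auto
  show i: "integrable lborel h" by (rule integrable_lborel_bounded_support(1)[OF h z])
  show "\<exists>B\<ge>0. \<forall>x. norm (h x) \<le> B" by (rule integrable_lborel_bounded_support(2)[OF h z])
  have m: "h \<in> borel_measurable lborel" using h by (simp add: borel_measurable_continuous_onI)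
  show "integrable lebesgue h" using i by (simp add: integrable_completion[OF m])
  show "(LINT x|lebesgue. h x) = (LINT x|lborel. h x)" by (rule integral_completion[OF m])
qed

lemma smooth_zero_outside_partial:
  assumes "compact K" "\<And>x. x \<notin> K \<Longrightarrow> \<theta> x = 0" "x \<notin> K"
  shows "partial i \<theta> x = 0"
proof -
  have "partial i \<theta> x = partial i (\<lambda>_. 0) x"
    by (rule partial_cong_open[of "- K"]) (use assms compact_imp_closed in auto)
  then show ?thesis by (simp add: partial_const)
qed

text \<open>The mollifications of cut-off functions have continuous partial derivatives, so the
  product rule applies to \<open>\<theta>\<close> times both, and the integral of the resulting
  derivative is 0. The cut-off versions are the true mollifications on \<open>K\<close> only, but
  \<open>\<theta>\<close> and its derivatives vanish elsewhere.\<close>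

lemma mollify_product_by_parts:
  fixes D E :: "('n::finite \<Rightarrow> nat) \<Rightarrow> real^'n \<Rightarrow> 'b::{real_normed_field, euclidean_space}"
  assumes D: "weak_family \<Omega> m D" and E: "weak_family \<Omega> m E" and \<alpha>: "mi_order \<alpha> < m" and \<beta>: "mi_order \<beta> < m"
    and K: "compact K" "\<And>x. x \<in> K \<Longrightarrow> cball x \<delta> \<subseteq> \<Omega>" and \<theta>: "smooth \<theta>" "\<And>x. x \<notin> K \<Longrightarrow> \<theta> x = 0"
    and s: "0 < s" "s \<le> \<delta>" and \<phi>: "\<phi> \<in> bumps"
  shows "(LINT x|lebesgue. partial i \<theta> x *\<^sub>R (mollify (D \<alpha>) \<phi> s x * mollify (E \<beta>) \<phi> s x))
    = - ((LINT x|lebesgue. \<theta> x *\<^sub>R (mollify (D (bump_index i \<alpha>)) \<phi> s x * mollify (E \<beta>) \<phi> s x))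
       + (LINT x|lebesgue. \<theta> x *\<^sub>R (mollify (D \<alpha>) \<phi> s x * mollify (E (bump_index i \<beta>)) \<phi> s x)))"
proof -
  obtain F where F: "integrable lebesgue F"
    "\<And>x \<kappa> s. x \<in> K \<Longrightarrow> \<kappa> \<in> bumps \<Longrightarrow> 0 < s \<Longrightarrow> s \<le> \<delta> \<Longrightarrow> mollify F \<kappa> s x = mollify (D \<alpha>) \<kappa> s x"
    using mollify_localise[OF D less_imp_le[OF \<alpha>] K] by metis
  obtain G where G: "integrable lebesgue G"
    "\<And>x \<kappa> s. x \<in> K \<Longrightarrow> \<kappa> \<in> bumps \<Longrightarrow> 0 < s \<Longrightarrow> s \<le> \<delta> \<Longrightarrow> mollify G \<kappa> s x = mollify (E \<beta>) \<kappa> s x"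
    using mollify_localise[OF E less_imp_le[OF \<beta>] K] by metis
  let ?f = "mollify F \<phi> s" and ?g = "mollify G \<phi> s"
  let ?f' = "\<lambda>x. (- (1 / s)) *\<^sub>R mollify F (partial i \<phi>) s x"
  let ?g' = "\<lambda>x. (- (1 / s)) *\<^sub>R mollify G (partial i \<phi>) s x"
  have \<phi>': "partial i \<phi> \<in> bumps" by (rule bumps_partial[OF \<phi>])
  have sub: "cball x (s / 2) \<subseteq> \<Omega>" if "x \<in> K" for x
    using s K(2)[OF that] by (intro order_trans[OF subset_cball K(2)[OF that]]) auto
  have cf: "continuous_on UNIV ?f" "continuous_on UNIV ?g" "continuous_on UNIV ?f'" "continuous_on UNIV ?g'"
    by (intro continuous_intros mollify_continuous F G \<phi> \<phi>' s)+
  have ct: "continuous_on UNIV \<theta>" "continuous_on UNIV (partial i \<theta>)"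
    using \<theta>(1) smooth_continuous smooth_partial by blast+
  have z: "partial i \<theta> x = 0" if "x \<notin> K" for x
    by (rule smooth_zero_outside_partial[OF K(1) \<theta>(2) that])
  let ?h1 = "\<lambda>x. partial i \<theta> x *\<^sub>R (?f x * ?g x)"
  let ?h2 = "\<lambda>x. \<theta> x *\<^sub>R (?f' x * ?g x)"
  let ?h3 = "\<lambda>x. \<theta> x *\<^sub>R (?f x * ?g' x)"
  have ch: "continuous_on UNIV ?h1" "continuous_on UNIV ?h2" "continuous_on UNIV ?h3"
    by (intro continuous_intros cf ct)+
  have zh: "?h1 x = 0" "?h2 x = 0" "?h3 x = 0" if "x \<notin> K" for x using z[OF that] \<theta>(2)[OF that] by auto
  have i1: "integrable lborel ?h1" "(LINT x|lebesgue. ?h1 x) = (LINT x|lborel. ?h1 x)"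
    by (rule integrable_lebesgue_compact_support[OF ch(1) K(1)], erule zh)+
  have i2: "integrable lborel ?h2" "(LINT x|lebesgue. ?h2 x) = (LINT x|lborel. ?h2 x)"
    by (rule integrable_lebesgue_compact_support[OF ch(2) K(1)], erule zh)+
  have i3: "integrable lborel ?h3" "(LINT x|lebesgue. ?h3 x) = (LINT x|lborel. ?h3 x)"
    by (rule integrable_lebesgue_compact_support[OF ch(3) K(1)], erule zh)+
  obtain R where R: "\<And>x. x \<in> K \<Longrightarrow> norm x \<le> R" using compact_imp_bounded[OF K(1)] by (auto simp: bounded_iff)
  have out: "x \<notin> K" if "norm x > R" for x using R[of x] that by auto
  have I0: "(LINT x|lborel. ?h1 x + (?h2 x + ?h3 x)) = 0"
  proof (rule integral_directional_derivative_eq_0[where h = "\<lambda>x. \<theta> x *\<^sub>R (?f x * ?g x)" and e = "axis i 1" and R = R])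
    show "continuous_on UNIV (\<lambda>x. \<theta> x *\<^sub>R (?f x * ?g x))" by (intro continuous_intros cf ct)
    show "continuous_on UNIV (\<lambda>x. ?h1 x + (?h2 x + ?h3 x))" by (intro continuous_on_add ch)
    show "\<theta> x *\<^sub>R (?f x * ?g x) = 0" if "norm x > R" for x using \<theta>(2)[OF out[OF that]] by simp
    show "?h1 x + (?h2 x + ?h3 x) = 0" if "norm x > R" for x
      unfolding zh[OF out[OF that]] by simp
    show "((\<lambda>t. \<theta> (x + t *\<^sub>R axis i 1) *\<^sub>R (?f (x + t *\<^sub>R axis i 1) * ?g (x + t *\<^sub>R axis i 1)))
        has_vector_derivative ?h1 x + (?h2 x + ?h3 x)) (at 0)" for x
    proof -
      have "((\<lambda>t. \<theta> (x + t *\<^sub>R axis i 1)) has_real_derivative partial i \<theta> x) (at 0)"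
        by (rule partial_has_vector_derivative[OF smooth_differentiable[OF \<theta>(1)]])
      moreover have "((\<lambda>t. ?f (x + t *\<^sub>R axis i 1) * ?g (x + t *\<^sub>R axis i 1)) has_vector_derivative
          ?f (x + 0 *\<^sub>R axis i 1) * ?g' x + ?f' x * ?g (x + 0 *\<^sub>R axis i 1)) (at 0)"
        by (intro has_vector_derivative_mult mollify_has_partial F G \<phi> s)
      ultimately have "((\<lambda>t. \<theta> (x + t *\<^sub>R axis i 1) *\<^sub>R (?f (x + t *\<^sub>R axis i 1) * ?g (x + t *\<^sub>R axis i 1)))
        has_vector_derivative \<theta> (x + 0 *\<^sub>R axis i 1) *\<^sub>R (?f (x + 0 *\<^sub>R axis i 1) * ?g' x + ?f' x * ?g (x + 0 *\<^sub>R axis i 1))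
          + partial i \<theta> x *\<^sub>R (?f (x + 0 *\<^sub>R axis i 1) * ?g (x + 0 *\<^sub>R axis i 1))) (at 0)"
        by (rule has_vector_derivative_scaleR)
      moreover have "\<theta> (x + 0 *\<^sub>R axis i 1) *\<^sub>R (?f (x + 0 *\<^sub>R axis i 1) * ?g' x + ?f' x * ?g (x + 0 *\<^sub>R axis i 1))
          + partial i \<theta> x *\<^sub>R (?f (x + 0 *\<^sub>R axis i 1) * ?g (x + 0 *\<^sub>R axis i 1)) = ?h1 x + (?h2 x + ?h3 x)"
        by (simp only: scaleR_zero_left add_0_right add_0_left scaleR_add_right add_ac)
      ultimately show ?thesis by (simp only:)
    qed
  qed
  have I1: "(LINT x|lborel. ?h1 x + (?h2 x + ?h3 x))
      = (LINT x|lborel. ?h1 x) + ((LINT x|lborel. ?h2 x) + (LINT x|lborel. ?h3 x))"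
    using Bochner_Integration.integral_add[OF i1(1) Bochner_Integration.integrable_add[OF i2(1) i3(1)]]
      Bochner_Integration.integral_add[OF i2(1) i3(1)] by (rule trans[OF _ arg_cong])
  have "(LINT x|lebesgue. ?h1 x) + ((LINT x|lebesgue. ?h2 x) + (LINT x|lebesgue. ?h3 x)) = 0"
    unfolding i1(2) i2(2) i3(2) by (rule trans[OF I1[symmetric] I0])
  then have "(LINT x|lebesgue. ?h1 x) = - ((LINT x|lebesgue. ?h2 x) + (LINT x|lebesgue. ?h3 x))"
    by (rule eq_neg_iff_add_eq_0[THEN iffD2])
  moreover have "?h1 x = partial i \<theta> x *\<^sub>R (mollify (D \<alpha>) \<phi> s x * mollify (E \<beta>) \<phi> s x)" for x
    using z[of x] F(2)[of x \<phi> s] G(2)[of x \<phi> s] s \<phi> by (cases "x \<in> K") auto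
  moreover have "?h2 x = \<theta> x *\<^sub>R (mollify (D (bump_index i \<alpha>)) \<phi> s x * mollify (E \<beta>) \<phi> s x)" for x
    using \<theta>(2)[of x] F(2)[of x "partial i \<phi>" s] G(2)[of x \<phi> s] s \<phi> \<phi>' mollify_partial[OF D \<alpha> \<phi> s(1) sub, of x i]
    by (cases "x \<in> K") auto
  moreover have "?h3 x = \<theta> x *\<^sub>R (mollify (D \<alpha>) \<phi> s x * mollify (E (bump_index i \<beta>)) \<phi> s x)" for x
    using \<theta>(2)[of x] G(2)[of x "partial i \<phi>" s] F(2)[of x \<phi> s] s \<phi> \<phi>' mollify_partial[OF E \<beta> \<phi> s(1) sub, of x i]
    by (cases "x \<in> K") auto
  ultimately show ?thesis by (simp only:)
qed

lemma foldr_partial_zero_outside: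
  assumes "compact K" "\<And>x. x \<notin> K \<Longrightarrow> \<psi> x = 0" "x \<notin> K"
  shows "foldr partial w \<psi> x = 0"
  using assms(3)
proof (induction w arbitrary: x)
  case (Cons i w)
  show ?case using smooth_zero_outside_partial[OF assms(1) Cons.IH Cons.prems] by simp
qed (simp add: assms(2))

lemma mollify_leibniz:
  fixes D E :: "('n::finite \<Rightarrow> nat) \<Rightarrow> real^'n \<Rightarrow> 'b::{real_normed_field, euclidean_space}"
  assumes D: "weak_family \<Omega> m D" and E: "weak_family \<Omega> m E"
    and K: "compact K" "\<And>x. x \<in> K \<Longrightarrow> cball x \<delta> \<subseteq> \<Omega>" and \<psi>: "smooth \<psi>" "\<And>x. x \<notin> K \<Longrightarrow> \<psi> x = 0"
    and s: "0 < s" "s \<le> \<delta>" and \<phi>: "\<phi> \<in> bumps"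
    and w: "mi_order \<alpha> + length w \<le> m" "mi_order \<beta> + length w \<le> m"
  shows "(LINT x|lebesgue. foldr partial w \<psi> x *\<^sub>R (mollify (D \<alpha>) \<phi> s x * mollify (E \<beta>) \<phi> s x))
    = (-1) ^ length w *\<^sub>R (\<Sum>(\<gamma>, \<epsilon>)\<leftarrow>leibniz w \<alpha> \<beta>.
        LINT x|lebesgue. \<psi> x *\<^sub>R (mollify (D \<gamma>) \<phi> s x * mollify (E \<epsilon>) \<phi> s x))"
  using w
proof (induction w arbitrary: \<alpha> \<beta>)
  case (Cons i w)
  have "(LINT x|lebesgue. foldr partial (i # w) \<psi> x *\<^sub>R (mollify (D \<alpha>) \<phi> s x * mollify (E \<beta>) \<phi> s x))
    = - ((LINT x|lebesgue. foldr partial w \<psi> x *\<^sub>R (mollify (D (bump_index i \<alpha>)) \<phi> s x * mollify (E \<beta>) \<phi> s x))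
       + (LINT x|lebesgue. foldr partial w \<psi> x *\<^sub>R (mollify (D \<alpha>) \<phi> s x * mollify (E (bump_index i \<beta>)) \<phi> s x)))"
    using Cons.prems unfolding foldr.simps o_apply
    by (intro mollify_product_by_parts[OF D E _ _ K _ _ s \<phi>] smooth_foldr_partial \<psi>
        foldr_partial_zero_outside[OF K(1)]) auto
  then show ?case
    using Cons.IH[of "bump_index i \<alpha>" \<beta>] Cons.IH[of \<alpha> "bump_index i \<beta>"] Cons.prems
    by (simp add: mi_order_upd scaleR_add_right del: fun_upd_apply)
qed simp

section \<open>Domination and the limit of vanishing scale\<close>

text \<open>The envelope \<open>G\<close> must not depend on the scale, whereas \<open>r\<close>
  lets the range of admissible scales shrink towards the boundary of \<open>\<Omega>\<close>. This
  is the only information on products of derivatives that the limit uses.\<close>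

definition product_dominated ::
  "(real^'n::finite) set \<Rightarrow> (('n \<Rightarrow> nat) \<Rightarrow> real^'n \<Rightarrow> 'b::euclidean_space) \<Rightarrow>
   (('n \<Rightarrow> nat) \<Rightarrow> real^'n \<Rightarrow> 'b) \<Rightarrow> (real^'n \<Rightarrow> real) \<Rightarrow> (real^'n \<Rightarrow> real) \<Rightarrow> ('n \<Rightarrow> nat) \<Rightarrow> ('n \<Rightarrow> nat) \<Rightarrow>
   (real^'n \<Rightarrow> real) \<Rightarrow> bool" where
  "product_dominated \<Omega> D E \<phi> r \<alpha> \<beta> G \<longleftrightarrow> locally_integrable \<Omega> G \<and>
    (AE x in lebesgue. x \<in> \<Omega> \<longrightarrow> (\<forall>s. 0 < s \<and> s \<le> r x \<longrightarrow>
      norm (mollify (D \<alpha>) \<phi> s x) * norm (mollify (E \<beta>) \<phi> s x) \<le> G x))"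

text \<open>All three conclusions rest on the same pointwise limit. The envelope passes to the
  limit, there it yields local integrability of the product, and on compact sets it is the majorant
  for dominated convergence.\<close>

lemma
  fixes D E :: "('n::finite \<Rightarrow> nat) \<Rightarrow> real^'n \<Rightarrow> 'b::{real_normed_field, euclidean_space}"
  assumes \<Omega>: "open \<Omega>" and D: "weak_family \<Omega> m D" and E: "weak_family \<Omega> m E"
    and \<alpha>: "mi_order \<alpha> \<le> m" and \<beta>: "mi_order \<beta> \<le> m"
    and \<phi>: "\<phi> \<in> bumps" "(LINT x|lborel. \<phi> x) = 1"
    and r: "\<And>x. x \<in> \<Omega> \<Longrightarrow> r x > 0"
    and G: "product_dominated \<Omega> D E \<phi> r \<alpha> \<beta> G"
  shows AE_product_le: "AE x in lebesgue. x \<in> \<Omega> \<longrightarrow> norm (D \<alpha> x * E \<beta> x) \<le> G x"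
    and locally_integrable_product: "locally_integrable \<Omega> (\<lambda>x. D \<alpha> x * E \<beta> x)"
    and mollify_product_tendsto: "\<lbrakk>compact K; K \<subseteq> \<Omega>; \<And>x. x \<in> K \<Longrightarrow> cball x \<delta> \<subseteq> \<Omega> \<and> \<delta> \<le> r x; smooth \<psi>;
      \<And>x. x \<notin> K \<Longrightarrow> \<psi> x = 0; \<And>k. 0 < \<sigma> k \<and> \<sigma> k \<le> \<delta>; \<sigma> \<longlonglongrightarrow> 0\<rbrakk> \<Longrightarrow>
      (\<lambda>k. LINT x|lebesgue. \<psi> x *\<^sub>R (mollify (D \<alpha>) \<phi> (\<sigma> k) x * mollify (E \<beta>) \<phi> (\<sigma> k) x))
        \<longlonglongrightarrow> (LINT x|lebesgue. \<psi> x *\<^sub>R (D \<alpha> x * E \<beta> x))"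
proof -
  have li: "locally_integrable \<Omega> (D \<alpha>)" "locally_integrable \<Omega> (E \<beta>)" "locally_integrable \<Omega> G"
    using D E \<alpha> \<beta> G by (auto simp: weak_family_def product_dominated_def)
  have dom: "AE x in lebesgue. x \<in> \<Omega> \<longrightarrow> (\<forall>s. 0 < s \<and> s \<le> r x \<longrightarrow>
      norm (mollify (D \<alpha>) \<phi> s x) * norm (mollify (E \<beta>) \<phi> s x) \<le> G x)"
    using G by (simp add: product_dominated_def)
  have lim: "AE x in lebesgue. x \<in> \<Omega> \<longrightarrow>
    ((\<lambda>s. mollify (D \<alpha>) \<phi> s x * mollify (E \<beta>) \<phi> s x) \<longlongrightarrow> D \<alpha> x * E \<beta> x) (at_right 0)"
    using AE_mollify_tendsto_local[OF \<Omega> li(1)] AE_mollify_tendsto_local[OF \<Omega> li(2)]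
  proof eventually_elim
    case (elim x)
    show ?case
    proof
      assume "x \<in> \<Omega>"
      then have "((\<lambda>s. mollify (D \<alpha>) \<phi> s x) \<longlongrightarrow> D \<alpha> x) (at_right 0)"
        "((\<lambda>s. mollify (E \<beta>) \<phi> s x) \<longlongrightarrow> E \<beta> x) (at_right 0)"
        using elim \<phi> by fastforce+
      then show "((\<lambda>s. mollify (D \<alpha>) \<phi> s x * mollify (E \<beta>) \<phi> s x) \<longlongrightarrow> D \<alpha> x * E \<beta> x) (at_right 0)"
        by (rule tendsto_mult)
    qed
  qed
  show le: "AE x in lebesgue. x \<in> \<Omega> \<longrightarrow> norm (D \<alpha> x * E \<beta> x) \<le> G x"
    using dom lim
  proof eventually_elim
    case (elim x)
    show ?case
    proof
      assume x: "x \<in> \<Omega>"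
      then have "((\<lambda>s. norm (mollify (D \<alpha>) \<phi> s x * mollify (E \<beta>) \<phi> s x)) \<longlongrightarrow> norm (D \<alpha> x * E \<beta> x)) (at_right 0)"
        using elim by (intro tendsto_norm) auto
      moreover have "\<forall>\<^sub>F s in at_right 0. norm (mollify (D \<alpha>) \<phi> s x * mollify (E \<beta>) \<phi> s x) \<le> G x"
        using elim x r[OF x] by (intro eventually_at_rightI[of 0 "r x"]) (auto simp: norm_mult)
      ultimately show "norm (D \<alpha> x * E \<beta> x) \<le> G x"
        by (rule tendsto_upperbound) simp
    qed
  qed
  show "locally_integrable \<Omega> (\<lambda>x. D \<alpha> x * E \<beta> x)"
    unfolding locally_integrable_def
  proof safe
    fix K assume K: "compact K" "K \<subseteq> \<Omega>"
    have iD: "integrable lebesgue (\<lambda>x. indicator K x *\<^sub>R D \<alpha> x)" and iE: "integrable lebesgue (\<lambda>x. indicator K x *\<^sub>R E \<beta> x)"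
      and iG: "integrable lebesgue (\<lambda>x. indicator K x *\<^sub>R G x)"
      using li K by (auto simp: locally_integrable_def set_integrable_def)
    have eq: "indicator K x *\<^sub>R (D \<alpha> x * E \<beta> x) = (indicator K x *\<^sub>R D \<alpha> x) * (indicator K x *\<^sub>R E \<beta> x)" for x
      by (simp add: indicator_def)
    show "set_integrable lebesgue K (\<lambda>x. D \<alpha> x * E \<beta> x)"
      unfolding set_integrable_def
    proof (rule Bochner_Integration.integrable_bound[OF iG])
      show "(\<lambda>x. indicator K x *\<^sub>R (D \<alpha> x * E \<beta> x)) \<in> borel_measurable lebesgue"
        unfolding eq using iD iE by (intro borel_measurable_times) auto
      show "AE x in lebesgue. norm (indicator K x *\<^sub>R (D \<alpha> x * E \<beta> x)) \<le> norm (indicator K x *\<^sub>R G x)"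
        using le by eventually_elim (use K(2) in \<open>auto simp: indicator_def\<close>)
    qed
  qed
  note lip = this
  show "(\<lambda>k. LINT x|lebesgue. \<psi> x *\<^sub>R (mollify (D \<alpha>) \<phi> (\<sigma> k) x * mollify (E \<beta>) \<phi> (\<sigma> k) x))
        \<longlonglongrightarrow> (LINT x|lebesgue. \<psi> x *\<^sub>R (D \<alpha> x * E \<beta> x))"
    if K: "compact K" "K \<subseteq> \<Omega>" "\<And>x. x \<in> K \<Longrightarrow> cball x \<delta> \<subseteq> \<Omega> \<and> \<delta> \<le> r x" and \<psi>: "smooth \<psi>"
      "\<And>x. x \<notin> K \<Longrightarrow> \<psi> x = 0" and \<sigma>: "\<And>k. 0 < \<sigma> k \<and> \<sigma> k \<le> \<delta>" "\<sigma> \<longlonglongrightarrow> 0" for K \<delta> \<psi> and \<sigma> :: "nat \<Rightarrow> real"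
  proof -
    have c\<psi>: "continuous_on UNIV \<psi>" by (rule smooth_continuous[OF \<psi>(1)])
    obtain B where B: "B \<ge> 0" "\<And>x. \<bar>\<psi> x\<bar> \<le> B"
      using integrable_lebesgue_compact_support(4)[OF c\<psi> K(1) \<psi>(2)] by auto
    obtain F where F: "integrable lebesgue F"
      "\<And>x \<kappa> s. x \<in> K \<Longrightarrow> \<kappa> \<in> bumps \<Longrightarrow> 0 < s \<Longrightarrow> s \<le> \<delta> \<Longrightarrow> mollify F \<kappa> s x = mollify (D \<alpha>) \<kappa> s x"
      using mollify_localise[OF D \<alpha> K(1), of \<delta>] K(3) by metis
    obtain H where H: "integrable lebesgue H"
      "\<And>x \<kappa> s. x \<in> K \<Longrightarrow> \<kappa> \<in> bumps \<Longrightarrow> 0 < s \<Longrightarrow> s \<le> \<delta> \<Longrightarrow> mollify H \<kappa> s x = mollify (E \<beta>) \<kappa> s x"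
      using mollify_localise[OF E \<beta> K(1), of \<delta>] K(3) by metis
    have iG: "integrable lebesgue (\<lambda>x. B * (indicator K x *\<^sub>R G x))"
      using li(3) K by (intro integrable_mult_right) (auto simp: locally_integrable_def set_integrable_def)
    have iDE: "integrable lebesgue (\<lambda>x. indicator K x *\<^sub>R (D \<alpha> x * E \<beta> x))"
      using lip K by (auto simp: locally_integrable_def set_integrable_def)
    have m\<psi>: "\<psi> \<in> borel_measurable lebesgue"
      by (rule measurable_completion) (simp add: borel_measurable_continuous_onI[OF c\<psi>])
    show ?thesis
    proof (rule integral_dominated_convergence[OF _ _ iG])
      have "\<psi> x *\<^sub>R (D \<alpha> x * E \<beta> x) = \<psi> x *\<^sub>R (indicator K x *\<^sub>R (D \<alpha> x * E \<beta> x))" for x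
        using \<psi>(2)[of x] by (cases "x \<in> K") auto
      moreover have "(\<lambda>x. \<psi> x *\<^sub>R (indicator K x *\<^sub>R (D \<alpha> x * E \<beta> x))) \<in> borel_measurable lebesgue"
        by (rule borel_measurable_scaleR[OF m\<psi> borel_measurable_integrable[OF iDE]])
      ultimately show "(\<lambda>x. \<psi> x *\<^sub>R (D \<alpha> x * E \<beta> x)) \<in> borel_measurable lebesgue" by (simp only:)
    next
      fix k
      \<comment> \<open>Off \<open>K\<close> the mollifications of \<open>D \<alpha>\<close> and
        \<open>E \<beta>\<close> need not be measurable, but \<open>\<psi>\<close> vanishes there;
        on \<open>K\<close> they equal mollifications of integrable functions, which are
        continuous.\<close>
      have eq: "\<psi> x *\<^sub>R (mollify (D \<alpha>) \<phi> (\<sigma> k) x * mollify (E \<beta>) \<phi> (\<sigma> k) x)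
          = \<psi> x *\<^sub>R (mollify F \<phi> (\<sigma> k) x * mollify H \<phi> (\<sigma> k) x)" for x
        using \<psi>(2)[of x] F(2)[of x \<phi> "\<sigma> k"] H(2)[of x \<phi> "\<sigma> k"] \<phi> \<sigma>(1)[of k] by (cases "x \<in> K") auto
      have cont: "continuous_on UNIV (\<lambda>x. \<psi> x *\<^sub>R (mollify F \<phi> (\<sigma> k) x * mollify H \<phi> (\<sigma> k) x))"
        using \<sigma>(1)[of k] by (intro continuous_intros c\<psi> mollify_continuous F H \<phi>) auto
      have "(\<lambda>x. \<psi> x *\<^sub>R (mollify F \<phi> (\<sigma> k) x * mollify H \<phi> (\<sigma> k) x)) \<in> borel_measurable lebesgue"
        by (rule measurable_completion) (simp add: borel_measurable_continuous_onI[OF cont])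
      then show "(\<lambda>x. \<psi> x *\<^sub>R (mollify (D \<alpha>) \<phi> (\<sigma> k) x * mollify (E \<beta>) \<phi> (\<sigma> k) x)) \<in> borel_measurable lebesgue"
        by (simp only: eq)
      show "AE x in lebesgue. norm (\<psi> x *\<^sub>R (mollify (D \<alpha>) \<phi> (\<sigma> k) x * mollify (E \<beta>) \<phi> (\<sigma> k) x))
          \<le> B * (indicator K x *\<^sub>R G x)"
        using dom
      proof eventually_elim
        case (elim x)
        show ?case
        proof (cases "x \<in> K")
          case True
          have "norm (mollify (D \<alpha>) \<phi> (\<sigma> k) x) * norm (mollify (E \<beta>) \<phi> (\<sigma> k) x) \<le> G x"
            using elim True K(2) K(3)[OF True] \<sigma>(1)[of k] by auto
          then have "\<bar>\<psi> x\<bar> * (norm (mollify (D \<alpha>) \<phi> (\<sigma> k) x) * norm (mollify (E \<beta>) \<phi> (\<sigma> k) x)) \<le> B * G x"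
            using B by (intro mult_mono) auto
          then show ?thesis using True by (simp add: norm_mult)
        qed (simp add: \<psi>(2))
      qed
    next
      have "\<sigma> k \<in> {0<..} \<and> \<sigma> k \<noteq> 0" for k using \<sigma>(1)[of k] by auto
      then have fl: "filterlim \<sigma> (at_right 0) sequentially"
        unfolding filterlim_at using \<sigma>(2) by (simp add: always_eventually)
      show "AE x in lebesgue. (\<lambda>k. \<psi> x *\<^sub>R (mollify (D \<alpha>) \<phi> (\<sigma> k) x * mollify (E \<beta>) \<phi> (\<sigma> k) x))
          \<longlonglongrightarrow> \<psi> x *\<^sub>R (D \<alpha> x * E \<beta> x)"
        using lim
      proof eventually_elim
        case (elim x)
        show ?case
        proof (cases "x \<in> K")
          case True
          then have "((\<lambda>s. mollify (D \<alpha>) \<phi> s x * mollify (E \<beta>) \<phi> s x) \<longlongrightarrow> D \<alpha> x * E \<beta> x) (at_right 0)"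
            using elim K(2) by auto
          from filterlim_compose[OF this fl] show ?thesis by (intro tendsto_scaleR tendsto_const)
        qed (simp add: \<psi>(2))
      qed
    qed
  qed
qed

text \<open>Brings the iterated powers in \<open>mpartial\<close> into the shape on which
  \<open>leibniz\<close> recurses.\<close>

definition mi_word :: "('n::{finite,linorder} \<Rightarrow> nat) \<Rightarrow> 'n list" where
  "mi_word \<alpha> = concat (map (\<lambda>i. replicate (\<alpha> i) i) (sorted_list_of_set UNIV))"

lemma mpartial_mi_word: "mpartial \<alpha> f = foldr partial (mi_word \<alpha>) f"
proof -
  have "foldr (\<lambda>i. partial i ^^ \<alpha> i) xs f = foldr partial (concat (map (\<lambda>i. replicate (\<alpha> i) i) xs)) f" for xs
    by (induction xs) (auto simp: foldr_replicate)
  then show ?thesis by (simp add: mpartial_def mi_word_def)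
qed

lemma length_mi_word: "length (mi_word \<alpha>) = mi_order \<alpha>"
  by (simp add: mi_word_def mi_order_def length_concat o_def sum_list_distinct_conv_sum_set)

lemma sum_list_scaleR_integral:
  fixes h :: "'c \<Rightarrow> 'a \<Rightarrow> 'b::euclidean_space"
  assumes "\<And>c. c \<in> set cs \<Longrightarrow> integrable M (\<lambda>x. \<psi> x *\<^sub>R h c x)"
  shows "integrable M (\<lambda>x. \<psi> x *\<^sub>R (\<Sum>c\<leftarrow>cs. h c x))"
    "(\<integral>x. \<psi> x *\<^sub>R (\<Sum>c\<leftarrow>cs. h c x) \<partial>M) = (\<Sum>c\<leftarrow>cs. \<integral>x. \<psi> x *\<^sub>R h c x \<partial>M)"
  using assms by (induction cs) (auto simp: scaleR_add_right)

lemma integrable_test_function_scaleR: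
  fixes f :: "real^'n::finite \<Rightarrow> 'b::euclidean_space"
  assumes "locally_integrable \<Omega> f" "\<psi> \<in> test_functions \<Omega>"
  shows "integrable lebesgue (\<lambda>x. \<psi> x *\<^sub>R f x)"
proof -
  let ?K = "closure {x. \<psi> x \<noteq> 0}"
  have \<psi>: "smooth \<psi>" "compact ?K" "?K \<subseteq> \<Omega>" using assms(2) by (auto simp: test_functions_def)
  have z: "\<psi> x = 0" if "x \<notin> ?K" for x using that closure_subset[of "{x. \<psi> x \<noteq> 0}"] by auto
  have c: "continuous_on UNIV \<psi>" by (rule smooth_continuous[OF \<psi>(1)])
  obtain B where B: "\<And>x. \<bar>\<psi> x\<bar> \<le> B"
    using integrable_lebesgue_compact_support(4)[OF c \<psi>(2) z] by auto
  have "integrable lebesgue (\<lambda>x. \<psi> x *\<^sub>R (indicator ?K x *\<^sub>R f x))"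
  proof (rule integrable_bounded_scaleR[OF _ _ B])
    show "integrable lebesgue (\<lambda>x. indicator ?K x *\<^sub>R f x)"
      using assms(1) \<psi> by (auto simp: locally_integrable_def set_integrable_def)
    show "\<psi> \<in> borel_measurable lebesgue"
      by (rule measurable_completion) (simp add: borel_measurable_continuous_onI[OF c])
  qed
  moreover have "\<psi> x *\<^sub>R (indicator ?K x *\<^sub>R f x) = \<psi> x *\<^sub>R f x" for x using z[of x] by (cases "x \<in> ?K") auto
  ultimately show ?thesis by (simp only:)
qed

lemma locally_integrable_sum_list:
  assumes "\<And>c. c \<in> set cs \<Longrightarrow> locally_integrable \<Omega> (h c)"
  shows "locally_integrable \<Omega> (\<lambda>x. \<Sum>c\<leftarrow>cs. h c x)"
  using assms
proof (induction cs)
  case Nil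
  then show ?case by (simp add: locally_integrable_def set_integrable_def)
next
  case (Cons c cs)
  then show ?case by (auto simp: locally_integrable_def intro!: set_integral_add(1))
qed

text \<open>For mollified factors the Leibniz rule is an exact identity of integrals. Both sides
  converge along a sequence of scales, the left one dominated by \<open>G0\<close> and the right one
  term by term by the envelopes \<open>G\<close>.\<close>

lemma has_weak_derivative_product:
  fixes D E :: "('n::{finite,linorder} \<Rightarrow> nat) \<Rightarrow> real^'n::{finite,linorder} \<Rightarrow> 'b::{real_normed_field, euclidean_space}"
  assumes \<Omega>: "open \<Omega>" and D: "weak_family \<Omega> m D" and E: "weak_family \<Omega> m E" and \<alpha>: "mi_order \<alpha> \<le> m"
    and \<phi>: "\<phi> \<in> bumps" "(LINT x|lborel. \<phi> x) = 1"
    and r: "\<And>x. x \<in> \<Omega> \<Longrightarrow> r x > 0 \<and> cball x (r x) \<subseteq> \<Omega>" "continuous_on \<Omega> r"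
    and G0: "product_dominated \<Omega> D E \<phi> r (\<lambda>_. 0) (\<lambda>_. 0) G0"
    and G: "\<And>\<gamma> \<epsilon>. mi_order \<gamma> + mi_order \<epsilon> = mi_order \<alpha> \<Longrightarrow> product_dominated \<Omega> D E \<phi> r \<gamma> \<epsilon> (G \<gamma> \<epsilon>)"
  shows "has_weak_derivative \<Omega> \<alpha> (\<lambda>x. D (\<lambda>_. 0) x * E (\<lambda>_. 0) x)
    (\<lambda>x. \<Sum>(\<gamma>, \<epsilon>)\<leftarrow>leibniz (mi_word \<alpha>) (\<lambda>_. 0) (\<lambda>_. 0). D \<gamma> x * E \<epsilon> x)"
proof -
  let ?w = "mi_word \<alpha>" and ?z = "\<lambda>_::'n. 0 :: nat"
  let ?L = "leibniz ?w ?z ?z"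
  have z: "mi_order ?z = 0" by (simp add: mi_order_0_iff)
  have ord: "mi_order \<gamma> + mi_order \<epsilon> = mi_order \<alpha>" if "(\<gamma>, \<epsilon>) \<in> set ?L" for \<gamma> \<epsilon>
    using leibniz_order[OF that] z by (simp add: length_mi_word)
  have li0: "locally_integrable \<Omega> (\<lambda>x. D ?z x * E ?z x)"
    by (rule locally_integrable_product[OF \<Omega> D E _ _ \<phi> _ G0]) (use r z in auto)
  have li: "locally_integrable \<Omega> (\<lambda>x. D \<gamma> x * E \<epsilon> x)" if "(\<gamma>, \<epsilon>) \<in> set ?L" for \<gamma> \<epsilon>
    by (rule locally_integrable_product[OF \<Omega> D E _ _ \<phi> _ G[OF ord[OF that]]]) (use r ord[OF that] \<alpha> in auto)
  have liW: "locally_integrable \<Omega> (\<lambda>x. \<Sum>(\<gamma>, \<epsilon>)\<leftarrow>?L. D \<gamma> x * E \<epsilon> x)"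
    by (rule locally_integrable_sum_list) (use li in auto)
  have main: "(LINT x:\<Omega>|lebesgue. mpartial \<alpha> \<psi> x *\<^sub>R (D ?z x * E ?z x)) =
        (-1) ^ mi_order \<alpha> *\<^sub>R (LINT x:\<Omega>|lebesgue. \<psi> x *\<^sub>R (\<Sum>(\<gamma>, \<epsilon>)\<leftarrow>?L. D \<gamma> x * E \<epsilon> x))"
    if \<psi>: "\<psi> \<in> test_functions \<Omega>" for \<psi>
  proof -
    let ?K = "closure {x. \<psi> x \<noteq> 0}"
    have \<psi>': "smooth \<psi>" "compact ?K" "?K \<subseteq> \<Omega>" using \<psi> by (auto simp: test_functions_def)
    have zo: "\<psi> x = 0" if "x \<notin> ?K" for x using that closure_subset[of "{x. \<psi> x \<noteq> 0}"] by auto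
    \<comment> \<open>The scales have to be admissible at all points of the support at once;
      continuity of \<open>r\<close> on a compact set provides a common bound.\<close>
    have "\<exists>\<delta>>0. \<forall>x\<in>?K. \<delta> \<le> r x"
    proof (cases "?K = {}")
      case False
      obtain x where x: "x \<in> ?K" "\<And>y. y \<in> ?K \<Longrightarrow> r x \<le> r y"
        using continuous_attains_inf[OF \<psi>'(2) False continuous_on_subset[OF r(2) \<psi>'(3)]] by blast
      then show ?thesis using r(1) \<psi>'(3) by (intro exI[of _ "r x"]) auto
    qed (auto intro: exI[of _ 1])
    then obtain \<delta> where \<delta>: "\<delta> > 0" "\<And>x. x \<in> ?K \<Longrightarrow> \<delta> \<le> r x" by blast
    have \<delta>': "cball x \<delta> \<subseteq> \<Omega>" if "x \<in> ?K" for x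
      using subset_cball[OF \<delta>(2)[OF that], of x] r(1)[of x] \<psi>'(3) that by blast
    define \<sigma> where "\<sigma> k = \<delta> / real (Suc k)" for k
    have \<sigma>: "0 < \<sigma> k \<and> \<sigma> k \<le> \<delta>" for k using \<delta>(1) by (simp add: \<sigma>_def field_simps)
    have \<sigma>0: "\<sigma> \<longlonglongrightarrow> 0" unfolding \<sigma>_def by (rule LIMSEQ_Suc[OF lim_const_over_n])
    let ?I = "\<lambda>w \<gamma> \<epsilon> k. LINT x|lebesgue. foldr partial w \<psi> x *\<^sub>R (mollify (D \<gamma>) \<phi> (\<sigma> k) x * mollify (E \<epsilon>) \<phi> (\<sigma> k) x)"
    have T: "?I v \<gamma> \<epsilon> \<longlonglongrightarrow> (LINT x|lebesgue. foldr partial v \<psi> x *\<^sub>R (D \<gamma> x * E \<epsilon> x))"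
      if "product_dominated \<Omega> D E \<phi> r \<gamma> \<epsilon> H" "mi_order \<gamma> \<le> m" "mi_order \<epsilon> \<le> m" for v \<gamma> \<epsilon> H
      by (rule mollify_product_tendsto[OF \<Omega> D E that(2,3) \<phi> _ that(1) \<psi>'(2,3) _ smooth_foldr_partial[OF \<psi>'(1)]
            foldr_partial_zero_outside[OF \<psi>'(2) zo] \<sigma> \<sigma>0]) (use r \<delta> \<delta>' in auto)
    have "?I ?w ?z ?z \<longlonglongrightarrow> (LINT x|lebesgue. mpartial \<alpha> \<psi> x *\<^sub>R (D ?z x * E ?z x))"
      unfolding mpartial_mi_word by (rule T[OF G0]) (simp_all add: z)
    moreover have "?I ?w ?z ?z = (\<lambda>k. (-1) ^ length ?w *\<^sub>R (\<Sum>(\<gamma>, \<epsilon>)\<leftarrow>?L. ?I [] \<gamma> \<epsilon> k))"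
    proof
      fix k
      show "?I ?w ?z ?z k = (-1) ^ length ?w *\<^sub>R (\<Sum>(\<gamma>, \<epsilon>)\<leftarrow>?L. ?I [] \<gamma> \<epsilon> k)"
        using mollify_leibniz[OF D E \<psi>'(2) \<delta>' \<psi>'(1) zo _ _ \<phi>(1), of "\<sigma> k" ?z ?w ?z] \<sigma>[of k] \<alpha>
        by (simp add: z length_mi_word)
    qed
    moreover have "(\<lambda>k. (-1) ^ length ?w *\<^sub>R (\<Sum>(\<gamma>, \<epsilon>)\<leftarrow>?L. ?I [] \<gamma> \<epsilon> k))
        \<longlonglongrightarrow> (-1) ^ length ?w *\<^sub>R (\<Sum>(\<gamma>, \<epsilon>)\<leftarrow>?L. LINT x|lebesgue. \<psi> x *\<^sub>R (D \<gamma> x * E \<epsilon> x))"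
    proof (intro tendsto_scaleR tendsto_const)
      have "(\<lambda>k. \<Sum>(\<gamma>, \<epsilon>)\<leftarrow>M. ?I [] \<gamma> \<epsilon> k) \<longlonglongrightarrow> (\<Sum>(\<gamma>, \<epsilon>)\<leftarrow>M. LINT x|lebesgue. \<psi> x *\<^sub>R (D \<gamma> x * E \<epsilon> x))"
        if "set M \<subseteq> set ?L" for M
        using that
      proof (induction M)
        case (Cons c M)
        obtain \<gamma> \<epsilon> where c: "c = (\<gamma>, \<epsilon>)" by fastforce
        have "?I [] \<gamma> \<epsilon> \<longlonglongrightarrow> (LINT x|lebesgue. foldr partial [] \<psi> x *\<^sub>R (D \<gamma> x * E \<epsilon> x))"
          using Cons.prems c ord[of \<gamma> \<epsilon>] \<alpha> by (intro T[OF G]) auto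
        then show ?case using Cons unfolding c by (auto intro!: tendsto_add)
      qed simp
      then show "(\<lambda>k. \<Sum>(\<gamma>, \<epsilon>)\<leftarrow>?L. ?I [] \<gamma> \<epsilon> k)
        \<longlonglongrightarrow> (\<Sum>(\<gamma>, \<epsilon>)\<leftarrow>?L. LINT x|lebesgue. \<psi> x *\<^sub>R (D \<gamma> x * E \<epsilon> x))" by blast
    qed
    ultimately have "(LINT x|lebesgue. mpartial \<alpha> \<psi> x *\<^sub>R (D ?z x * E ?z x))
        = (-1) ^ length ?w *\<^sub>R (\<Sum>(\<gamma>, \<epsilon>)\<leftarrow>?L. LINT x|lebesgue. \<psi> x *\<^sub>R (D \<gamma> x * E \<epsilon> x))"
      using LIMSEQ_unique by simp
    also have "(\<Sum>(\<gamma>, \<epsilon>)\<leftarrow>?L. LINT x|lebesgue. \<psi> x *\<^sub>R (D \<gamma> x * E \<epsilon> x))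
        = (LINT x|lebesgue. \<psi> x *\<^sub>R (\<Sum>(\<gamma>, \<epsilon>)\<leftarrow>?L. D \<gamma> x * E \<epsilon> x))"
      using sum_list_scaleR_integral(2)[of ?L lebesgue \<psi> "\<lambda>c x. case c of (\<gamma>, \<epsilon>) \<Rightarrow> D \<gamma> x * E \<epsilon> x"]
        integrable_test_function_scaleR[OF li \<psi>] by (auto simp: case_prod_beta')
    finally show ?thesis
    proof -
      assume *: "(LINT x|lebesgue. mpartial \<alpha> \<psi> x *\<^sub>R (D ?z x * E ?z x))
        = (-1) ^ length ?w *\<^sub>R (LINT x|lebesgue. \<psi> x *\<^sub>R (\<Sum>(\<gamma>, \<epsilon>)\<leftarrow>?L. D \<gamma> x * E \<epsilon> x))"
      have "foldr partial v \<psi> \<in> test_functions \<Omega>" for v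
        by (induction v) (auto simp: \<psi> partial_test_function)
      then have "mpartial \<alpha> \<psi> \<in> test_functions \<Omega>" by (simp add: mpartial_mi_word)
      from set_integral_test_function[OF this, of "\<lambda>x. D ?z x * E ?z x"]
        set_integral_test_function[OF \<psi>, of "\<lambda>x. \<Sum>(\<gamma>, \<epsilon>)\<leftarrow>?L. D \<gamma> x * E \<epsilon> x"] *
      show ?thesis by (simp only: length_mi_word)
    qed
  qed
  show ?thesis unfolding has_weak_derivative_def using li0 liW main by blast
qed

subsection \<open>The pointwise product estimate\<close>

lemma power_mult_power_le_sum:
  fixes x y :: real
  assumes "0 \<le> x" "0 \<le> y"
  shows "x ^ j * y ^ k \<le> x ^ (j + k) + y ^ (j + k)"
proof (cases "x \<le> y")
  case True
  then have "x ^ j * y ^ k \<le> y ^ j * y ^ k" using assms by (intro mult_right_mono power_mono) auto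
  then show ?thesis using assms by (simp add: power_add add_increasing)
next
  case False
  then have "x ^ j * y ^ k \<le> x ^ j * x ^ k" using assms by (intro mult_left_mono power_mono) auto
  then show ?thesis using assms by (simp add: power_add add_increasing2)
qed

text \<open>\<open>S\<close> bounds the averages of every order after weighting by powers of
  \<open>R\<close>, so in \<open>norm_mollify_optimised\<close> it acts both as \<open>A\<close> and
  as \<open>R ^ n * B\<close>. The powers of the two balancing parameters then add up to order
  \<open>n\<close>, where they can be replaced by \<open>2 * S / U\<close> and
  \<open>2 * T / V\<close>.\<close>

lemma norm_mollify_product:
  fixes \<phi> :: "real^'n::finite \<Rightarrow> real"
  assumes \<phi>: "\<phi> \<in> bumps" "euler \<phi> \<in> moment K" and n: "n \<le> K" "mi_order \<gamma> + mi_order \<epsilon> = n"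
  shows "\<exists>C\<ge>0. \<forall>\<Omega> m (D :: ('n \<Rightarrow> nat) \<Rightarrow> real^'n \<Rightarrow> 'b::euclidean_space)
      (E :: ('n \<Rightarrow> nat) \<Rightarrow> real^'n \<Rightarrow> 'b) s R x U V S T.
    weak_family \<Omega> m D \<longrightarrow> weak_family \<Omega> m E \<longrightarrow> n \<le> m \<longrightarrow> 0 < s \<longrightarrow> s \<le> R \<longrightarrow> cball x R \<subseteq> \<Omega> \<longrightarrow>
    0 < U \<longrightarrow> 0 < V \<longrightarrow> 0 \<le> S \<longrightarrow> 0 \<le> T \<longrightarrow>
    (\<forall>\<tau>. 0 < \<tau> \<and> \<tau> \<le> R \<longrightarrow> (LINT y:ball x \<tau>|lebesgue. norm (D (\<lambda>_. 0) y)) \<le> U * \<tau> ^ CARD('n)) \<longrightarrow>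
    (\<forall>\<tau>. 0 < \<tau> \<and> \<tau> \<le> R \<longrightarrow> (LINT y:ball x \<tau>|lebesgue. norm (E (\<lambda>_. 0) y)) \<le> V * \<tau> ^ CARD('n)) \<longrightarrow>
    (\<forall>\<alpha> \<tau>. mi_order \<alpha> \<le> n \<and> 0 < \<tau> \<and> \<tau> \<le> R \<longrightarrow>
      (LINT y:ball x \<tau>|lebesgue. norm (D \<alpha> y)) \<le> S / R ^ mi_order \<alpha> * \<tau> ^ CARD('n)) \<longrightarrow>
    (\<forall>\<alpha> \<tau>. mi_order \<alpha> \<le> n \<and> 0 < \<tau> \<and> \<tau> \<le> R \<longrightarrow>
      (LINT y:ball x \<tau>|lebesgue. norm (E \<alpha> y)) \<le> T / R ^ mi_order \<alpha> * \<tau> ^ CARD('n)) \<longrightarrow>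
    R ^ n * (norm (mollify (D \<gamma>) \<phi> s x) * norm (mollify (E \<epsilon>) \<phi> s x)) \<le> C * (V * S + U * T)"
proof (cases "n = 0")
  case True
  \<comment> \<open>At order 0 no balancing parameter can be solved for. Averages of the
    undifferentiated functions suffice, and \<open>V * S\<close> alone is a bound.\<close>
  then have 0: "\<gamma> = (\<lambda>_. 0)" "\<epsilon> = (\<lambda>_. 0)" using n by (auto simp: mi_order_0_iff)
  have z: "mi_order (\<lambda>_::'n. 0) = 0" by (simp add: mi_order_0_iff)
  from norm_mollify_derivative[OF \<phi>(1) z, where 'b = 'b] obtain C where C: "C \<ge> 0"
    "\<And>\<Omega> m (D :: ('n \<Rightarrow> nat) \<Rightarrow> real^'n \<Rightarrow> 'b) s x P.
    weak_family \<Omega> m D \<Longrightarrow> s > 0 \<Longrightarrow> cball x s \<subseteq> \<Omega> \<Longrightarrow>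
    (LINT y:ball x s|lebesgue. norm (D (\<lambda>_. 0) y)) \<le> P * s ^ CARD('n) \<Longrightarrow>
    norm (mollify (D (\<lambda>_. 0)) \<phi> s x) \<le> C * P" by force
  show ?thesis
  proof (intro exI[of _ "C * C"] conjI allI impI)
    show "C * C \<ge> 0" by simp
    fix \<Omega> m and D E :: "('n \<Rightarrow> nat) \<Rightarrow> real^'n \<Rightarrow> 'b" and s R :: real and x and U V S T :: real
    assume *: "weak_family \<Omega> m D" "weak_family \<Omega> m E" "n \<le> m" "0 < s" "s \<le> R" "cball x R \<subseteq> \<Omega>"
      "0 < U" "0 < V" "0 \<le> S" "0 \<le> T"
    assume V: "\<forall>\<tau>. 0 < \<tau> \<and> \<tau> \<le> R \<longrightarrow> (LINT y:ball x \<tau>|lebesgue. norm (E (\<lambda>_. 0) y)) \<le> V * \<tau> ^ CARD('n)"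
    assume S: "\<forall>\<alpha> \<tau>. mi_order \<alpha> \<le> n \<and> 0 < \<tau> \<and> \<tau> \<le> R \<longrightarrow>
      (LINT y:ball x \<tau>|lebesgue. norm (D \<alpha> y)) \<le> S / R ^ mi_order \<alpha> * \<tau> ^ CARD('n)"
    have sub: "cball x s \<subseteq> \<Omega>" using subset_cball[OF *(5)] *(6) by blast
    have "norm (mollify (D (\<lambda>_. 0)) \<phi> s x) \<le> C * S"
      using S[rule_format, of "\<lambda>_. 0" s] * z by (intro C(2)[OF *(1) *(4) sub]) auto
    moreover have "norm (mollify (E (\<lambda>_. 0)) \<phi> s x) \<le> C * V"
      using V * by (intro C(2)[OF *(2) *(4) sub]) auto
    ultimately have "norm (mollify (D (\<lambda>_. 0)) \<phi> s x) * norm (mollify (E (\<lambda>_. 0)) \<phi> s x) \<le> (C * S) * (C * V)"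
      using C(1) * by (intro mult_mono) auto
    also have "\<dots> \<le> C * C * (V * S + U * T)"
      using C(1) * by (simp add: algebra_simps)
    finally show "R ^ n * (norm (mollify (D \<gamma>) \<phi> s x) * norm (mollify (E \<epsilon>) \<phi> s x)) \<le> C * C * (V * S + U * T)"
      using True by (simp add: 0)
  qed
next
  case False
  then have n0: "n > 0" by simp
  have ord: "mi_order \<gamma> \<le> n" "mi_order \<epsilon> \<le> n" using n by auto
  from norm_mollify_optimised[OF \<phi> n(1) ord(1), where 'b = 'b] obtain C1 where C1: "C1 \<ge> 0"
    "\<And>\<Omega> m (D :: ('n \<Rightarrow> nat) \<Rightarrow> real^'n \<Rightarrow> 'b) s R x U A B \<kappa>.
    weak_family \<Omega> m D \<Longrightarrow> n \<le> m \<Longrightarrow> 0 < s \<Longrightarrow> s \<le> R \<Longrightarrow> cball x R \<subseteq> \<Omega> \<Longrightarrow> 0 \<le> U \<Longrightarrow> 0 \<le> A \<Longrightarrow> 0 \<le> B \<Longrightarrow>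
    (\<forall>\<tau>. 0 < \<tau> \<and> \<tau> \<le> R \<longrightarrow> (LINT y:ball x \<tau>|lebesgue. norm (D (\<lambda>_. 0) y)) \<le> U * \<tau> ^ CARD('n)) \<Longrightarrow>
    (\<forall>\<tau>. 0 < \<tau> \<and> \<tau> \<le> R \<longrightarrow> (LINT y:ball x \<tau>|lebesgue. norm (D (\<lambda>_. 0) y)) \<le> A * \<tau> ^ CARD('n)) \<Longrightarrow>
    (\<forall>\<beta> \<tau>. mi_order \<beta> = n \<and> 0 < \<tau> \<and> \<tau> \<le> R \<longrightarrow>
      (LINT y:ball x \<tau>|lebesgue. norm (D \<beta> y)) \<le> B * \<tau> ^ CARD('n)) \<Longrightarrow>
    0 \<le> \<kappa> \<Longrightarrow> U * \<kappa> ^ n = A + R ^ n * B \<Longrightarrow>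
    R ^ mi_order \<gamma> * norm (mollify (D \<gamma>) \<phi> s x) \<le> C1 * U * \<kappa> ^ mi_order \<gamma>" by blast
  from norm_mollify_optimised[OF \<phi> n(1) ord(2), where 'b = 'b] obtain C2 where C2: "C2 \<ge> 0"
    "\<And>\<Omega> m (D :: ('n \<Rightarrow> nat) \<Rightarrow> real^'n \<Rightarrow> 'b) s R x U A B \<kappa>.
    weak_family \<Omega> m D \<Longrightarrow> n \<le> m \<Longrightarrow> 0 < s \<Longrightarrow> s \<le> R \<Longrightarrow> cball x R \<subseteq> \<Omega> \<Longrightarrow> 0 \<le> U \<Longrightarrow> 0 \<le> A \<Longrightarrow> 0 \<le> B \<Longrightarrow>
    (\<forall>\<tau>. 0 < \<tau> \<and> \<tau> \<le> R \<longrightarrow> (LINT y:ball x \<tau>|lebesgue. norm (D (\<lambda>_. 0) y)) \<le> U * \<tau> ^ CARD('n)) \<Longrightarrow>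
    (\<forall>\<tau>. 0 < \<tau> \<and> \<tau> \<le> R \<longrightarrow> (LINT y:ball x \<tau>|lebesgue. norm (D (\<lambda>_. 0) y)) \<le> A * \<tau> ^ CARD('n)) \<Longrightarrow>
    (\<forall>\<beta> \<tau>. mi_order \<beta> = n \<and> 0 < \<tau> \<and> \<tau> \<le> R \<longrightarrow>
      (LINT y:ball x \<tau>|lebesgue. norm (D \<beta> y)) \<le> B * \<tau> ^ CARD('n)) \<Longrightarrow>
    0 \<le> \<kappa> \<Longrightarrow> U * \<kappa> ^ n = A + R ^ n * B \<Longrightarrow>
    R ^ mi_order \<epsilon> * norm (mollify (D \<epsilon>) \<phi> s x) \<le> C2 * U * \<kappa> ^ mi_order \<epsilon>" by blast
  have z: "mi_order (\<lambda>_::'n. 0) = 0" by (simp add: mi_order_0_iff)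
  show ?thesis
  proof (intro exI[of _ "2 * C1 * C2"] conjI allI impI)
    show "2 * C1 * C2 \<ge> 0" using C1 C2 by simp
    fix \<Omega> m and D E :: "('n \<Rightarrow> nat) \<Rightarrow> real^'n \<Rightarrow> 'b" and s R :: real and x and U V S T :: real
    assume *: "weak_family \<Omega> m D" "weak_family \<Omega> m E" "n \<le> m" "0 < s" "s \<le> R" "cball x R \<subseteq> \<Omega>"
      "0 < U" "0 < V" "0 \<le> S" "0 \<le> T"
    assume U: "\<forall>\<tau>. 0 < \<tau> \<and> \<tau> \<le> R \<longrightarrow> (LINT y:ball x \<tau>|lebesgue. norm (D (\<lambda>_. 0) y)) \<le> U * \<tau> ^ CARD('n)"
    assume V: "\<forall>\<tau>. 0 < \<tau> \<and> \<tau> \<le> R \<longrightarrow> (LINT y:ball x \<tau>|lebesgue. norm (E (\<lambda>_. 0) y)) \<le> V * \<tau> ^ CARD('n)"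
    assume S: "\<forall>\<alpha> \<tau>. mi_order \<alpha> \<le> n \<and> 0 < \<tau> \<and> \<tau> \<le> R \<longrightarrow>
      (LINT y:ball x \<tau>|lebesgue. norm (D \<alpha> y)) \<le> S / R ^ mi_order \<alpha> * \<tau> ^ CARD('n)"
    assume T: "\<forall>\<alpha> \<tau>. mi_order \<alpha> \<le> n \<and> 0 < \<tau> \<and> \<tau> \<le> R \<longrightarrow>
      (LINT y:ball x \<tau>|lebesgue. norm (E \<alpha> y)) \<le> T / R ^ mi_order \<alpha> * \<tau> ^ CARD('n)"
    have R: "R > 0" using * by linarith
    \<comment> \<open>Solves \<open>U * \<kappa> ^ n = 2 * S\<close>; this uses \<open>n > 0\<close>
      and \<open>U > 0\<close>. The parameter depends on \<open>n\<close> but not on how the order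
      is split between the factors.\<close>
    define \<kappa> where "\<kappa> = root n (2 * S / U)"
    define l where "l = root n (2 * T / V)"
    have \<kappa>: "0 \<le> \<kappa>" "U * \<kappa> ^ n = S + R ^ n * (S / R ^ n)" "U * \<kappa> ^ n = 2 * S"
      using * n0 R by (auto simp: \<kappa>_def)
    have l: "0 \<le> l" "V * l ^ n = T + R ^ n * (T / R ^ n)" "V * l ^ n = 2 * T"
      using * n0 R by (auto simp: l_def)
    have S0: "\<forall>\<tau>. 0 < \<tau> \<and> \<tau> \<le> R \<longrightarrow> (LINT y:ball x \<tau>|lebesgue. norm (D (\<lambda>_. 0) y)) \<le> S * \<tau> ^ CARD('n)"
      using S[rule_format, of "\<lambda>_. 0"] by (simp add: z)
    have Sn: "\<forall>\<beta> \<tau>. mi_order \<beta> = n \<and> 0 < \<tau> \<and> \<tau> \<le> R \<longrightarrow>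
      (LINT y:ball x \<tau>|lebesgue. norm (D \<beta> y)) \<le> S / R ^ n * \<tau> ^ CARD('n)"
    proof (intro allI impI)
      fix \<beta> :: "'n \<Rightarrow> nat" and \<tau> :: real assume "mi_order \<beta> = n \<and> 0 < \<tau> \<and> \<tau> \<le> R"
      then show "(LINT y:ball x \<tau>|lebesgue. norm (D \<beta> y)) \<le> S / R ^ n * \<tau> ^ CARD('n)"
        using S[rule_format, of \<beta> \<tau>] by simp
    qed
    have T0: "\<forall>\<tau>. 0 < \<tau> \<and> \<tau> \<le> R \<longrightarrow> (LINT y:ball x \<tau>|lebesgue. norm (E (\<lambda>_. 0) y)) \<le> T * \<tau> ^ CARD('n)"
      using T[rule_format, of "\<lambda>_. 0"] by (simp add: z)
    have Tn: "\<forall>\<beta> \<tau>. mi_order \<beta> = n \<and> 0 < \<tau> \<and> \<tau> \<le> R \<longrightarrow>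
      (LINT y:ball x \<tau>|lebesgue. norm (E \<beta> y)) \<le> T / R ^ n * \<tau> ^ CARD('n)"
    proof (intro allI impI)
      fix \<beta> :: "'n \<Rightarrow> nat" and \<tau> :: real assume "mi_order \<beta> = n \<and> 0 < \<tau> \<and> \<tau> \<le> R"
      then show "(LINT y:ball x \<tau>|lebesgue. norm (E \<beta> y)) \<le> T / R ^ n * \<tau> ^ CARD('n)"
        using T[rule_format, of \<beta> \<tau>] by simp
    qed
    have 1: "R ^ mi_order \<gamma> * norm (mollify (D \<gamma>) \<phi> s x) \<le> C1 * U * \<kappa> ^ mi_order \<gamma>"
      by (rule C1(2)[OF *(1,3-6) _ *(9) _ U S0 Sn \<kappa>(1,2)]) (use * R in auto)
    have 2: "R ^ mi_order \<epsilon> * norm (mollify (E \<epsilon>) \<phi> s x) \<le> C2 * V * l ^ mi_order \<epsilon>"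
      by (rule C2(2)[OF *(2,3-6) _ *(10) _ V T0 Tn l(1,2)]) (use * R in auto)
    have "R ^ n * (norm (mollify (D \<gamma>) \<phi> s x) * norm (mollify (E \<epsilon>) \<phi> s x))
      = (R ^ mi_order \<gamma> * norm (mollify (D \<gamma>) \<phi> s x)) * (R ^ mi_order \<epsilon> * norm (mollify (E \<epsilon>) \<phi> s x))"
      unfolding n(2)[symmetric] power_add by (simp add: mult_ac)
    also have "\<dots> \<le> (C1 * U * \<kappa> ^ mi_order \<gamma>) * (C2 * V * l ^ mi_order \<epsilon>)"
      using R \<kappa>(1) C1(1) * by (intro mult_mono 1 2) auto
    also have "\<dots> = C1 * C2 * (U * V) * (\<kappa> ^ mi_order \<gamma> * l ^ mi_order \<epsilon>)" by (simp add: mult_ac)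
    also have "\<dots> \<le> C1 * C2 * (U * V) * (\<kappa> ^ n + l ^ n)"
      unfolding n(2)[symmetric] using C1(1) C2(1) * \<kappa>(1) l(1)
      by (intro mult_left_mono power_mult_power_le_sum) auto
    also have "\<dots> = C1 * C2 * (V * (U * \<kappa> ^ n) + U * (V * l ^ n))" by (simp add: algebra_simps)
    also have "\<dots> = 2 * C1 * C2 * (V * S + U * T)" unfolding \<kappa>(3) l(3) by (simp add: algebra_simps)
    finally show "R ^ n * (norm (mollify (D \<gamma>) \<phi> s x) * norm (mollify (E \<epsilon>) \<phi> s x)) \<le> 2 * C1 * C2 * (V * S + U * T)" .
  qed
qed

section \<open>The maximal theorem for Lebesgue measurable functions\<close>

lemma maximal_lebesgue:
  fixes p :: real
  assumes p: "p > 1"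
  shows "\<exists>C\<ge>0. \<forall>f::'a::euclidean_space \<Rightarrow> real. f \<in> borel_measurable lebesgue \<longrightarrow> (\<forall>x. 0 \<le> f x) \<longrightarrow>
    integrable lebesgue (\<lambda>x. f x powr p) \<longrightarrow>
    (\<exists>g. g \<in> borel_measurable lebesgue \<and> (\<forall>x. 0 \<le> g x) \<and> integrable lebesgue (\<lambda>x. g x powr p) \<and>
      (LINT x|lebesgue. g x powr p) \<le> C * (LINT x|lebesgue. f x powr p) \<and>
      (AE x in lebesgue. \<forall>r. 0 < r \<longrightarrow> r \<le> 1 \<longrightarrow>
        set_integrable lebesgue (ball x r) f \<and> (LINT y:ball x r|lebesgue. f y) \<le> g x * r ^ DIM('a)))"
proof -
  obtain C where C: "C \<ge> 0" "\<And>f::'a \<Rightarrow> real. f \<in> borel_measurable borel \<Longrightarrow> (\<And>x. 0 \<le> f x) \<Longrightarrow>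
    integrable lborel (\<lambda>x. f x powr p) \<Longrightarrow>
    (\<exists>g. g \<in> borel_measurable borel \<and> (\<forall>x. 0 \<le> g x) \<and> integrable lborel (\<lambda>x. g x powr p) \<and>
      (\<integral>x. g x powr p \<partial>lborel) \<le> C * (\<integral>x. f x powr p \<partial>lborel) \<and>
      (AE x in lborel. \<forall>r. 0 < r \<longrightarrow> r \<le> 1 \<longrightarrow>
        (\<integral>\<^sup>+y\<in>ball x r. f y \<partial>lborel) \<le> ennreal (g x * r ^ DIM('a))))"
    using maximal_strong_type[OF p, where 'a = 'a] by blast
  show ?thesis
  proof (intro exI[of _ C] conjI allI impI C(1))
    fix f :: "'a \<Rightarrow> real"
    assume f: "f \<in> borel_measurable lebesgue" and nn: "\<forall>x. 0 \<le> f x" and int: "integrable lebesgue (\<lambda>x. f x powr p)"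
    obtain f' where f': "f' \<in> borel_measurable lborel" "AE x in lborel. f x = f' x"
      using completion_ex_borel_measurable_real[OF f] by blast
    \<comment> \<open>A Borel representative may be negative on a null set, while the maximal
      theorem asks for a function that is nonnegative everywhere.\<close>
    define h where "h x = max 0 (f' x)" for x
    have [measurable]: "f' \<in> borel_measurable borel" using f'(1) by simp
    have h[measurable]: "h \<in> borel_measurable borel" unfolding h_def by measurable
    have h0: "\<And>x. 0 \<le> h x" by (simp add: h_def)
    have fh: "AE x in lebesgue. f x = h x"
      using AE_completion[OF f'(2)]
    proof eventually_elim
      case (elim x)
      then show ?case using nn[rule_format, of x] by (simp add: h_def)
    qed
    have hp: "(\<lambda>x. h x powr p) \<in> borel_measurable lborel" by measurable
    have ih: "integrable lebesgue (\<lambda>x. h x powr p)"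
      by (rule integrable_cong_AE_imp[OF int measurable_completion[OF hp]]) (use fh in \<open>eventually_elim, simp\<close>)
    have Ih: "(\<integral>x. h x powr p \<partial>lborel) = (LINT x|lebesgue. f x powr p)"
      unfolding integral_completion[OF hp, symmetric]
      by (rule integral_cong_AE) (use fh ih int in \<open>auto elim: AE_mp\<close>)
    obtain g where g: "g \<in> borel_measurable borel" "\<forall>x. 0 \<le> g x" "integrable lborel (\<lambda>x. g x powr p)"
      "(\<integral>x. g x powr p \<partial>lborel) \<le> C * (\<integral>x. h x powr p \<partial>lborel)"
      "AE x in lborel. \<forall>r. 0 < r \<longrightarrow> r \<le> 1 \<longrightarrow> (\<integral>\<^sup>+y\<in>ball x r. h y \<partial>lborel) \<le> ennreal (g x * r ^ DIM('a))"
      using C(2)[OF h h0] ih integrable_completion[OF hp] by auto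
    note [measurable] = g(1)
    have gp: "(\<lambda>x. g x powr p) \<in> borel_measurable lborel" by measurable
    have "AE x in lebesgue. \<forall>r. 0 < r \<longrightarrow> r \<le> 1 \<longrightarrow>
        set_integrable lebesgue (ball x r) f \<and> (LINT y:ball x r|lebesgue. f y) \<le> g x * r ^ DIM('a)"
      using AE_completion[OF g(5)]
    proof eventually_elim
      case (elim x)
      show ?case
      proof (intro allI impI)
        fix r :: real assume r: "0 < r" "r \<le> 1"
        have m: "(\<lambda>y. indicator (ball x r) y *\<^sub>R f y) \<in> borel_measurable lebesgue"
          using f by (intro borel_measurable_scaleR borel_measurable_indicator) auto
        have "(\<integral>\<^sup>+y. ennreal (indicator (ball x r) y *\<^sub>R f y) \<partial>lebesgue) = (\<integral>\<^sup>+y. ennreal (h y) * indicator (ball x r) y \<partial>lebesgue)"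
          by (rule nn_integral_cong_AE) (use fh in \<open>eventually_elim, auto simp: indicator_def\<close>)
        also have "\<dots> \<le> ennreal (g x * r ^ DIM('a))"
          unfolding nn_integral_completion using elim r by blast
        finally have le: "(\<integral>\<^sup>+y. ennreal (indicator (ball x r) y *\<^sub>R f y) \<partial>lebesgue) \<le> ennreal (g x * r ^ DIM('a))" .
        have i: "integrable lebesgue (\<lambda>y. indicator (ball x r) y *\<^sub>R f y)"
          by (rule integrableI_nonneg[OF m]) (use nn le in \<open>auto intro: le_less_trans\<close>)
        have "ennreal (LINT y|lebesgue. indicator (ball x r) y *\<^sub>R f y) \<le> ennreal (g x * r ^ DIM('a))"
          using le nn_integral_eq_integral[OF i] nn by simp
        then have "(LINT y|lebesgue. indicator (ball x r) y *\<^sub>R f y) \<le> g x * r ^ DIM('a)"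
          using g(2) r by (subst (asm) ennreal_le_iff) auto
        with i show "set_integrable lebesgue (ball x r) f \<and> (LINT y:ball x r|lebesgue. f y) \<le> g x * r ^ DIM('a)"
          by (simp add: set_integrable_def set_lebesgue_integral_def)
      qed
    qed
    moreover have "integrable lebesgue (\<lambda>x. g x powr p)" using g(3) integrable_completion[OF gp] by simp
    moreover have "(LINT x|lebesgue. g x powr p) \<le> C * (LINT x|lebesgue. f x powr p)"
      using g(4) by (simp add: Ih integral_completion[OF gp])
    moreover have "g \<in> borel_measurable lebesgue"
      by (rule measurable_completion) (simp add: g(1))
    ultimately show "\<exists>g. g \<in> borel_measurable lebesgue \<and> (\<forall>x. 0 \<le> g x) \<and> integrable lebesgue (\<lambda>x. g x powr p) \<and>
      (LINT x|lebesgue. g x powr p) \<le> C * (LINT x|lebesgue. f x powr p) \<and>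
      (AE x in lebesgue. \<forall>r. 0 < r \<longrightarrow> r \<le> 1 \<longrightarrow>
        set_integrable lebesgue (ball x r) f \<and> (LINT y:ball x r|lebesgue. f y) \<le> g x * r ^ DIM('a))"
      using g(2) by blast
  qed
qed

subsection \<open>The weight\<close>

lemma rho_nonneg: "0 \<le> rho l x" and rho_le_1: "rho l x \<le> 1"
  by (auto simp: rho_def intro!: sum_nonneg)

lemma rho_eq_0_iff:
  fixes x :: "real^'n::{finite,linorder}"
  shows "rho l x = 0 \<longleftrightarrow> x \<in> Rstar l"
proof -
  have "(\<Sum>i\<in>leading_coords l. \<bar>x $ i\<bar>\<^sup>2) = 0 \<longleftrightarrow> x \<in> Rstar l"
    by (subst sum_nonneg_eq_0_iff) (auto simp: Rstar_def)
  then show ?thesis by (auto simp: rho_def min_def)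
qed

text \<open>The root is the norm of the coordinate projection \<open>P\<close>, a linear map that
  does not increase norms; so \<open>rho\<close> is the distance to \<open>Rstar l\<close> truncated
  at 1.\<close>

lemma rho_lipschitz:
  fixes x y :: "real^'n::{finite,linorder}"
  shows "\<bar>rho l x - rho l y\<bar> \<le> dist x y"
proof -
  define P :: "(real, 'n) vec \<Rightarrow> (real, 'n) vec" where "P x = (\<chi> i. if i \<in> leading_coords l then x $ i else 0)" for x
  have s: "sqrt (\<Sum>i\<in>leading_coords l. \<bar>x $ i\<bar>\<^sup>2) = norm (P x)" for x
  proof -
    have "(\<Sum>i\<in>UNIV. (norm (P x $ i))\<^sup>2) = (\<Sum>i\<in>UNIV. if i \<in> leading_coords l then \<bar>x $ i\<bar>\<^sup>2 else 0)"
      by (intro sum.cong) (auto simp: P_def)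
    also have "\<dots> = (\<Sum>i\<in>leading_coords l. \<bar>x $ i\<bar>\<^sup>2)"
      by (simp add: sum.If_cases)
    finally show ?thesis by (simp add: norm_vec_def L2_set_def)
  qed
  have "P x - P y = P (x - y)" by (simp add: P_def vec_eq_iff)
  moreover have "norm (P z) \<le> norm z" for z
    unfolding norm_vec_def by (rule L2_set_mono) (auto simp: P_def)
  ultimately have "\<bar>norm (P x) - norm (P y)\<bar> \<le> dist x y"
    using norm_triangle_ineq3[of "P x" "P y"] by (simp add: dist_norm) (metis order_trans)
  then show ?thesis unfolding rho_def s by (auto simp: min_def abs_if split: if_splits)
qed

lemma continuous_rho: "continuous_on S (rho l)"
  unfolding continuous_on_iff
proof (intro ballI allI impI)
  fix x :: "(real, 'a) vec" and e :: real assume "0 < e"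
  then show "\<exists>d>0. \<forall>x'\<in>S. dist x' x < d \<longrightarrow> dist (rho l x') (rho l x) < e"
    using rho_lipschitz[of l _ x] by (intro exI[of _ e]) (auto simp: dist_real_def intro: le_less_trans)
qed

lemma open_Compl_Rstar: "open (- Rstar l :: (real^'n::{finite,linorder}) set)"
proof -
  have "(- Rstar l :: (real, 'n) vec set) = rho l -` (- {0})" by (auto simp: rho_eq_0_iff)
  moreover have "open (rho l -` (- {0}) :: (real, 'n) vec set)"
    by (intro open_vimage continuous_rho open_Compl closed_singleton)
  ultimately show ?thesis by simp
qed

lemma rho_pos: "x \<in> - Rstar l \<Longrightarrow> rho l x > 0"
  using rho_nonneg[of l x] rho_eq_0_iff[of l x] by force

lemma rho_half:
  fixes x y :: "real^'n::{finite,linorder}"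
  assumes "dist x y \<le> rho l x / 2"
  shows "rho l x / 2 \<le> rho l y" "rho l y \<le> 2 * rho l x"
  using rho_lipschitz[of l x y] assms rho_nonneg[of l x] by (auto simp: abs_le_iff)

lemma rho_cball_subset:
  assumes "x \<in> - Rstar l" shows "cball x (rho l x / 2) \<subseteq> - Rstar l"
proof
  fix y assume "y \<in> cball x (rho l x / 2)"
  then have "rho l y > 0" using rho_half(1)[of x y l] rho_pos[OF assms] by simp
  then show "y \<in> - Rstar l" using rho_eq_0_iff[of l y] by auto
qed

text \<open>The sign of the exponent decides which of the two comparisons of \<open>s\<close> and
  \<open>t\<close> is used.\<close>

lemma powr_comparable:
  fixes s t b :: real
  assumes "0 < s" "s / 2 \<le> t" "t \<le> 2 * s"
  shows "s powr b \<le> 2 powr \<bar>b\<bar> * t powr b"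
proof (cases "b \<ge> 0")
  case True
  have "s powr b \<le> (2 * t) powr b" using assms True by (intro powr_mono2) auto
  then show ?thesis using assms True by (simp add: powr_mult)
next
  case False
  have "s powr b \<le> (t / 2) powr b" using assms False by (intro powr_mono2') auto
  also have "\<dots> = 2 powr (- b) * t powr b" using assms by (simp add: powr_divide powr_minus divide_simps)
  finally show ?thesis using False by simp
qed

subsection \<open>Kondratiev spaces\<close>

lemma finite_mi_order: "finite {\<alpha> :: 'n::finite \<Rightarrow> nat. mi_order \<alpha> \<le> m}"
proof (rule finite_subset)
  show "finite {\<alpha> :: 'n \<Rightarrow> nat. \<forall>i. (i \<in> UNIV \<longrightarrow> \<alpha> i \<in> {..m}) \<and> (i \<notin> UNIV \<longrightarrow> \<alpha> i = 0)}"
    by (rule finite_set_of_finite_funs) auto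
  have "\<alpha> i \<le> mi_order \<alpha>" for \<alpha> :: "'n \<Rightarrow> nat" and i
    unfolding mi_order_def by (rule member_le_sum) auto
  then show "{\<alpha> :: 'n \<Rightarrow> nat. mi_order \<alpha> \<le> m}
      \<subseteq> {\<alpha>. \<forall>i. (i \<in> UNIV \<longrightarrow> \<alpha> i \<in> {..m}) \<and> (i \<notin> UNIV \<longrightarrow> \<alpha> i = 0)}"
    by (auto intro: order_trans)
qed

lemma length_leibniz: "length (leibniz w \<alpha> \<beta>) = 2 ^ length w"
  by (induction w arbitrary: \<alpha> \<beta>) auto

lemma locally_integrable_measurable:
  fixes f :: "real^'n::finite \<Rightarrow> 'b::euclidean_space"
  assumes \<Omega>: "open \<Omega>" and f: "locally_integrable \<Omega> f"
  shows "(\<lambda>x. indicator \<Omega> x *\<^sub>R f x) \<in> borel_measurable lebesgue"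
proof -
  obtain D :: "(real^'n) set set" where D: "countable D" "D \<subseteq> Pow \<Omega>" "\<And>X. X \<in> D \<Longrightarrow> \<exists>a b. X = cbox a b" "\<Union>D = \<Omega>"
    using open_countable_Union_open_cbox[OF \<Omega>] by metis
  \<comment> \<open>Finite unions of the covering boxes: compact sets increasing to
    \<open>\<Omega>\<close>, on each of which \<open>f\<close> is integrable.\<close>
  define Y where "Y n = (\<Union>X\<in>D \<inter> {X. to_nat_on D X \<le> n}. X)" for n
  have fin: "finite (D \<inter> {X. to_nat_on D X \<le> n})" for n
  proof (rule finite_imageD)
    show "finite (to_nat_on D ` (D \<inter> {X. to_nat_on D X \<le> n}))" by (rule finite_subset[of _ "{..n}"]) auto
    show "inj_on (to_nat_on D) (D \<inter> {X. to_nat_on D X \<le> n})"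
      by (rule inj_on_subset[OF inj_on_to_nat_on[OF D(1)]]) auto
  qed
  have "compact (Y n)" "Y n \<subseteq> \<Omega>" for n
  proof -
    have "compact X" if "X \<in> D" for X using D(3)[OF that] compact_cbox by auto
    then show "compact (Y n)" unfolding Y_def using fin by (intro compact_UN) auto
    show "Y n \<subseteq> \<Omega>" unfolding Y_def using D(2) by auto
  qed
  then have m: "(\<lambda>x. indicator (Y n) x *\<^sub>R f x) \<in> borel_measurable lebesgue" for n
    using f by (intro borel_measurable_integrable) (auto simp: locally_integrable_def set_integrable_def)
  show ?thesis
  proof (rule borel_measurable_LIMSEQ_metric[OF m])
    fix x
    show "(\<lambda>n. indicator (Y n) x *\<^sub>R f x) \<longlonglongrightarrow> indicator \<Omega> x *\<^sub>R f x"
    proof (cases "x \<in> \<Omega>")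
      case True
      then obtain X where X: "X \<in> D" "x \<in> X" using D(4) by blast
      have "\<forall>\<^sub>F n in sequentially. indicator (Y n) x *\<^sub>R f x = indicator \<Omega> x *\<^sub>R f x"
        unfolding eventually_sequentially
        by (rule exI[of _ "to_nat_on D X"]) (use X True in \<open>auto simp: Y_def indicator_def\<close>)
      then show ?thesis by (rule tendsto_eventually)
    next
      case False
      then have "x \<notin> Y n" for n using D(4) unfolding Y_def by blast
      then show ?thesis using False by simp
    qed
  qed
qed

text \<open>Transfers what is known of an explicit weak derivative to the representative chosen in
  \<open>weak_derivative\<close>.\<close>

lemma weak_derivative_unique:
  fixes u w w' :: "real^'n::{finite,linorder} \<Rightarrow> 'b::euclidean_space"
  assumes \<Omega>: "open \<Omega>" and w: "has_weak_derivative \<Omega> \<alpha> u w" and w': "has_weak_derivative \<Omega> \<alpha> u w'"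
  shows "AE x in lebesgue. x \<in> \<Omega> \<longrightarrow> w x = w' x"
proof -
  have li: "locally_integrable \<Omega> w" "locally_integrable \<Omega> w'" using w w' by (auto simp: has_weak_derivative_def)
  have "AE x in lebesgue. x \<in> \<Omega> \<longrightarrow> w x - w' x = 0"
  proof (rule du_Bois_Reymond[OF \<Omega>])
    show "locally_integrable \<Omega> (\<lambda>x. w x - w' x)"
      using li by (auto simp: locally_integrable_def intro: set_integral_diff)
    fix \<psi> :: "(real, 'n) vec \<Rightarrow> real" assume \<psi>: "\<psi> \<in> test_functions \<Omega>"
    have "(LINT x:\<Omega>|lebesgue. mpartial \<alpha> \<psi> x *\<^sub>R u x) = (-1) ^ mi_order \<alpha> *\<^sub>R (LINT x:\<Omega>|lebesgue. \<psi> x *\<^sub>R w x)"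
      using w \<psi> unfolding has_weak_derivative_def by blast
    moreover have "(LINT x:\<Omega>|lebesgue. mpartial \<alpha> \<psi> x *\<^sub>R u x) = (-1) ^ mi_order \<alpha> *\<^sub>R (LINT x:\<Omega>|lebesgue. \<psi> x *\<^sub>R w' x)"
      using w' \<psi> unfolding has_weak_derivative_def by blast
    ultimately have "(-1) ^ mi_order \<alpha> *\<^sub>R (LINT x:\<Omega>|lebesgue. \<psi> x *\<^sub>R w x) = (-1) ^ mi_order \<alpha> *\<^sub>R (LINT x:\<Omega>|lebesgue. \<psi> x *\<^sub>R w' x)"
      by (simp only:)
    then have "(LINT x:\<Omega>|lebesgue. \<psi> x *\<^sub>R w x) = (LINT x:\<Omega>|lebesgue. \<psi> x *\<^sub>R w' x)"
      by (rule scaleR_left_imp_eq[rotated]) simp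
    then have eq: "(LINT x|lebesgue. \<psi> x *\<^sub>R w x) = (LINT x|lebesgue. \<psi> x *\<^sub>R w' x)"
      by (simp add: set_integral_test_function[OF \<psi>])
    have "(LINT x|lebesgue. \<psi> x *\<^sub>R (w x - w' x)) = 0"
      using integrable_test_function_scaleR[OF li(1) \<psi>] integrable_test_function_scaleR[OF li(2) \<psi>] eq
      by (simp add: scaleR_diff_right)
    then show "(LINT x:\<Omega>|lebesgue. \<psi> x *\<^sub>R (w x - w' x)) = 0"
      by (simp add: set_integral_test_function[OF \<psi>])
  qed
  then show ?thesis by eventually_elim simp
qed

lemma has_weak_derivative_0:
  "locally_integrable \<Omega> u \<Longrightarrow> has_weak_derivative \<Omega> (\<lambda>_. 0) u u"
  by (simp add: has_weak_derivative_def mpartial_zero mi_order_def)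

text \<open>Every summand is replaced by the largest one. The crude constant is valid for all
  positive \<open>p\<close>.\<close>

lemma sum_powr_le:
  fixes x :: "'i \<Rightarrow> real"
  assumes A: "finite A" and x: "\<And>i. i \<in> A \<Longrightarrow> 0 \<le> x i" and p: "p > 0"
  shows "(\<Sum>i\<in>A. x i) powr p \<le> real (card A) powr p * (\<Sum>i\<in>A. x i powr p)"
proof (cases "A = {}")
  case False
  define M where "M = Max (x ` A)"
  have "M \<in> x ` A" unfolding M_def using A False by (intro Max_in) auto
  then obtain j where j: "j \<in> A" "x j = M" by auto
  have le: "x i \<le> M" if "i \<in> A" for i unfolding M_def using A that by auto
  have "(\<Sum>i\<in>A. x i) powr p \<le> (real (card A) * M) powr p"
    using sum_bounded_above[of A x M] le x p by (intro powr_mono2 sum_nonneg) auto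
  also have "\<dots> = real (card A) powr p * x j powr p"
    using x j by (simp add: powr_mult)
  also have "\<dots> \<le> real (card A) powr p * (\<Sum>i\<in>A. x i powr p)"
    using j A by (intro mult_left_mono member_le_sum) auto
  finally show ?thesis .
qed simp

section \<open>Maximal-function envelopes in Kondratiev spaces\<close>

text \<open>The maximal theorem is applied to the weighted derivatives, whose norms are those in the
  definition of the space. On a ball of radius at most \<open>rho l x / 2\<close> the weight is
  comparable to its value at the centre and can be taken out of the average. Summing over all orders
  makes one \<open>S\<close> serve every derivative.\<close>

lemma kondratiev_envelope:
  fixes p a :: real and m l :: nat
  assumes p: "1 < p"
  shows "\<exists>C\<ge>0. \<forall>u :: real^'n::{finite,linorder} \<Rightarrow> 'b::euclidean_space. u \<in> kondratiev_space m a p l \<longrightarrow>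
    (\<exists>D S. weak_family (- Rstar l) m D \<and> D (\<lambda>_. 0) = u \<and> S \<in> borel_measurable lebesgue \<and> (\<forall>x. 0 \<le> S x) \<and>
      integrable lebesgue (\<lambda>x. S x powr p) \<and> (LINT x|lebesgue. S x powr p) \<le> C * kondratiev_norm m a p l u powr p \<and>
      (AE x in lebesgue. x \<in> - Rstar l \<longrightarrow> (\<forall>\<alpha> \<tau>. mi_order \<alpha> \<le> m \<and> 0 < \<tau> \<and> \<tau> \<le> rho l x / 2 \<longrightarrow>
        (LINT y:ball x \<tau>|lebesgue. norm (D \<alpha> y))
          \<le> (rho l x powr a * S x) / (rho l x / 2) ^ mi_order \<alpha> * \<tau> ^ CARD('n))))"
proof -
  let ?\<Omega> = "- Rstar l :: (real, 'n) vec set"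
  let ?A = "{\<alpha> :: 'n \<Rightarrow> nat. mi_order \<alpha> \<le> m}"
  note fA = finite_mi_order[where 'n = 'n and m = m]
  have \<Omega>: "open ?\<Omega>" by (rule open_Compl_Rstar)
  obtain CM where CM: "CM \<ge> 0" "\<And>f::(real, 'n) vec \<Rightarrow> real. f \<in> borel_measurable lebesgue \<Longrightarrow> (\<And>x. 0 \<le> f x) \<Longrightarrow>
    integrable lebesgue (\<lambda>x. f x powr p) \<Longrightarrow>
    (\<exists>g. g \<in> borel_measurable lebesgue \<and> (\<forall>x. 0 \<le> g x) \<and> integrable lebesgue (\<lambda>x. g x powr p) \<and>
      (LINT x|lebesgue. g x powr p) \<le> CM * (LINT x|lebesgue. f x powr p) \<and>
      (AE x in lebesgue. \<forall>r. 0 < r \<longrightarrow> r \<le> 1 \<longrightarrow>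
        set_integrable lebesgue (ball x r) f \<and> (LINT y:ball x r|lebesgue. f y) \<le> g x * r ^ DIM((real, 'n) vec)))"
    using maximal_lebesgue[OF p, where 'a = "(real, 'n) vec"] by blast
  \<comment> \<open>Dominates the comparison constants \<open>2 powr \<bar>k - a\<bar>\<close> of
    the weights for all orders \<open>k \<le> m\<close>.\<close>
  define C0 where "C0 = 2 powr (real m + \<bar>a\<bar>)"
  have C0: "C0 > 0" by (simp add: C0_def)
  define C where "C = C0 powr p * (real (card ?A) powr p * CM)"
  have "C \<ge> 0" using CM(1) by (simp add: C_def)
  moreover have "\<exists>D S. weak_family ?\<Omega> m D \<and> D (\<lambda>_. 0) = u \<and> S \<in> borel_measurable lebesgue \<and> (\<forall>x. 0 \<le> S x) \<and>
      integrable lebesgue (\<lambda>x. S x powr p) \<and> (LINT x|lebesgue. S x powr p) \<le> C * kondratiev_norm m a p l u powr p \<and>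
      (AE x in lebesgue. x \<in> ?\<Omega> \<longrightarrow> (\<forall>\<alpha> \<tau>. mi_order \<alpha> \<le> m \<and> 0 < \<tau> \<and> \<tau> \<le> rho l x / 2 \<longrightarrow>
        (LINT y:ball x \<tau>|lebesgue. norm (D \<alpha> y))
          \<le> (rho l x powr a * S x) / (rho l x / 2) ^ mi_order \<alpha> * \<tau> ^ CARD('n)))"
    if u: "u \<in> kondratiev_space m a p l" for u :: "(real, 'n) vec \<Rightarrow> 'b"
  proof -
    let ?w = "\<lambda>\<alpha>. weak_derivative ?\<Omega> \<alpha> u"
    have w: "has_weak_derivative ?\<Omega> \<alpha> u (?w \<alpha>)" if "mi_order \<alpha> \<le> m" for \<alpha>
    proof -
      have "\<exists>w. has_weak_derivative ?\<Omega> \<alpha> u w" using u that unfolding kondratiev_space_def by blast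
      then show ?thesis unfolding weak_derivative_def by (rule someI_ex)
    qed
    have ki: "set_integrable lebesgue ?\<Omega> (kondratiev_integrand a p l \<alpha> u)" if "mi_order \<alpha> \<le> m" for \<alpha>
      using u that unfolding kondratiev_space_def by blast
    \<comment> \<open>At order 0 the function itself replaces the chosen representative, so that sup
      bounds on \<open>u\<close> apply to \<open>D (\<lambda>_. 0)\<close> directly.\<close>
    define D where "D \<alpha> = (if \<alpha> = (\<lambda>_. 0) then u else ?w \<alpha>)" for \<alpha>
    have D: "has_weak_derivative ?\<Omega> \<alpha> u (D \<alpha>)" if "mi_order \<alpha> \<le> m" for \<alpha>
      using w[OF that] has_weak_derivative_0[of ?\<Omega> u] by (auto simp: D_def has_weak_derivative_def)
    have wf: "weak_family ?\<Omega> m D" by (rule weak_familyI[OF D])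
    have Dw: "AE x in lebesgue. x \<in> ?\<Omega> \<longrightarrow> D \<alpha> x = ?w \<alpha> x" if "mi_order \<alpha> \<le> m" for \<alpha>
      by (rule weak_derivative_unique[OF \<Omega> D[OF that] w[OF that]])
    \<comment> \<open>The weighted derivative extended by 0 across \<open>Rstar l\<close>, as the
      maximal theorem concerns functions on the whole space.\<close>
    define f where "f \<alpha> x = (indicator ?\<Omega> x * kondratiev_integrand a p l \<alpha> u x) powr (1 / p)" for \<alpha> x
    have fp: "f \<alpha> x powr p = indicator ?\<Omega> x *\<^sub>R kondratiev_integrand a p l \<alpha> u x" for \<alpha> x
      using p by (simp add: f_def powr_powr kondratiev_integrand_def indicator_def)
    have f0: "0 \<le> f \<alpha> x" for \<alpha> x by (simp add: f_def)
    have f_eq: "f \<alpha> x = rho l x powr (real (mi_order \<alpha>) - a) * norm (?w \<alpha> x)" if "x \<in> ?\<Omega>" for \<alpha> x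
      using p that by (simp add: f_def powr_powr kondratiev_integrand_def)
    have fm: "f \<alpha> \<in> borel_measurable lebesgue" if "mi_order \<alpha> \<le> m" for \<alpha>
    proof -
      have "(\<lambda>x. indicator ?\<Omega> x *\<^sub>R kondratiev_integrand a p l \<alpha> u x) \<in> borel_measurable lebesgue"
        using ki[OF that] unfolding set_integrable_def by (rule borel_measurable_integrable)
      then have "(\<lambda>x. (indicator ?\<Omega> x *\<^sub>R kondratiev_integrand a p l \<alpha> u x) powr (1 / p)) \<in> borel_measurable lebesgue"
        by (rule powr_real_measurable[OF _ borel_measurable_const])
      then show ?thesis by (simp add: f_def[abs_def])
    qed
    have fi: "integrable lebesgue (\<lambda>x. f \<alpha> x powr p)" if "mi_order \<alpha> \<le> m" for \<alpha>
      using ki[OF that] by (simp add: fp set_integrable_def)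
    have "\<exists>g. g \<in> borel_measurable lebesgue \<and> (\<forall>x. 0 \<le> g x) \<and> integrable lebesgue (\<lambda>x. g x powr p) \<and>
      (LINT x|lebesgue. g x powr p) \<le> CM * (LINT x|lebesgue. f \<alpha> x powr p) \<and>
      (AE x in lebesgue. \<forall>r. 0 < r \<longrightarrow> r \<le> 1 \<longrightarrow>
        set_integrable lebesgue (ball x r) (f \<alpha>) \<and> (LINT y:ball x r|lebesgue. f \<alpha> y) \<le> g x * r ^ CARD('n))"
      if "mi_order \<alpha> \<le> m" for \<alpha>
      using CM(2)[OF fm[OF that] f0 fi[OF that]] by simp
    then have "\<forall>\<alpha>\<in>?A. \<exists>g. g \<in> borel_measurable lebesgue \<and> (\<forall>x. 0 \<le> g x) \<and> integrable lebesgue (\<lambda>x. g x powr p) \<and>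
      (LINT x|lebesgue. g x powr p) \<le> CM * (LINT x|lebesgue. f \<alpha> x powr p) \<and>
      (AE x in lebesgue. \<forall>r. 0 < r \<longrightarrow> r \<le> 1 \<longrightarrow>
        set_integrable lebesgue (ball x r) (f \<alpha>) \<and> (LINT y:ball x r|lebesgue. f \<alpha> y) \<le> g x * r ^ CARD('n))"
      by blast
    from bchoice[OF this] obtain g where "\<forall>\<alpha>\<in>?A. g \<alpha> \<in> borel_measurable lebesgue \<and> (\<forall>x. 0 \<le> g \<alpha> x) \<and> integrable lebesgue (\<lambda>x. g \<alpha> x powr p) \<and>
      (LINT x|lebesgue. g \<alpha> x powr p) \<le> CM * (LINT x|lebesgue. f \<alpha> x powr p) \<and>
      (AE x in lebesgue. \<forall>r. 0 < r \<longrightarrow> r \<le> 1 \<longrightarrow>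
        set_integrable lebesgue (ball x r) (f \<alpha>) \<and> (LINT y:ball x r|lebesgue. f \<alpha> y) \<le> g \<alpha> x * r ^ CARD('n))"
      by blast
    then have g: "\<And>\<alpha>. mi_order \<alpha> \<le> m \<Longrightarrow> g \<alpha> \<in> borel_measurable lebesgue"
      "\<And>\<alpha> x. mi_order \<alpha> \<le> m \<Longrightarrow> 0 \<le> g \<alpha> x"
      "\<And>\<alpha>. mi_order \<alpha> \<le> m \<Longrightarrow> integrable lebesgue (\<lambda>x. g \<alpha> x powr p)"
      "\<And>\<alpha>. mi_order \<alpha> \<le> m \<Longrightarrow> (LINT x|lebesgue. g \<alpha> x powr p) \<le> CM * (LINT x|lebesgue. f \<alpha> x powr p)"
      "\<And>\<alpha>. mi_order \<alpha> \<le> m \<Longrightarrow> AE x in lebesgue. \<forall>r. 0 < r \<longrightarrow> r \<le> 1 \<longrightarrow>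
        set_integrable lebesgue (ball x r) (f \<alpha>) \<and> (LINT y:ball x r|lebesgue. f \<alpha> y) \<le> g \<alpha> x * r ^ CARD('n)"
      by simp_all
    define S where "S x = C0 * (\<Sum>\<alpha>\<in>?A. g \<alpha> x)" for x
    have Sm: "S \<in> borel_measurable lebesgue"
      unfolding S_def using g(1) by (intro borel_measurable_times borel_measurable_const borel_measurable_sum) auto
    have S0: "0 \<le> S x" for x unfolding S_def using C0 g(2) by (intro mult_nonneg_nonneg sum_nonneg) auto
    have gi: "integrable lebesgue (\<lambda>x. C0 powr p * (real (card ?A) powr p * (\<Sum>\<alpha>\<in>?A. g \<alpha> x powr p)))"
      using g(3) by (intro integrable_mult_right Bochner_Integration.integrable_sum) auto
    have Sle: "S x powr p \<le> C0 powr p * (real (card ?A) powr p * (\<Sum>\<alpha>\<in>?A. g \<alpha> x powr p))" for x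
    proof -
      have "S x powr p = C0 powr p * (\<Sum>\<alpha>\<in>?A. g \<alpha> x) powr p"
        unfolding S_def using C0 g(2) by (intro powr_mult)
      also have "\<dots> \<le> C0 powr p * (real (card ?A) powr p * (\<Sum>\<alpha>\<in>?A. g \<alpha> x powr p))"
        using p g(2) by (intro mult_left_mono sum_powr_le fA) auto
      finally show ?thesis .
    qed
    have Si: "integrable lebesgue (\<lambda>x. S x powr p)"
    proof (rule Bochner_Integration.integrable_bound[OF gi])
      show "(\<lambda>x. S x powr p) \<in> borel_measurable lebesgue" by (rule powr_real_measurable[OF Sm borel_measurable_const])
      show "AE x in lebesgue. norm (S x powr p) \<le> norm (C0 powr p * (real (card ?A) powr p * (\<Sum>\<alpha>\<in>?A. g \<alpha> x powr p)))"
        using Sle by (intro AE_I2) (auto intro: order_trans[OF _ abs_ge_self])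
    qed
    have "(LINT x|lebesgue. S x powr p) \<le> (LINT x|lebesgue. C0 powr p * (real (card ?A) powr p * (\<Sum>\<alpha>\<in>?A. g \<alpha> x powr p)))"
      by (rule integral_mono[OF Si gi Sle])
    also have "\<dots> = C0 powr p * (real (card ?A) powr p * (\<Sum>\<alpha>\<in>?A. LINT x|lebesgue. g \<alpha> x powr p))"
      using g(3) by (simp add: Bochner_Integration.integral_sum)
    also have "\<dots> \<le> C0 powr p * (real (card ?A) powr p * (\<Sum>\<alpha>\<in>?A. CM * (LINT x|lebesgue. f \<alpha> x powr p)))"
      using g(4) by (intro mult_left_mono sum_mono) auto
    also have "\<dots> = C * (\<Sum>\<alpha>\<in>?A. LINT x:?\<Omega>|lebesgue. kondratiev_integrand a p l \<alpha> u x)"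
      by (simp add: C_def fp set_lebesgue_integral_def sum_distrib_left mult_ac)
    also have "(\<Sum>\<alpha>\<in>?A. LINT x:?\<Omega>|lebesgue. kondratiev_integrand a p l \<alpha> u x) = kondratiev_norm m a p l u powr p"
    proof -
      have "0 \<le> (\<Sum>\<alpha>\<in>?A. LINT x:?\<Omega>|lebesgue. kondratiev_integrand a p l \<alpha> u x)"
        unfolding set_lebesgue_integral_def
        by (intro sum_nonneg Bochner_Integration.integral_nonneg) (auto simp: kondratiev_integrand_def)
      then show ?thesis using p by (simp add: kondratiev_norm_def powr_powr)
    qed
    finally have Sint: "(LINT x|lebesgue. S x powr p) \<le> C * kondratiev_norm m a p l u powr p" .
    have "AE x in lebesgue. \<forall>\<alpha>\<in>?A. \<forall>r. 0 < r \<longrightarrow> r \<le> 1 \<longrightarrow>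
        set_integrable lebesgue (ball x r) (f \<alpha>) \<and> (LINT y:ball x r|lebesgue. f \<alpha> y) \<le> g \<alpha> x * r ^ CARD('n)"
      using g(5) by (intro AE_finite_allI[OF fA]) auto
    then have "AE x in lebesgue. x \<in> ?\<Omega> \<longrightarrow> (\<forall>\<alpha> \<tau>. mi_order \<alpha> \<le> m \<and> 0 < \<tau> \<and> \<tau> \<le> rho l x / 2 \<longrightarrow>
        (LINT y:ball x \<tau>|lebesgue. norm (D \<alpha> y))
          \<le> (rho l x powr a * S x) / (rho l x / 2) ^ mi_order \<alpha> * \<tau> ^ CARD('n))"
    proof eventually_elim
      case (elim x)
      show ?case
      proof (intro impI allI)
        fix \<alpha> :: "'n \<Rightarrow> nat" and \<tau> :: real assume x: "x \<in> ?\<Omega>" and *: "mi_order \<alpha> \<le> m \<and> 0 < \<tau> \<and> \<tau> \<le> rho l x / 2"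
        let ?k = "mi_order \<alpha>"
        have \<rho>: "rho l x > 0" by (rule rho_pos[OF x])
        have "\<tau> \<le> 1" using * rho_le_1[of l x] by linarith
        with elim * have fx: "set_integrable lebesgue (ball x \<tau>) (f \<alpha>)" "(LINT y:ball x \<tau>|lebesgue. f \<alpha> y) \<le> g \<alpha> x * \<tau> ^ CARD('n)"
          by auto
        have sub: "cball x (rho l x / 2) \<subseteq> ?\<Omega>" by (rule rho_cball_subset[OF x])
        let ?c = "C0 * rho l x powr (a - real ?k)"
        have c0: "?c \<ge> 0" using C0 by simp
        have "(LINT y:ball x \<tau>|lebesgue. norm (D \<alpha> y)) \<le> (LINT y:ball x \<tau>|lebesgue. ?c * f \<alpha> y)"
        proof (rule set_integral_mono_AE)
          show "set_integrable lebesgue (ball x \<tau>) (\<lambda>y. norm (D \<alpha> y))"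
            using * by (intro set_integrable_norm weak_family_integrable_ball(1)[OF wf _ sub]) auto
          show "set_integrable lebesgue (ball x \<tau>) (\<lambda>y. ?c * f \<alpha> y)"
            by (rule set_integrable_mult_right) (rule fx)
          show "AE y\<in>ball x \<tau> in lebesgue. norm (D \<alpha> y) \<le> ?c * f \<alpha> y"
            using Dw[OF conjunct1[OF *]]
          proof eventually_elim
            case (elim y)
            show ?case
            proof
              assume y: "y \<in> ball x \<tau>"
              then have d: "dist x y \<le> rho l x / 2" using * by simp
              then have y\<Omega>: "y \<in> ?\<Omega>" using sub by auto
              have "rho l x powr (real ?k - a) \<le> 2 powr \<bar>real ?k - a\<bar> * rho l y powr (real ?k - a)"
                by (rule powr_comparable[OF \<rho> rho_half[OF d]])
              also have "\<dots> \<le> C0 * rho l y powr (real ?k - a)"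
                unfolding C0_def using * by (intro mult_right_mono powr_mono) auto
              finally have "rho l x powr (real ?k - a) * norm (?w \<alpha> y) \<le> C0 * rho l y powr (real ?k - a) * norm (?w \<alpha> y)"
                by (rule mult_right_mono) simp
              then have le: "rho l x powr (real ?k - a) * norm (?w \<alpha> y) \<le> C0 * f \<alpha> y"
                using f_eq[OF y\<Omega>] by (simp add: mult.assoc)
              have "norm (D \<alpha> y) = norm (?w \<alpha> y)" using elim y\<Omega> by simp
              also have "\<dots> = rho l x powr (a - real ?k) * (rho l x powr (real ?k - a) * norm (?w \<alpha> y))"
                using \<rho> by (simp add: mult.assoc[symmetric] powr_add[symmetric])
              also have "\<dots> \<le> rho l x powr (a - real ?k) * (C0 * f \<alpha> y)"
                by (intro mult_left_mono le) simp
              finally show "norm (D \<alpha> y) \<le> ?c * f \<alpha> y" by (simp add: mult_ac)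
            qed
          qed
        qed
        also have "\<dots> = ?c * (LINT y:ball x \<tau>|lebesgue. f \<alpha> y)" by (rule set_integral_mult_right)
        also have "\<dots> \<le> ?c * (g \<alpha> x * \<tau> ^ CARD('n))" by (intro mult_left_mono fx c0)
        also have "\<dots> = rho l x powr (a - real ?k) * (C0 * g \<alpha> x) * \<tau> ^ CARD('n)" by (simp add: mult_ac)
        \<comment> \<open>Powers of \<open>rho l x\<close> in the denominator become powers of
          \<open>rho l x / 2\<close>, the radius \<open>R\<close> of the product estimate.\<close>
        also have "\<dots> \<le> (rho l x powr a / (rho l x / 2) ^ ?k) * S x * \<tau> ^ CARD('n)"
        proof (intro mult_right_mono mult_mono)
          have "rho l x powr (a - real ?k) = rho l x powr a / rho l x ^ ?k"
            using \<rho> by (simp add: powr_diff powr_realpow)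
          also have "\<dots> \<le> rho l x powr a / (rho l x / 2) ^ ?k"
            using \<rho> by (intro divide_left_mono power_mono mult_pos_pos zero_less_power) auto
          finally show "rho l x powr (a - real ?k) \<le> rho l x powr a / (rho l x / 2) ^ ?k" .
          have "g \<alpha> x \<le> (\<Sum>\<alpha>\<in>?A. g \<alpha> x)"
            using * g(2) by (intro member_le_sum fA) auto
          then show "C0 * g \<alpha> x \<le> S x" unfolding S_def using C0 by (intro mult_left_mono) auto
          show "0 \<le> rho l x powr a / (rho l x / 2) ^ ?k" using \<rho> by simp
          show "0 \<le> C0 * g \<alpha> x" using C0 g(2)[of \<alpha> x] * by simp
          show "0 \<le> \<tau> ^ CARD('n)" using * by simp
        qed
        finally show "(LINT y:ball x \<tau>|lebesgue. norm (D \<alpha> y))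
          \<le> (rho l x powr a * S x) / (rho l x / 2) ^ ?k * \<tau> ^ CARD('n)" by simp
      qed
    qed
    then show ?thesis using wf Sm S0 Si Sint by (intro exI[of _ D] exI[of _ S]) (simp add: D_def)
  qed
  ultimately show ?thesis by blast
qed

lemma Linf_norm_bound:
  assumes "u \<in> Linf_space"
  shows "0 \<le> Linf_norm u" "AE x in lebesgue. norm (u x) \<le> Linf_norm u"
proof -
  have ae: "AE x in lebesgue. ereal (norm (u x)) \<le> Linf_esssup u"
    unfolding Linf_esssup_def by (rule esssup_AE)
  have fin: "Linf_esssup u < \<infinity>" using assms by (simp add: Linf_space_def)
  \<comment> \<open>Excludes negative values, including minus infinity, which
    \<open>real_of_ereal\<close> would send to 0. A negative almost everywhere bound on a norm would
    force the space to be null.\<close>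
  have "Linf_esssup u \<ge> 0"
  proof (rule ccontr)
    assume "\<not> Linf_esssup u \<ge> 0"
    with ae have "AE x in (lebesgue :: (real, 'a) vec measure). False"
      by (auto elim!: eventually_mono) (metis ereal_less_eq(5) norm_ge_zero order_trans)
    then have "emeasure lebesgue (UNIV :: (real, 'a) vec set) = 0"
      using AE_iff_measurable[of UNIV "lebesgue :: (real, 'a) vec measure" "\<lambda>_. False"] by simp
    then show False by simp
  qed
  with fin obtain r where r: "Linf_esssup u = ereal r" "r \<ge> 0" by (cases "Linf_esssup u") auto
  then show "0 \<le> Linf_norm u" by (simp add: Linf_norm_def)
  show "AE x in lebesgue. norm (u x) \<le> Linf_norm u"
    using ae by eventually_elim (simp add: Linf_norm_def r)
qed

lemma ball_average_le:
  fixes u :: "real^'n::finite \<Rightarrow> 'b::euclidean_space"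
  assumes "set_integrable lebesgue (ball x \<tau>) u" "AE x in lebesgue. norm (u x) \<le> U" "\<tau> > 0"
  shows "(LINT y:ball x \<tau>|lebesgue. norm (u y)) \<le> U * unit_ball_vol CARD('n) * \<tau> ^ CARD('n)"
proof -
  have "set_integrable lebesgue (ball x \<tau>) (\<lambda>_. U)"
    unfolding set_integrable_def
    by (intro integrable_scaleR_left integrable_real_indicator)
      (use emeasure_bounded_finite[OF bounded_ball, of x \<tau>] in auto)
  then have "(LINT y:ball x \<tau>|lebesgue. norm (u y)) \<le> (LINT y:ball x \<tau>|lebesgue. U)"
    using assms by (intro set_integral_mono_AE set_integrable_norm) auto
  also have "\<dots> = U * measure lebesgue (ball x \<tau>)" by (simp add: set_lebesgue_integral_def)
  also have "measure lebesgue (ball x \<tau>) = unit_ball_vol CARD('n) * \<tau> ^ CARD('n)"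
    using content_ball[of \<tau> x] assms(3) by simp
  finally show ?thesis by (simp add: mult.assoc)
qed

lemma set_integrable_compact_Lp:
  fixes S :: "'a::euclidean_space \<Rightarrow> real"
  assumes S: "S \<in> borel_measurable lebesgue" "\<And>x. 0 \<le> S x" "integrable lebesgue (\<lambda>x. S x powr p)"
    and p: "1 \<le> p" and K: "compact K"
  shows "set_integrable lebesgue K S"
  unfolding set_integrable_def
proof (rule Bochner_Integration.integrable_bound)
  have "integrable lebesgue (indicator K :: 'a \<Rightarrow> real)"
    using emeasure_bounded_finite[OF compact_imp_bounded[OF K]] K
    by (intro integrable_real_indicator) (auto simp: borel_compact)
  then show "integrable lebesgue (\<lambda>x. indicator K x + S x powr p)"
    by (intro Bochner_Integration.integrable_add S)
  show "(\<lambda>x. indicator K x *\<^sub>R S x) \<in> borel_measurable lebesgue"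
    using K by (intro borel_measurable_scaleR borel_measurable_indicator S) (auto simp: borel_compact)
  have "S x \<le> 1 + S x powr p" for x
  proof (cases "S x \<le> 1")
    case False
    then have "S x powr 1 \<le> S x powr p" using p by (intro powr_mono) auto
    then show ?thesis using False by simp
  qed (simp add: add_increasing2)
  then show "AE x in lebesgue. norm (indicator K x *\<^sub>R S x) \<le> norm (indicator K x + S x powr p)"
    using S(2) by (intro AE_I2) (auto simp: indicator_def)
qed

lemma powr_add_le:
  fixes x y p :: real
  assumes "0 \<le> x" "0 \<le> y" "0 < p"
  shows "(x + y) powr p \<le> 2 powr p * (x powr p + y powr p)"
  using sum_powr_le[of "{True, False}" "\<lambda>b. if b then x else y" p] assms by simp

lemma norm_sum_list_le:
  fixes h :: "'c \<Rightarrow> 'b::real_normed_vector"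
  assumes "\<And>c. c \<in> set cs \<Longrightarrow> norm (h c) \<le> B"
  shows "norm (\<Sum>c\<leftarrow>cs. h c) \<le> real (length cs) * B"
  using assms
proof (induction cs)
  case (Cons c cs)
  have "norm (h c + (\<Sum>c\<leftarrow>cs. h c)) \<le> B + real (length cs) * B"
    by (rule order_trans[OF norm_triangle_ineq add_mono]) (use Cons in auto)
  then show ?case by (simp add: algebra_simps)
qed simp

section \<open>The product estimate in Kondratiev spaces\<close>

text \<open>Positive bounds \<open>U\<close> and \<open>V\<close> take the place of the sup norms,
  because the balancing parameters divide by them. So a vanishing norm needs no separate case; it is
  approached from above afterwards.\<close>

lemma kondratiev_product:
  fixes p a :: real and m l :: nat
  assumes p: "1 < p"
  shows "\<exists>c\<ge>0. \<forall>(u :: real^'n::{finite,linorder} \<Rightarrow> 'b::{real_normed_field, euclidean_space}) v U V.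
    u \<in> kondratiev_space m a p l \<longrightarrow> v \<in> kondratiev_space m a p l \<longrightarrow> 0 < U \<longrightarrow> 0 < V \<longrightarrow>
    (AE x in lebesgue. norm (u x) \<le> U) \<longrightarrow> (AE x in lebesgue. norm (v x) \<le> V) \<longrightarrow>
    (\<lambda>x. u x * v x) \<in> kondratiev_space m a p l \<and>
    kondratiev_norm m a p l (\<lambda>x. u x * v x)
      \<le> c * (V * kondratiev_norm m a p l u + U * kondratiev_norm m a p l v)"
proof -
  let ?\<Omega> = "- Rstar l :: (real, 'n) vec set"
  let ?A = "{\<alpha> :: 'n \<Rightarrow> nat. mi_order \<alpha> \<le> m}"
  let ?r = "\<lambda>x :: (real, 'n) vec. rho l x / 2"
  note fA = finite_mi_order[where 'n = 'n and m = m]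
  have \<Omega>: "open ?\<Omega>" by (rule open_Compl_Rstar)
  define \<omega> where "\<omega> = unit_ball_vol (real CARD('n))"
  have \<omega>: "\<omega> > 0" by (simp add: \<omega>_def)
  from kondratiev_envelope[OF p, of m a, where 'b = 'b] obtain CE where CE: "CE \<ge> 0"
    "\<And>u :: (real, 'n) vec \<Rightarrow> 'b. u \<in> kondratiev_space m a p l \<Longrightarrow>
    (\<exists>D S. weak_family ?\<Omega> m D \<and> D (\<lambda>_. 0) = u \<and> S \<in> borel_measurable lebesgue \<and> (\<forall>x. 0 \<le> S x) \<and>
      integrable lebesgue (\<lambda>x. S x powr p) \<and> (LINT x|lebesgue. S x powr p) \<le> CE * kondratiev_norm m a p l u powr p \<and>
      (AE x in lebesgue. x \<in> ?\<Omega> \<longrightarrow> (\<forall>\<alpha> \<tau>. mi_order \<alpha> \<le> m \<and> 0 < \<tau> \<and> \<tau> \<le> ?r x \<longrightarrow>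
        (LINT y:ball x \<tau>|lebesgue. norm (D \<alpha> y))
          \<le> (rho l x powr a * S x) / ?r x ^ mi_order \<alpha> * \<tau> ^ CARD('n))))" by blast
  obtain \<phi> :: "(real, 'n) vec \<Rightarrow> real" where \<phi>: "\<phi> \<in> bumps" "(LINT x|lborel. \<phi> x) = 1" "euler \<phi> \<in> moment (Suc m)"
    using exists_moment_bump by blast
  define good :: "('n \<Rightarrow> nat) \<Rightarrow> ('n \<Rightarrow> nat) \<Rightarrow> real \<Rightarrow> bool" where "good \<gamma> \<epsilon> C \<longleftrightarrow> C \<ge> 0 \<and>
    (\<forall>\<Omega> m (D :: ('n \<Rightarrow> nat) \<Rightarrow> (real, 'n) vec \<Rightarrow> 'b) (E :: ('n \<Rightarrow> nat) \<Rightarrow> (real, 'n) vec \<Rightarrow> 'b) s R x U V S T.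
    weak_family \<Omega> m D \<longrightarrow> weak_family \<Omega> m E \<longrightarrow> mi_order \<gamma> + mi_order \<epsilon> \<le> m \<longrightarrow> 0 < s \<longrightarrow> s \<le> R \<longrightarrow> cball x R \<subseteq> \<Omega> \<longrightarrow>
    0 < U \<longrightarrow> 0 < V \<longrightarrow> 0 \<le> S \<longrightarrow> 0 \<le> T \<longrightarrow>
    (\<forall>\<tau>. 0 < \<tau> \<and> \<tau> \<le> R \<longrightarrow> (LINT y:ball x \<tau>|lebesgue. norm (D (\<lambda>_. 0) y)) \<le> U * \<tau> ^ CARD('n)) \<longrightarrow>
    (\<forall>\<tau>. 0 < \<tau> \<and> \<tau> \<le> R \<longrightarrow> (LINT y:ball x \<tau>|lebesgue. norm (E (\<lambda>_. 0) y)) \<le> V * \<tau> ^ CARD('n)) \<longrightarrow>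
    (\<forall>\<alpha> \<tau>. mi_order \<alpha> \<le> mi_order \<gamma> + mi_order \<epsilon> \<and> 0 < \<tau> \<and> \<tau> \<le> R \<longrightarrow>
      (LINT y:ball x \<tau>|lebesgue. norm (D \<alpha> y)) \<le> S / R ^ mi_order \<alpha> * \<tau> ^ CARD('n)) \<longrightarrow>
    (\<forall>\<alpha> \<tau>. mi_order \<alpha> \<le> mi_order \<gamma> + mi_order \<epsilon> \<and> 0 < \<tau> \<and> \<tau> \<le> R \<longrightarrow>
      (LINT y:ball x \<tau>|lebesgue. norm (E \<alpha> y)) \<le> T / R ^ mi_order \<alpha> * \<tau> ^ CARD('n)) \<longrightarrow>
    R ^ (mi_order \<gamma> + mi_order \<epsilon>) * (norm (mollify (D \<gamma>) \<phi> s x) * norm (mollify (E \<epsilon>) \<phi> s x)) \<le> C * (V * S + U * T))"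
    for \<gamma> \<epsilon> C
  \<comment> \<open>The constant of \<open>norm_mollify_product\<close> depends on the pair of
    orders' multi-indices. There are finitely many pairs of total order at most \<open>m\<close>,
    and the sum of their constants serves all of them.\<close>
  let ?P = "{z :: ('n \<Rightarrow> nat) \<times> ('n \<Rightarrow> nat). mi_order (fst z) + mi_order (snd z) \<le> m}"
  have fP: "finite ?P" by (rule finite_subset[of _ "?A \<times> ?A"]) (auto intro: fA)
  have "\<forall>z\<in>?P. \<exists>C. good (fst z) (snd z) C"
  proof
    fix z assume "z \<in> ?P"
    then have "mi_order (fst z) + mi_order (snd z) \<le> Suc m" by simp
    from norm_mollify_product[OF \<phi>(1,3) this refl, where 'b = 'b]
    show "\<exists>C. good (fst z) (snd z) C" unfolding good_def by blast
  qed
  from bchoice[OF this] obtain Cp where Cp: "\<forall>z\<in>?P. good (fst z) (snd z) (Cp z)" by blast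
  define CP where "CP = (\<Sum>z\<in>?P. Cp z)"
  have Cp0: "0 \<le> Cp z" if "z \<in> ?P" for z
    using bspec[OF Cp that] unfolding good_def by (rule conjunct1)
  have CP0: "CP \<ge> 0" unfolding CP_def using Cp0 by (rule sum_nonneg)
  \<comment> \<open>The Leibniz rule contributes \<open>2 ^ n\<close> terms and the radius
    \<open>rho l x / 2\<close> another \<open>2 ^ n\<close>, with \<open>n \<le> m\<close>. The
    volume \<open>\<omega>\<close> arises because averages are normalised by a power of the
    radius.\<close>
  define M1 where "M1 = 4 ^ m * CP * \<omega>"
  have M1: "M1 \<ge> 0" using CP0 \<omega> by (simp add: M1_def)
  \<comment> \<open>\<open>2 powr p\<close> comes from the power of a sum and \<open>CE\<close> from
    the envelopes; the last 2 arises because both \<open>V * ?Ku\<close> and \<open>U * ?Kv\<close>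
    are bounded by their sum \<open>Z\<close>.\<close>
  define Q where "Q = M1 powr p * (2 powr p * (CE * 2))"
  have Q: "Q \<ge> 0" using CE(1) by (simp add: Q_def)
  define c where "c = (real (card ?A) * Q) powr (1 / p)"
  have main: "(\<lambda>x. u x * v x) \<in> kondratiev_space m a p l \<and>
    kondratiev_norm m a p l (\<lambda>x. u x * v x) \<le> c * (V * kondratiev_norm m a p l u + U * kondratiev_norm m a p l v)"
    if u: "u \<in> kondratiev_space m a p l" and v: "v \<in> kondratiev_space m a p l" and UV: "0 < U" "0 < V"
      and bu: "AE x in lebesgue. norm (u x) \<le> U" and bv: "AE x in lebesgue. norm (v x) \<le> V"
    for u v :: "(real, 'n) vec \<Rightarrow> 'b" and U V :: real
  proof -
    obtain D S where D: "weak_family ?\<Omega> m D" "D (\<lambda>_. 0) = u" and S: "S \<in> borel_measurable lebesgue" "\<And>x. 0 \<le> S x"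
      "integrable lebesgue (\<lambda>x. S x powr p)" "(LINT x|lebesgue. S x powr p) \<le> CE * kondratiev_norm m a p l u powr p"
      and DS: "AE x in lebesgue. x \<in> ?\<Omega> \<longrightarrow> (\<forall>\<alpha> \<tau>. mi_order \<alpha> \<le> m \<and> 0 < \<tau> \<and> \<tau> \<le> ?r x \<longrightarrow>
        (LINT y:ball x \<tau>|lebesgue. norm (D \<alpha> y)) \<le> (rho l x powr a * S x) / ?r x ^ mi_order \<alpha> * \<tau> ^ CARD('n))"
      using CE(2)[OF u] by blast
    obtain E T where E: "weak_family ?\<Omega> m E" "E (\<lambda>_. 0) = v" and T: "T \<in> borel_measurable lebesgue" "\<And>x. 0 \<le> T x"
      "integrable lebesgue (\<lambda>x. T x powr p)" "(LINT x|lebesgue. T x powr p) \<le> CE * kondratiev_norm m a p l v powr p"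
      and ET: "AE x in lebesgue. x \<in> ?\<Omega> \<longrightarrow> (\<forall>\<alpha> \<tau>. mi_order \<alpha> \<le> m \<and> 0 < \<tau> \<and> \<tau> \<le> ?r x \<longrightarrow>
        (LINT y:ball x \<tau>|lebesgue. norm (E \<alpha> y)) \<le> (rho l x powr a * T x) / ?r x ^ mi_order \<alpha> * \<tau> ^ CARD('n))"
      using CE(2)[OF v] by blast
    \<comment> \<open>Chosen so that \<open>?r x ^ n * G n x\<close> is the right-hand side of the
      pointwise product estimate. The factor \<open>rho l x powr a\<close> later cancels against the
      weight in the norm.\<close>
    define h where "h n x = CP * \<omega> * rho l x powr a / ?r x ^ n" for n :: nat and x :: "(real, 'n) vec"
    define G where "G n x = h n x *\<^sub>R (V * S x + U * T x)" for n x
    have VSUT: "0 \<le> V * S x + U * T x" for x using UV S(2) T(2) by simp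
    have h0: "0 \<le> h n x" for n x using CP0 \<omega> rho_nonneg[of l x] by (simp add: h_def)
    have G0: "0 \<le> G n x" for n x using h0 VSUT by (simp add: G_def)
    have rho_m: "rho l \<in> borel_measurable (borel :: (real, 'n) vec measure)"
      by (rule borel_measurable_continuous_onI[OF continuous_rho])
    have h_m: "h n \<in> borel_measurable lebesgue" for n
    proof -
      note [measurable] = rho_m
      have "h n \<in> borel_measurable lborel" unfolding h_def by measurable
      then show ?thesis by (rule measurable_completion)
    qed
    have liG: "locally_integrable ?\<Omega> (G n)" for n
      unfolding locally_integrable_def
    proof safe
      fix K :: "(real, 'n) vec set" assume K: "compact K" "K \<subseteq> ?\<Omega>"
      have iST: "integrable lebesgue (\<lambda>x. indicator K x *\<^sub>R (V * S x + U * T x))"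
      proof -
        have "set_integrable lebesgue K S" "set_integrable lebesgue K T"
          using p by (auto intro!: set_integrable_compact_Lp[OF _ _ _ _ K(1), of _ p] S T)
        then have "set_integrable lebesgue K (\<lambda>x. V * S x + U * T x)"
          by (intro set_integral_add(1) set_integrable_mult_right)
        then show ?thesis by (simp add: set_integrable_def)
      qed
      have "continuous_on K (h n)"
        unfolding h_def using K(2) rho_pos
        by (intro continuous_intros continuous_rho) (use K(2) rho_pos in \<open>force+\<close>)
      then have "compact (h n ` K)" by (rule compact_continuous_image[OF _ K(1)])
      then obtain B where B: "\<And>x. x \<in> K \<Longrightarrow> norm (h n x) \<le> B" using compact_imp_bounded by (force simp: bounded_iff)
      have "integrable lebesgue (\<lambda>x. (indicator K x * h n x) *\<^sub>R (indicator K x *\<^sub>R (V * S x + U * T x)))"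
      proof (rule integrable_bounded_scaleR[OF iST])
        show "(\<lambda>x. indicator K x * h n x) \<in> borel_measurable lebesgue"
          using K(1) by (intro borel_measurable_times borel_measurable_indicator h_m) (auto simp: borel_compact)
        show "\<bar>indicator K x * h n x\<bar> \<le> max B 0" for x
          using B[of x] by (cases "x \<in> K") auto
      qed
      also have "(\<lambda>x. (indicator K x * h n x) *\<^sub>R (indicator K x *\<^sub>R (V * S x + U * T x))) = (\<lambda>x. indicator K x *\<^sub>R G n x)"
        by (auto simp: fun_eq_iff G_def indicator_def)
      finally show "set_integrable lebesgue K (G n)" by (simp add: set_integrable_def)
    qed
    have dom: "product_dominated ?\<Omega> D E \<phi> ?r \<gamma> \<epsilon> (G (mi_order \<gamma> + mi_order \<epsilon>))"
      if ord: "mi_order \<gamma> + mi_order \<epsilon> \<le> m" for \<gamma> \<epsilon>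
      unfolding product_dominated_def
    proof (intro conjI liG)
      let ?n = "mi_order \<gamma> + mi_order \<epsilon>"
      show "AE x in lebesgue. x \<in> ?\<Omega> \<longrightarrow> (\<forall>s. 0 < s \<and> s \<le> ?r x \<longrightarrow>
        norm (mollify (D \<gamma>) \<phi> s x) * norm (mollify (E \<epsilon>) \<phi> s x) \<le> G ?n x)"
        using DS ET
      proof eventually_elim
        case (elim x)
        show ?case
        proof (intro impI allI)
          fix s assume x: "x \<in> ?\<Omega>" and s: "0 < s \<and> s \<le> ?r x"
          have \<rho>: "rho l x > 0" by (rule rho_pos[OF x])
          have sub: "cball x (?r x) \<subseteq> ?\<Omega>" by (rule rho_cball_subset[OF x])
          have z: "mi_order (\<lambda>_::'n. 0) = 0" by (simp add: mi_order_0_iff)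
          have bU: "\<forall>\<tau>. 0 < \<tau> \<and> \<tau> \<le> ?r x \<longrightarrow> (LINT y:ball x \<tau>|lebesgue. norm (D (\<lambda>_. 0) y)) \<le> (U * \<omega>) * \<tau> ^ CARD('n)"
          proof (intro allI impI)
            fix \<tau> assume \<tau>: "0 < \<tau> \<and> \<tau> \<le> ?r x"
            have "set_integrable lebesgue (ball x \<tau>) (D (\<lambda>_. 0))"
              using \<tau> z by (intro weak_family_integrable_ball(1)[OF D(1) _ sub]) auto
            then show "(LINT y:ball x \<tau>|lebesgue. norm (D (\<lambda>_. 0) y)) \<le> (U * \<omega>) * \<tau> ^ CARD('n)"
              unfolding \<omega>_def D(2) using bu \<tau> by (intro ball_average_le) auto
          qed
          have bV: "\<forall>\<tau>. 0 < \<tau> \<and> \<tau> \<le> ?r x \<longrightarrow> (LINT y:ball x \<tau>|lebesgue. norm (E (\<lambda>_. 0) y)) \<le> (V * \<omega>) * \<tau> ^ CARD('n)"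
          proof (intro allI impI)
            fix \<tau> assume \<tau>: "0 < \<tau> \<and> \<tau> \<le> ?r x"
            have "set_integrable lebesgue (ball x \<tau>) (E (\<lambda>_. 0))"
              using \<tau> z by (intro weak_family_integrable_ball(1)[OF E(1) _ sub]) auto
            then show "(LINT y:ball x \<tau>|lebesgue. norm (E (\<lambda>_. 0) y)) \<le> (V * \<omega>) * \<tau> ^ CARD('n)"
              unfolding \<omega>_def E(2) using bv \<tau> by (intro ball_average_le) auto
          qed
          have "(\<gamma>, \<epsilon>) \<in> ?P" using ord by simp
          then have gd: "good \<gamma> \<epsilon> (Cp (\<gamma>, \<epsilon>))" "Cp (\<gamma>, \<epsilon>) \<le> CP"
            using Cp Cp0 fP by (auto simp: CP_def intro!: member_le_sum)
          have "?r x ^ ?n * (norm (mollify (D \<gamma>) \<phi> s x) * norm (mollify (E \<epsilon>) \<phi> s x))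
            \<le> Cp (\<gamma>, \<epsilon>) * ((V * \<omega>) * (rho l x powr a * S x) + (U * \<omega>) * (rho l x powr a * T x))"
          proof (rule gd(1)[unfolded good_def, THEN conjunct2, rule_format, OF D(1) E(1) ord])
            show "0 < s" "s \<le> ?r x" "cball x (?r x) \<subseteq> ?\<Omega>" using s sub by auto
            show "0 < U * \<omega>" "0 < V * \<omega>" using UV \<omega> by auto
            show "0 \<le> rho l x powr a * S x" "0 \<le> rho l x powr a * T x" using S(2) T(2) by auto
            show "(LINT y:ball x \<tau>|lebesgue. norm (D (\<lambda>_. 0) y)) \<le> U * \<omega> * \<tau> ^ CARD('n)" if "0 < \<tau> \<and> \<tau> \<le> ?r x" for \<tau>
              using bU that by blast
            show "(LINT y:ball x \<tau>|lebesgue. norm (E (\<lambda>_. 0) y)) \<le> V * \<omega> * \<tau> ^ CARD('n)" if "0 < \<tau> \<and> \<tau> \<le> ?r x" for \<tau>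
              using bV that by blast
            show "(LINT y:ball x \<tau>|lebesgue. norm (D \<alpha> y)) \<le> rho l x powr a * S x / ?r x ^ mi_order \<alpha> * \<tau> ^ CARD('n)"
              if "mi_order \<alpha> \<le> ?n \<and> 0 < \<tau> \<and> \<tau> \<le> ?r x" for \<alpha> \<tau>
              using elim(1) x that ord by (meson order_trans)
            show "(LINT y:ball x \<tau>|lebesgue. norm (E \<alpha> y)) \<le> rho l x powr a * T x / ?r x ^ mi_order \<alpha> * \<tau> ^ CARD('n)"
              if "mi_order \<alpha> \<le> ?n \<and> 0 < \<tau> \<and> \<tau> \<le> ?r x" for \<alpha> \<tau>
              using elim(2) x that ord by (meson order_trans)
          qed
          also have "\<dots> \<le> CP * ((V * \<omega>) * (rho l x powr a * S x) + (U * \<omega>) * (rho l x powr a * T x))"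
            using gd(2) UV \<omega> S(2) T(2) by (intro mult_right_mono add_nonneg_nonneg mult_nonneg_nonneg) auto
          also have "\<dots> = ?r x ^ ?n * G ?n x"
            using \<rho> by (simp add: G_def h_def field_simps)
          finally show "norm (mollify (D \<gamma>) \<phi> s x) * norm (mollify (E \<epsilon>) \<phi> s x) \<le> G ?n x"
            using \<rho> by (simp add: mult_le_cancel_left_pos)
        qed
      qed
    qed
    define W where "W \<alpha> x = (\<Sum>(\<gamma>, \<epsilon>)\<leftarrow>leibniz (mi_word \<alpha>) (\<lambda>_. 0) (\<lambda>_. 0). D \<gamma> x * E \<epsilon> x)" for \<alpha> x
    have z: "mi_order (\<lambda>_::'n. 0) = 0" by (simp add: mi_order_0_iff)
    have hw: "has_weak_derivative ?\<Omega> \<alpha> (\<lambda>x. u x * v x) (W \<alpha>)" if "mi_order \<alpha> \<le> m" for \<alpha>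
      unfolding W_def[abs_def] D(2)[symmetric] E(2)[symmetric]
    proof (rule has_weak_derivative_product[OF \<Omega> D(1) E(1) that \<phi>(1,2), where r = ?r])
      show "?r x > 0 \<and> cball x (?r x) \<subseteq> ?\<Omega>" if "x \<in> ?\<Omega>" for x
        using rho_pos[OF that] rho_cball_subset[OF that] by simp
      show "continuous_on ?\<Omega> ?r" by (intro continuous_intros continuous_rho) simp
      show "product_dominated ?\<Omega> D E \<phi> ?r (\<lambda>_. 0) (\<lambda>_. 0) (G 0)"
        using dom[of "\<lambda>_. 0" "\<lambda>_. 0"] by (simp add: z)
      show "product_dominated ?\<Omega> D E \<phi> ?r \<gamma> \<epsilon> (G (mi_order \<alpha>))" if "mi_order \<gamma> + mi_order \<epsilon> = mi_order \<alpha>" for \<gamma> \<epsilon>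
        using dom[of \<gamma> \<epsilon>] that \<open>mi_order \<alpha> \<le> m\<close> by simp
    qed
    have Wle: "AE x in lebesgue. x \<in> ?\<Omega> \<longrightarrow> norm (W \<alpha> x) \<le> 2 ^ mi_order \<alpha> * G (mi_order \<alpha>) x" if \<alpha>: "mi_order \<alpha> \<le> m" for \<alpha>
    proof -
      let ?L = "leibniz (mi_word \<alpha>) (\<lambda>_. 0) (\<lambda>_. 0)"
      have "AE x in lebesgue. x \<in> ?\<Omega> \<longrightarrow> norm (D (fst z) x * E (snd z) x) \<le> G (mi_order \<alpha>) x" if "z \<in> set ?L" for z
      proof -
        have o: "mi_order (fst z) + mi_order (snd z) = mi_order \<alpha>"
          using leibniz_order[of "fst z" "snd z" "mi_word \<alpha>"] that by (simp add: length_mi_word \<open>mi_order (\<lambda>_::'n. 0) = 0\<close>)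
        show ?thesis
          by (rule AE_product_le[OF \<Omega> D(1) E(1) _ _ \<phi>(1,2), where r = ?r])
            (use o \<alpha> dom[of "fst z" "snd z"] rho_pos in auto)
      qed
      then have "AE x in lebesgue. \<forall>z\<in>set ?L. x \<in> ?\<Omega> \<longrightarrow> norm (D (fst z) x * E (snd z) x) \<le> G (mi_order \<alpha>) x"
        by (intro AE_finite_allI) auto
      then show ?thesis
      proof eventually_elim
        case (elim x)
        show ?case
        proof
          assume "x \<in> ?\<Omega>"
          then have "norm (\<Sum>z\<leftarrow>?L. D (fst z) x * E (snd z) x) \<le> real (length ?L) * G (mi_order \<alpha>) x"
            using elim by (intro norm_sum_list_le) auto
          then show "norm (W \<alpha> x) \<le> 2 ^ mi_order \<alpha> * G (mi_order \<alpha>) x"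
            by (simp add: W_def case_prod_beta' length_leibniz length_mi_word)
        qed
      qed
    qed
    let ?uv = "\<lambda>x. u x * v x"
    let ?wd = "\<lambda>\<alpha>. weak_derivative ?\<Omega> \<alpha> ?uv"
    have wd: "has_weak_derivative ?\<Omega> \<alpha> ?uv (?wd \<alpha>)" if "mi_order \<alpha> \<le> m" for \<alpha>
      unfolding weak_derivative_def using hw[OF that] by (rule someI[where P = "has_weak_derivative ?\<Omega> \<alpha> ?uv"])
    \<comment> \<open>After weighting, no power of \<open>rho\<close> is left, so one integrable
      majorant on the whole space serves every derivative of the product.\<close>
    define H where "H x = M1 powr p * (2 powr p * (V powr p * S x powr p + U powr p * T x powr p))" for x
    have H: "integrable lebesgue H" unfolding H_def
      by (intro integrable_mult_right Bochner_Integration.integrable_add S T)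
    have ki: "AE x in lebesgue. x \<in> ?\<Omega> \<longrightarrow> kondratiev_integrand a p l \<alpha> ?uv x \<le> H x" if \<alpha>: "mi_order \<alpha> \<le> m" for \<alpha>
      using Wle[OF \<alpha>] weak_derivative_unique[OF \<Omega> wd[OF \<alpha>] hw[OF \<alpha>]]
    proof eventually_elim
      case (elim x)
      show ?case
      proof
        assume x: "x \<in> ?\<Omega>"
        let ?n = "mi_order \<alpha>"
        have \<rho>: "rho l x > 0" by (rule rho_pos[OF x])
        have "norm (rho l x powr (real ?n - a) *\<^sub>R ?wd \<alpha> x) = rho l x powr (real ?n - a) * norm (W \<alpha> x)"
          using elim x by simp
        also have "\<dots> \<le> rho l x powr (real ?n - a) * (2 ^ ?n * G ?n x)"
          using elim x by (intro mult_left_mono) auto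
        also have "\<dots> = (4 ^ ?n * CP * \<omega>) * (V * S x + U * T x)"
        proof -
          have "(4 :: real) ^ ?n = 2 ^ ?n * 2 ^ ?n" by (simp add: power_mult_distrib[symmetric])
          then show ?thesis using \<rho>
            by (simp add: G_def h_def powr_diff powr_realpow power_divide field_simps)
        qed
        also have "\<dots> \<le> M1 * (V * S x + U * T x)"
          unfolding M1_def using CP0 \<omega> VSUT \<alpha> by (intro mult_right_mono power_increasing) auto
        finally have "kondratiev_integrand a p l \<alpha> ?uv x \<le> (M1 * (V * S x + U * T x)) powr p"
          unfolding kondratiev_integrand_def using p by (intro powr_mono2) auto
        also have "\<dots> = M1 powr p * (V * S x + U * T x) powr p"
          using M1 VSUT by (simp add: powr_mult)
        also have "\<dots> \<le> M1 powr p * (2 powr p * ((V * S x) powr p + (U * T x) powr p))"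
          using p UV S(2) T(2) by (intro mult_left_mono powr_add_le) auto
        also have "\<dots> = H x" unfolding H_def using UV S(2) T(2) by (simp add: powr_mult)
        finally show "kondratiev_integrand a p l \<alpha> ?uv x \<le> H x" .
      qed
    qed
    have kset: "set_integrable lebesgue ?\<Omega> (kondratiev_integrand a p l \<alpha> ?uv)" if \<alpha>: "mi_order \<alpha> \<le> m" for \<alpha>
      unfolding set_integrable_def
    proof (rule Bochner_Integration.integrable_bound[OF H])
      have mw: "(\<lambda>x. indicator ?\<Omega> x *\<^sub>R ?wd \<alpha> x) \<in> borel_measurable lebesgue"
        by (rule locally_integrable_measurable[OF \<Omega>]) (use wd[OF \<alpha>] in \<open>simp add: has_weak_derivative_def\<close>)
      have mr: "rho l \<in> borel_measurable (lebesgue :: (real, 'n) vec measure)"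
        by (rule measurable_completion) (simp add: rho_m)
      have "(\<lambda>x. norm (rho l x powr (real (mi_order \<alpha>) - a) *\<^sub>R (indicator ?\<Omega> x *\<^sub>R ?wd \<alpha> x)) powr p) \<in> borel_measurable lebesgue"
        by (rule powr_real_measurable[OF measurable_compose[OF borel_measurable_scaleR[OF
              powr_real_measurable[OF mr borel_measurable_const] mw] borel_measurable_norm] borel_measurable_const])
      moreover have "norm (rho l x powr (real (mi_order \<alpha>) - a) *\<^sub>R (indicator ?\<Omega> x *\<^sub>R ?wd \<alpha> x)) powr p
          = indicator ?\<Omega> x *\<^sub>R kondratiev_integrand a p l \<alpha> ?uv x" for x
        by (cases "x \<in> ?\<Omega>") (simp_all add: kondratiev_integrand_def)
      ultimately show "(\<lambda>x. indicator ?\<Omega> x *\<^sub>R kondratiev_integrand a p l \<alpha> ?uv x) \<in> borel_measurable lebesgue"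
        by (simp only:)
      show "AE x in lebesgue. norm (indicator ?\<Omega> x *\<^sub>R kondratiev_integrand a p l \<alpha> ?uv x) \<le> norm (H x)"
        using ki[OF \<alpha>]
      proof eventually_elim
        case (elim x)
        then show ?case
          by (cases "x \<in> ?\<Omega>") (auto simp: kondratiev_integrand_def)
      qed
    qed
    have mem: "?uv \<in> kondratiev_space m a p l"
    proof -
      have "?uv \<in> borel_measurable (lebesgue_on ?\<Omega>)"
        using u v by (intro borel_measurable_times) (auto simp: kondratiev_space_def)
      then show ?thesis using hw kset unfolding kondratiev_space_def by blast
    qed
    let ?Ku = "kondratiev_norm m a p l u" and ?Kv = "kondratiev_norm m a p l v"
    define Z where "Z = V * ?Ku + U * ?Kv"
    have K0: "0 \<le> ?Ku" "0 \<le> ?Kv" by (auto simp: kondratiev_norm_def)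
    have Z0: "0 \<le> Z" unfolding Z_def using K0 UV by simp
    have int_le: "(LINT x:?\<Omega>|lebesgue. kondratiev_integrand a p l \<alpha> ?uv x) \<le> Q * Z powr p" if \<alpha>: "mi_order \<alpha> \<le> m" for \<alpha>
    proof -
      have "(LINT x:?\<Omega>|lebesgue. kondratiev_integrand a p l \<alpha> ?uv x) \<le> (LINT x|lebesgue. H x)"
        unfolding set_lebesgue_integral_def
      proof (rule integral_mono_AE[OF _ H])
        show "integrable lebesgue (\<lambda>x. indicator ?\<Omega> x *\<^sub>R kondratiev_integrand a p l \<alpha> ?uv x)"
          using kset[OF \<alpha>] by (simp add: set_integrable_def)
        have H0: "0 \<le> H x" for x by (simp add: H_def)
        show "AE x in lebesgue. indicator ?\<Omega> x *\<^sub>R kondratiev_integrand a p l \<alpha> ?uv x \<le> H x"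
          using ki[OF \<alpha>] by eventually_elim (use H0 in \<open>auto simp: indicator_def\<close>)
      qed
      also have "\<dots> = M1 powr p * (2 powr p * (V powr p * (LINT x|lebesgue. S x powr p) + U powr p * (LINT x|lebesgue. T x powr p)))"
        unfolding H_def using S(3) T(3) by simp
      also have "\<dots> \<le> M1 powr p * (2 powr p * (V powr p * (CE * ?Ku powr p) + U powr p * (CE * ?Kv powr p)))"
        by (intro mult_left_mono add_mono S T) auto
      also have "\<dots> = M1 powr p * (2 powr p * (CE * ((V * ?Ku) powr p + (U * ?Kv) powr p)))"
        using UV K0 by (simp add: powr_mult algebra_simps)
      also have "\<dots> \<le> M1 powr p * (2 powr p * (CE * (Z powr p + Z powr p)))"
        using UV K0 p CE(1) by (intro mult_left_mono add_mono powr_mono2) (auto simp: Z_def)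
      also have "\<dots> = Q * Z powr p" by (simp add: Q_def)
      finally show ?thesis .
    qed
    have "kondratiev_norm m a p l ?uv \<le> (real (card ?A) * Q * Z powr p) powr (1 / p)"
      unfolding kondratiev_norm_def
    proof (rule powr_mono2)
      show "0 \<le> (\<Sum>\<alpha>\<in>?A. LINT x:?\<Omega>|lebesgue. kondratiev_integrand a p l \<alpha> ?uv x)"
        unfolding set_lebesgue_integral_def
        by (intro sum_nonneg Bochner_Integration.integral_nonneg) (auto simp: kondratiev_integrand_def)
      have "(\<Sum>\<alpha>\<in>?A. LINT x:?\<Omega>|lebesgue. kondratiev_integrand a p l \<alpha> ?uv x) \<le> (\<Sum>\<alpha>\<in>?A. Q * Z powr p)"
        using int_le by (intro sum_mono) auto
      then show "(\<Sum>\<alpha>\<in>?A. LINT x:?\<Omega>|lebesgue. kondratiev_integrand a p l \<alpha> ?uv x) \<le> real (card ?A) * Q * Z powr p"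
        by (simp add: mult.assoc)
    qed (use p in simp)
    also have "\<dots> = c * Z"
      unfolding c_def using Q Z0 p by (simp add: powr_mult powr_powr)
    finally show ?thesis using mem by (simp add: Z_def)
  qed
  have "c \<ge> 0" by (simp add: c_def)
  with main show ?thesis by blast
qed

theorem theorem41:
  fixes p a :: real and m l :: nat
  assumes "1 < p" and "1 \<le> m" and "l < CARD('n::{finite,linorder})"
  shows "\<exists>c::real.
    \<forall>u \<in> kondratiev_space m a p l \<inter> Linf_space.
    \<forall>v \<in> kondratiev_space m a p l \<inter> Linf_space.
      (\<lambda>x. u x * v x) \<in> kondratiev_space m a p l \<and>
      kondratiev_norm m a p l
        ((\<lambda>x. u x * v x) :: real ^ 'n::{finite,linorder} \<Rightarrow> 'b::{real_normed_field, euclidean_space})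
      \<le> c * (kondratiev_norm m a p l u * Linf_norm v + kondratiev_norm m a p l v * Linf_norm u)"
proof -
  from kondratiev_product[OF assms(1), of m a, where 'b = 'b] obtain c where c:
    "\<And>(u :: (real, 'n) vec \<Rightarrow> 'b) v U V.
    u \<in> kondratiev_space m a p l \<Longrightarrow> v \<in> kondratiev_space m a p l \<Longrightarrow> 0 < U \<Longrightarrow> 0 < V \<Longrightarrow>
    (AE x in lebesgue. norm (u x) \<le> U) \<Longrightarrow> (AE x in lebesgue. norm (v x) \<le> V) \<Longrightarrow>
    (\<lambda>x. u x * v x) \<in> kondratiev_space m a p l \<and>
    kondratiev_norm m a p l (\<lambda>x. u x * v x)
      \<le> c * (V * kondratiev_norm m a p l u + U * kondratiev_norm m a p l v)"
    by blast
  show ?thesis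
  proof (intro exI[of _ c] ballI)
    fix u v :: "(real, 'n) vec \<Rightarrow> 'b"
    assume u: "u \<in> kondratiev_space m a p l \<inter> Linf_space" and v: "v \<in> kondratiev_space m a p l \<inter> Linf_space"
    let ?Ku = "kondratiev_norm m a p l u" and ?Kv = "kondratiev_norm m a p l v"
    \<comment> \<open>The norms may vanish, but \<open>kondratiev_product\<close> asks for positive
      bounds. Its constant does not depend on \<open>e\<close>, so \<open>e\<close> can tend to
      0.\<close>
    have eps: "(\<lambda>x. u x * v x) \<in> kondratiev_space m a p l \<and>
      kondratiev_norm m a p l (\<lambda>x. u x * v x) \<le> c * ((Linf_norm v + e) * ?Ku + (Linf_norm u + e) * ?Kv)" if e: "e > 0" for e
    proof (rule c)
      show "u \<in> kondratiev_space m a p l" "v \<in> kondratiev_space m a p l" using u v by auto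
      show "0 < Linf_norm u + e" "0 < Linf_norm v + e"
        using Linf_norm_bound(1)[of u] Linf_norm_bound(1)[of v] u v e by (auto intro: add_nonneg_pos)
      have "AE x in lebesgue. norm (u x) \<le> Linf_norm u" by (rule Linf_norm_bound) (use u in auto)
      then show "AE x in lebesgue. norm (u x) \<le> Linf_norm u + e" by eventually_elim (use e in simp)
      have "AE x in lebesgue. norm (v x) \<le> Linf_norm v" by (rule Linf_norm_bound) (use v in auto)
      then show "AE x in lebesgue. norm (v x) \<le> Linf_norm v + e" by eventually_elim (use e in simp)
    qed
    have "((\<lambda>e. c * ((Linf_norm v + e) * ?Ku + (Linf_norm u + e) * ?Kv))
      \<longlongrightarrow> c * ((Linf_norm v + 0) * ?Ku + (Linf_norm u + 0) * ?Kv)) (at_right 0)"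
      by (intro tendsto_intros)
    moreover have "\<forall>\<^sub>F e in at_right 0. kondratiev_norm m a p l (\<lambda>x. u x * v x)
      \<le> c * ((Linf_norm v + e) * ?Ku + (Linf_norm u + e) * ?Kv)"
      using eps by (intro eventually_at_rightI[of 0 1]) auto
    ultimately have "kondratiev_norm m a p l (\<lambda>x. u x * v x) \<le> c * ((Linf_norm v + 0) * ?Ku + (Linf_norm u + 0) * ?Kv)"
      by (rule tendsto_lowerbound) simp
    then show "(\<lambda>x. u x * v x) \<in> kondratiev_space m a p l \<and>
      kondratiev_norm m a p l (\<lambda>x. u x * v x) \<le> c * (?Ku * Linf_norm v + ?Kv * Linf_norm u)"
      using eps[of 1] by (simp add: mult.commute)
  qed
qed

end
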